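(* There exist an absolute constant $c>0$ and, for every normed space $X$ of type $2$, a number $\beta_X>0$ depending only on the type $2$ constant of $X$, such that the following holds. Let $T:\ell_2^n\to X$ be a linear operator with $\ell(T)^2\ge n$, where $X$ is a normed space of type $2$. Let $\alpha=c\log^{-3/2}(2\|T\|)$. Then there exists a subset $\sigma$ of $\{1,\dots,n\}$ of size $|\sigma|\ge\alpha^2n/\|T\|^2$ such that $$\|Tx\|\ge\alpha\,\beta_X\,\|x\|\qquad\text{for all }x\in\mathbb{R}^\sigma .$$
   Context: Spaces are real. $\ell(T)^2=\mathbb{E}\|Tg\|^2$, where $g=(g_1,\dots,g_n)$ and the $g_i$ are independent $N(0,1)$ random variables. $\|T\|$ is the operator norm, $\|x\|$ for $x\in\mathbb{R}^\sigma$ is the Euclidean norm, and $\mathbb{R}^\sigma$ is the coordinate subspace of vectors in $\mathbb{R}^n$ supported in $\sigma$. A normed space $X$ has type $2$ if there is a constant $M$ such that $\mathbb{E}\|\sum\varepsilon_ix_i\|\le M(\sum\|x_i\|^2)^{1/2}$ for all finite sequences $(x_i)$ in $X$, where $(\varepsilon_i)$ are independent symmetric $\pm1$-valued random variables; the minimal such $M$ is the type $2$ constant of $X$. *)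

theory Defs
  imports "HOL-Probability.Probability" "HOL-Library.Function_Algebras"
begin

instantiation "fun" :: (type, real_vector) real_vector
begin

definition scaleR_fun :: "real \<Rightarrow> ('a \<Rightarrow> 'b) \<Rightarrow> 'a \<Rightarrow> 'b"
  where "scaleR_fun r f = (\<lambda>x. r *\<^sub>R f x)"

instance
  by standard (simp_all add: scaleR_fun_def fun_eq_iff scaleR_add_right scaleR_add_left)

end

text \<open>A normed space is a pair \<open>(V, N)\<close>: a linear subspace \<open>V\<close> of an ambient real vector space
  and a norm \<open>N\<close> on \<open>V\<close>; the values of \<open>N\<close> outside \<open>V\<close> are irrelevant.  Since types cannot be
  quantified over, this is what allows statements of the form ``there is a constant such that
  for all normed spaces''.\<close>

definition normed_space_on :: "'v::real_vector set \<Rightarrow> ('v \<Rightarrow> real) \<Rightarrow> bool" where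
  "normed_space_on V N \<longleftrightarrow>
     subspace V \<and>
     (\<forall>x\<in>V. 0 \<le> N x \<and> (N x = 0 \<longleftrightarrow> x = 0)) \<and>
     (\<forall>x\<in>V. \<forall>a. N (a *\<^sub>R x) = \<bar>a\<bar> * N x) \<and>
     (\<forall>x\<in>V. \<forall>y\<in>V. N (x + y) \<le> N x + N y)"

lemma normed_space_on_UNIV_norm: "normed_space_on (UNIV :: 'v::real_normed_vector set) norm"
  by (simp add: normed_space_on_def norm_triangle_ineq)

text \<open>Independent symmetric signs \<open>\<epsilon> 0, \<dots>, \<epsilon> (m - 1)\<close>.\<close>

definition rademacher :: "nat \<Rightarrow> (nat \<Rightarrow> real) pmf" where
  "rademacher m = Pi_pmf {..<m} 0 (\<lambda>_. pmf_of_set {-1, 1})"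

definition type2_bound :: "'v::real_vector set \<Rightarrow> ('v \<Rightarrow> real) \<Rightarrow> real \<Rightarrow> bool" where
  "type2_bound V N M \<longleftrightarrow>
     (\<forall>m. \<forall>x::nat \<Rightarrow> 'v. (\<forall>i<m. x i \<in> V) \<longrightarrow>
        measure_pmf.expectation (rademacher m) (\<lambda>\<epsilon>. N (\<Sum>i<m. \<epsilon> i *\<^sub>R x i))
          \<le> M * sqrt (\<Sum>i<m. (N (x i))\<^sup>2))"

definition has_type2 :: "'v::real_vector set \<Rightarrow> ('v \<Rightarrow> real) \<Rightarrow> bool" where
  "has_type2 V N \<longleftrightarrow> (\<exists>M. type2_bound V N M)"

text \<open>The condition \<open>0 \<le> M\<close> only matters for the zero space, where every real \<open>M\<close> is a bound.\<close>

definition type2_const :: "'v::real_vector set \<Rightarrow> ('v \<Rightarrow> real) \<Rightarrow> real" where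
  "type2_const V N = Inf {M. 0 \<le> M \<and> type2_bound V N M}"

text \<open>\<open>\<real>\<^sup>\<sigma>\<close>, for a set \<open>\<sigma>\<close> of coordinates; \<open>\<real>\<^sup>n\<close> is \<open>coord_space {1..n}\<close>.  The Euclidean norm of
  a vector \<open>x\<close> in this space is \<open>L2_set x \<sigma>\<close>.\<close>

definition coord_space :: "nat set \<Rightarrow> (nat \<Rightarrow> real) set" where
  "coord_space \<sigma> = {x. \<forall>i. i \<notin> \<sigma> \<longrightarrow> x i = 0}"

text \<open>Linear operators from \<open>\<real>\<^sup>n\<close> to \<open>V\<close>; the values of \<open>T\<close> outside \<open>\<real>\<^sup>n\<close> are irrelevant.\<close>

definition linear_operator :: "nat \<Rightarrow> 'v::real_vector set \<Rightarrow> ((nat \<Rightarrow> real) \<Rightarrow> 'v) \<Rightarrow> bool" where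
  "linear_operator n V T \<longleftrightarrow>
     (\<forall>x\<in>coord_space {1..n}. T x \<in> V) \<and>
     (\<forall>x\<in>coord_space {1..n}. \<forall>y\<in>coord_space {1..n}. T (x + y) = T x + T y) \<and>
     (\<forall>x\<in>coord_space {1..n}. \<forall>a. T (a *\<^sub>R x) = a *\<^sub>R T x)"

definition op_norm :: "nat \<Rightarrow> ('v \<Rightarrow> real) \<Rightarrow> ((nat \<Rightarrow> real) \<Rightarrow> 'v) \<Rightarrow> real" where
  "op_norm n N T = (SUP x\<in>{x \<in> coord_space {1..n}. L2_set x {1..n} \<le> 1}. N (T x))"

definition std_gaussian :: "nat \<Rightarrow> (nat \<Rightarrow> real) measure" where
  "std_gaussian n = (\<Pi>\<^sub>M i\<in>{1..n}. density lborel (\<lambda>t. ennreal (std_normal_density t)))"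

text \<open>Points of the product space are \<open>undefined\<close> outside \<open>{1..n}\<close>, hence the extension by zero.\<close>

definition ell_norm :: "nat \<Rightarrow> ('v \<Rightarrow> real) \<Rightarrow> ((nat \<Rightarrow> real) \<Rightarrow> 'v) \<Rightarrow> real" where
  "ell_norm n N T =
     sqrt (\<integral>g. (N (T (\<lambda>i. if i \<in> {1..n} then g i else 0)))\<^sup>2 \<partial>std_gaussian n)"

definition large_coord_restriction ::
    "real \<Rightarrow> real \<Rightarrow> ('v \<Rightarrow> real) \<Rightarrow> nat \<Rightarrow> ((nat \<Rightarrow> real) \<Rightarrow> 'v) \<Rightarrow> bool" where
  "large_coord_restriction c b N n T \<longleftrightarrow>
     (let \<alpha> = c * ln (2 * op_norm n N T) powr (-3/2)
      in \<exists>\<sigma>\<subseteq>{1..n}.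
           real (card \<sigma>) \<ge> \<alpha>\<^sup>2 * real n / (op_norm n N T)\<^sup>2 \<and>
           (\<forall>x\<in>coord_space \<sigma>. N (T x) \<ge> \<alpha> * b * L2_set x \<sigma>))"

end

theory Submission
  imports Defs
begin

text \<open>
Write \<open>q x\<close> for the seminorm \<open>N (T x)\<close> on \<open>\<real>\<^sup>n\<close>, \<open>K\<close> for the norm of \<open>T\<close> and \<open>M\<close> for a type 2 bound. Then
\<open>q x \<le> K \<bar>x\<bar>\<close>, and \<open>n \<le> E q(g)\<^sup>2\<close> for a standard Gaussian vector \<open>g\<close>. The plan is to put a quadratic
form below \<open>q\<^sup>2\<close> and to apply a restricted invertibility theorem to this form instead of \<open>q\<close>.

The form has to be small as an operator and large in trace at the same time, at a scale adapted
to both \<open>K\<close> and \<open>M\<close>. With \<open>\<lambda> = K\<^sup>2 / (2 M\<^sup>2)\<close> there is a positive semidefinite form \<open>B\<close> with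
\<open>B x x \<le> q(x)\<^sup>2\<close>, \<open>B x x \<le> \<lambda> \<bar>x\<bar>\<^sup>2\<close> and trace at least \<open>n / (4 M\<^sup>2)\<close>. By conic duality (Hahn-Banach in
the space of matrices, \<open>exists_dominated_form\<close>) this amounts to the estimate
\<open>\<Sum> q(x)\<^sup>2 + \<lambda> \<Sum> \<bar>w\<bar>\<^sup>2 \<ge> n / (4 M\<^sup>2)\<close> whenever the rank-one matrices \<open>x \<otimes> x\<close> and \<open>w \<otimes> w\<close> add up to the
identity or more. In that case a Gaussian sum \<open>\<Sum> \<gamma> x + \<Sum> \<gamma>' w\<close> dominates \<open>g\<close>; its first part is
controlled by the type 2 property and its second part by \<open>K\<close> (\<open>gauss_avg_decomposition_le\<close>), so
that \<open>n \<le> E q(g)\<^sup>2 \<le> 4 M\<^sup>2 \<Sum> q(x)\<^sup>2 + 2 K\<^sup>2 \<Sum> \<bar>w\<bar>\<^sup>2\<close>. Two facts enter here: the type 2 inequality is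
about first moments, and Kahane's inequality on the sign cube (\<open>kahane_second_moment\<close>) turns it
into one about second moments; and the law of a Gaussian sum depends only on the Gram matrix of
its vectors (\<open>gauss_avg_eq_of_gram_eq\<close>).

For a form bounded by \<open>\<lambda>\<close> with trace \<open>F\<close>, the restricted invertibility theorem of Bourgain and
Tzafriri, proved with the barrier argument of Spielman and Srivastava
(\<open>restricted_invertibility\<close>), yields \<open>\<sigma>\<close> with \<open>\<bar>\<sigma>\<bar> \<ge> F / (8 \<lambda>)\<close> and \<open>B x x \<ge> F / (32 n) \<bar>x\<bar>\<^sup>2\<close> on \<open>\<real>\<^sup>\<sigma>\<close>.
For \<open>F \<ge> n / (4 M\<^sup>2)\<close> the factor \<open>M\<close> cancels in the first bound, which is where the choice of \<open>\<lambda>\<close>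
matters: \<open>\<bar>\<sigma>\<bar> \<ge> n / (16 K\<^sup>2)\<close>, while \<open>q(x) \<ge> \<bar>x\<bar> / (12 M)\<close> on \<open>\<real>\<^sup>\<sigma>\<close>. Since \<open>n \<le> E q(g)\<^sup>2 \<le> K\<^sup>2 n\<close>, one has
\<open>K \<ge> 1\<close> unless \<open>n = 0\<close>; hence \<open>\<alpha> \<le> 1/4\<close> for \<open>c = 1/16\<close>, and the two bounds are those of the theorem.

For the second conjunct, the type 2 constant of a space is already attained on the span of
countably many of its vectors, and such a span embeds linearly into \<open>nat \<Rightarrow> real\<close>
(\<open>operator_transfer\<close>). A statement about all normed spaces of sequences therefore covers all
normed spaces.
\<close>

section \<open>Second moments of seminorms on the sign cube\<close>

definition seminorm :: "('v::real_vector \<Rightarrow> real) \<Rightarrow> bool" where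
  "seminorm q \<longleftrightarrow> (\<forall>a x. q (a *\<^sub>R x) = \<bar>a\<bar> * q x) \<and> (\<forall>x y. q (x + y) \<le> q x + q y)"

lemma seminorm_scale: "seminorm q \<Longrightarrow> q (a *\<^sub>R x) = \<bar>a\<bar> * q x"
  by (simp add: seminorm_def)

lemma seminorm_triangle: "seminorm q \<Longrightarrow> q (x + y) \<le> q x + q y"
  by (simp add: seminorm_def)

lemma seminorm_zero: "seminorm q \<Longrightarrow> q 0 = 0"
  using seminorm_scale[of q 0 0] by simp

lemma seminorm_minus: "seminorm q \<Longrightarrow> q (- x) = q x"
  using seminorm_scale[of q "-1" x] by simp

lemma seminorm_nonneg: "seminorm q \<Longrightarrow> 0 \<le> q x"
  using seminorm_triangle[of q x "-x"] seminorm_minus[of q x] seminorm_zero[of q] by simp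

text \<open>The mean over all sign vectors of length \<open>m\<close>, which are represented as lists; this allows
  induction on one coordinate at a time.\<close>

primrec sign_avg :: "nat \<Rightarrow> (real list \<Rightarrow> real) \<Rightarrow> real" where
  "sign_avg 0 F = F []"
| "sign_avg (Suc m) F = (sign_avg m (\<lambda>e. F (1 # e)) + sign_avg m (\<lambda>e. F ((-1) # e))) / 2"

definition even_part :: "(real list \<Rightarrow> real) \<Rightarrow> real list \<Rightarrow> real" where
  "even_part F e = (F (1 # e) + F ((-1) # e)) / 2"

definition odd_part :: "(real list \<Rightarrow> real) \<Rightarrow> real list \<Rightarrow> real" where
  "odd_part F e = (F (1 # e) - F ((-1) # e)) / 2"

text \<open>The Dirichlet form of the cube: the sum over all coordinates of the mean square of half
  the difference of \<open>F\<close> along that coordinate. The even and odd parts are the Fourier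
  coefficients in the first coordinate.\<close>

primrec energy :: "nat \<Rightarrow> (real list \<Rightarrow> real) \<Rightarrow> real" where
  "energy 0 F = 0"
| "energy (Suc m) F =
     sign_avg m (\<lambda>e. (odd_part F e)\<^sup>2) + energy m (even_part F) + energy m (odd_part F)"

text \<open>The squared Fourier mass of \<open>F\<close> on the characters of degree one.\<close>

primrec linear_weight :: "nat \<Rightarrow> (real list \<Rightarrow> real) \<Rightarrow> real" where
  "linear_weight 0 F = 0"
| "linear_weight (Suc m) F = (sign_avg m (odd_part F))\<^sup>2 + linear_weight m (even_part F)"

primrec cube_laplacian :: "nat \<Rightarrow> (real list \<Rightarrow> real) \<Rightarrow> real list \<Rightarrow> real" where
  "cube_laplacian 0 F e = 0"
| "cube_laplacian (Suc m) F e =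
     (F e - F ((- hd e) # tl e)) / 2 + cube_laplacian m (\<lambda>d. F (hd e # d)) (tl e)"

lemma sign_avg_add: "sign_avg m (\<lambda>e. F e + G e) = sign_avg m F + sign_avg m G"
  by (induction m arbitrary: F G) (simp_all add: field_simps)

lemma sign_avg_cmult: "sign_avg m (\<lambda>e. c * F e) = c * sign_avg m F"
  by (induction m arbitrary: F) (simp_all add: field_simps)

lemma sign_avg_mono:
  "(\<And>e. length e = m \<Longrightarrow> F e \<le> G e) \<Longrightarrow> sign_avg m F \<le> sign_avg m G"
proof (induction m arbitrary: F G)
  case (Suc m)
  have "sign_avg m (\<lambda>e. F (s # e)) \<le> sign_avg m (\<lambda>e. G (s # e))" for s
    by (rule Suc.IH) (simp add: Suc.prems)
  from this[of 1] this[of "-1"] show ?case by simp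
qed simp

lemma sign_avg_nonneg: "(\<And>e. 0 \<le> F e) \<Longrightarrow> 0 \<le> sign_avg m F"
  by (induction m arbitrary: F) (simp_all add: add_nonneg_nonneg)

lemma sign_avg_even_part: "sign_avg (Suc m) F = sign_avg m (even_part F)"
proof -
  have "sign_avg m (even_part F) = sign_avg m (\<lambda>e. (1/2) * (F (1 # e) + F ((-1) # e)))"
    by (simp add: even_part_def[abs_def])
  then show ?thesis by (simp only: sign_avg_cmult sign_avg_add) simp
qed

lemma sign_avg_power2:
  "sign_avg (Suc m) (\<lambda>e. (F e)\<^sup>2)
     = sign_avg m (\<lambda>e. (even_part F e)\<^sup>2) + sign_avg m (\<lambda>e. (odd_part F e)\<^sup>2)"
proof -
  have "((F (1 # e))\<^sup>2 + (F ((-1) # e))\<^sup>2) / 2 = (even_part F e)\<^sup>2 + (odd_part F e)\<^sup>2" for e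
    by (simp add: even_part_def odd_part_def power2_eq_square field_simps)
  then have "even_part (\<lambda>e. (F e)\<^sup>2) = (\<lambda>e. (even_part F e)\<^sup>2 + (odd_part F e)\<^sup>2)"
    by (simp add: fun_eq_iff even_part_def)
  then show ?thesis by (simp only: sign_avg_even_part sign_avg_add)
qed

lemma energy_nonneg: "0 \<le> energy m F"
  by (induction m arbitrary: F) (simp_all add: add_nonneg_nonneg sign_avg_nonneg)

text \<open>The eigenvalues of the Laplacian are the degrees of the characters, so all of them except
  that of the constants are at least 1. Splitting off one coordinate gives a proof without
  characters.\<close>

lemma poincare_cube: "sign_avg m (\<lambda>e. (F e)\<^sup>2) - (sign_avg m F)\<^sup>2 \<le> energy m F"
proof (induction m arbitrary: F)
  case (Suc m)
  show ?case
    using Suc.IH[of "even_part F"] energy_nonneg[of m "odd_part F"]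
    by (simp add: sign_avg_power2 sign_avg_even_part del: sign_avg.simps)
qed simp

text \<open>Away from degrees 0 and 1 the eigenvalues are at least 2. The odd part enters with its
  degree raised by one, so the Poincare inequality is enough for it.\<close>

lemma second_spectral_gap_cube:
  "2 * (sign_avg m (\<lambda>e. (F e)\<^sup>2) - (sign_avg m F)\<^sup>2) \<le> energy m F + linear_weight m F"
proof (induction m arbitrary: F)
  case (Suc m)
  show ?case
    using Suc.IH[of "even_part F"] poincare_cube[of m "odd_part F"]
    by (simp add: sign_avg_power2 sign_avg_even_part del: sign_avg.simps)
qed simp

lemma sign_avg_uminus: "sign_avg m (\<lambda>e. F (map uminus e)) = sign_avg m F"
proof (induction m arbitrary: F)
  case (Suc m)
  show ?case using Suc.IH[of "\<lambda>e. F (1 # e)"] Suc.IH[of "\<lambda>e. F ((-1) # e)"] by simp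
qed simp

lemma linear_weight_even:
  assumes "\<And>e. F (map uminus e) = F e"
  shows "linear_weight m F = 0"
  using assms
proof (induction m arbitrary: F)
  case (Suc m)
  have "F (1 # map uminus e) = F ((-1) # e)" "F ((-1) # map uminus e) = F (1 # e)" for e
    using Suc.prems[of "(-1) # e"] Suc.prems[of "1 # e"] by simp_all
  then have "odd_part F (map uminus e) = - odd_part F e" "even_part F (map uminus e) = even_part F e" for e
    by (simp_all add: odd_part_def even_part_def field_simps)
  moreover from this have "sign_avg m (odd_part F) = - sign_avg m (odd_part F)"
    using sign_avg_uminus[of m "odd_part F"] sign_avg_cmult[of m "-1" "odd_part F"] by simp
  ultimately show ?case using Suc.IH[of "even_part F"] by simp
qed simp

lemma energy_parallelogram:
  "energy m (\<lambda>e. (F e + G e) / 2) + energy m (\<lambda>e. (F e - G e) / 2) = (energy m F + energy m G) / 2"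
proof (induction m arbitrary: F G)
  case (Suc m)
  have ev: "even_part (\<lambda>e. (F e + G e) / 2) = (\<lambda>e. (even_part F e + even_part G e) / 2)"
    "even_part (\<lambda>e. (F e - G e) / 2) = (\<lambda>e. (even_part F e - even_part G e) / 2)"
    "odd_part (\<lambda>e. (F e + G e) / 2) = (\<lambda>e. (odd_part F e + odd_part G e) / 2)"
    "odd_part (\<lambda>e. (F e - G e) / 2) = (\<lambda>e. (odd_part F e - odd_part G e) / 2)"
    by (simp_all add: fun_eq_iff even_part_def odd_part_def field_simps)
  have "sign_avg m (\<lambda>e. ((odd_part F e + odd_part G e) / 2)\<^sup>2)
      + sign_avg m (\<lambda>e. ((odd_part F e - odd_part G e) / 2)\<^sup>2)
      = sign_avg m (\<lambda>e. (1/2) * ((odd_part F e)\<^sup>2 + (odd_part G e)\<^sup>2))"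
    unfolding sign_avg_add[symmetric]
    by (rule arg_cong[of _ _ "sign_avg m"]) (simp add: fun_eq_iff power2_eq_square field_simps)
  also have "\<dots> = (sign_avg m (\<lambda>e. (odd_part F e)\<^sup>2) + sign_avg m (\<lambda>e. (odd_part G e)\<^sup>2)) / 2"
    unfolding sign_avg_cmult sign_avg_add by simp
  finally show ?case
    using Suc.IH[of "even_part F" "even_part G"] Suc.IH[of "odd_part F" "odd_part G"]
    by (simp add: ev field_simps)
qed simp

lemma energy_eq_laplacian: "energy m F = sign_avg m (\<lambda>e. F e * cube_laplacian m F e)"
proof (induction m arbitrary: F)
  case (Suc m)
  have step: "sign_avg m (\<lambda>e. F (s # e) * cube_laplacian (Suc m) F (s # e))
      = sign_avg m (\<lambda>e. F (s # e) * ((F (s # e) - F ((-s) # e)) / 2)) + energy m (\<lambda>e. F (s # e))" for s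
    by (simp add: distrib_left sign_avg_add Suc.IH)
  have "sign_avg m (\<lambda>e. F (1 # e) * ((F (1 # e) - F ((-1) # e)) / 2))
      + sign_avg m (\<lambda>e. F ((-1) # e) * ((F ((-1) # e) - F (1 # e)) / 2))
      = sign_avg m (\<lambda>e. 2 * (odd_part F e)\<^sup>2)"
    unfolding sign_avg_add[symmetric]
    by (rule arg_cong[of _ _ "sign_avg m"]) (simp add: fun_eq_iff odd_part_def power2_eq_square field_simps)
  moreover have "energy m (even_part F) + energy m (odd_part F)
      = (energy m (\<lambda>e. F (1 # e)) + energy m (\<lambda>e. F ((-1) # e))) / 2"
    using energy_parallelogram[of m "\<lambda>e. F (1 # e)" "\<lambda>e. F ((-1) # e)"]
    by (simp add: even_part_def[abs_def] odd_part_def[abs_def])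
  ultimately show ?case
    using step[of 1] step[of "-1"] by (simp add: sign_avg_cmult del: cube_laplacian.simps)
qed simp

fun signed_sum :: "'v::real_vector list \<Rightarrow> real list \<Rightarrow> 'v" where
  "signed_sum (z # zs) (s # e) = s *\<^sub>R z + signed_sum zs e"
| "signed_sum _ _ = 0"

lemma signed_sum_uminus: "signed_sum zs (map uminus e) = - signed_sum zs e"
  by (induction zs e rule: signed_sum.induct) simp_all

text \<open>Flipping the sign at one place subtracts \<open>2 s z\<close> from the signed sum \<open>y\<close>. By the triangle
  inequality the values of the seminorm at all these neighbours add up to at least its value at
  the sum of the neighbours. The parameters \<open>x\<close> and \<open>u\<close> collect the coordinates that the induction
  has already passed: \<open>x\<close> their part of the signed sum, \<open>u\<close> the sum of their neighbours.\<close>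

lemma laplacian_seminorm_aux:
  fixes q :: "'v::real_vector \<Rightarrow> real"
  assumes q: "seminorm q" and "length e = length zs"
  shows "2 * cube_laplacian (length zs) (\<lambda>d. q (x + signed_sum zs d)) e
      + q (u + real (length zs) *\<^sub>R (x + signed_sum zs e) - 2 *\<^sub>R signed_sum zs e)
      \<le> q u + real (length zs) * q (x + signed_sum zs e)"
  using assms(2)
proof (induction zs arbitrary: e x u)
  case (Cons z zs)
  then obtain s d where e: "e = s # d" "length d = length zs" by (cases e) auto
  define y where "y = x + (s *\<^sub>R z + signed_sum zs d)"
  define u' where "u' = u + y - 2 *\<^sub>R s *\<^sub>R z"
  have IH: "2 * cube_laplacian (length zs) (\<lambda>d. q ((x + s *\<^sub>R z) + signed_sum zs d)) d
      + q (u' + real (length zs) *\<^sub>R y - 2 *\<^sub>R signed_sum zs d) \<le> q u' + real (length zs) * q y"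
    using Cons.IH[OF e(2), of "x + s *\<^sub>R z" u'] by (simp add: y_def add_ac)
  have y': "y - 2 *\<^sub>R s *\<^sub>R z = x + ((-s) *\<^sub>R z + signed_sum zs d)"
    unfolding y_def scaleR_2 by (simp add: algebra_simps)
  have "u' = u + (y - 2 *\<^sub>R s *\<^sub>R z)" by (simp add: u'_def)
  then have "q u' \<le> q u + q (x + ((-s) *\<^sub>R z + signed_sum zs d))"
    using seminorm_triangle[OF q] by (simp only: y')
  moreover have "u' + real (length zs) *\<^sub>R y - 2 *\<^sub>R signed_sum zs d
     = u + real (length (z # zs)) *\<^sub>R y - 2 *\<^sub>R (s *\<^sub>R z + signed_sum zs d)"
    by (simp add: u'_def algebra_simps)
  moreover have "2 * cube_laplacian (length (z # zs)) (\<lambda>d. q (x + signed_sum (z # zs) d)) e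
     = q y - q (x + ((-s) *\<^sub>R z + signed_sum zs d))
       + 2 * cube_laplacian (length zs) (\<lambda>d. q ((x + s *\<^sub>R z) + signed_sum zs d)) d"
    by (simp add: e y_def add.assoc)
  moreover have "signed_sum (z # zs) e = s *\<^sub>R z + signed_sum zs d" "x + signed_sum (z # zs) e = y"
    by (simp_all add: e y_def)
  moreover have "real (length (z # zs)) * q y = q y + real (length zs) * q y"
    by (simp add: algebra_simps)
  ultimately show ?case using IH by (simp only:)
qed simp

text \<open>The sum of all \<open>m\<close> neighbours of \<open>y\<close> is \<open>(m - 2) y\<close>.\<close>

lemma laplacian_seminorm_le:
  assumes q: "seminorm q" and l: "length e = length zs"
  shows "cube_laplacian (length zs) (\<lambda>d. q (signed_sum zs d)) e \<le> q (signed_sum zs e)"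
proof -
  let ?m = "real (length zs)" and ?y = "signed_sum zs e"
  have "2 * cube_laplacian (length zs) (\<lambda>d. q (signed_sum zs d)) e + q ((?m - 2) *\<^sub>R ?y) \<le> ?m * q ?y"
    using laplacian_seminorm_aux[OF q l, of 0 0] seminorm_zero[OF q] by (simp add: algebra_simps)
  moreover have "(?m - 2) * q ?y \<le> q ((?m - 2) *\<^sub>R ?y)"
    using seminorm_nonneg[OF q, of ?y] by (simp add: seminorm_scale[OF q] mult_right_mono)
  ultimately show ?thesis by (simp add: algebra_simps)
qed

text \<open>Kahane's inequality with the argument of Latala and Oleszkiewicz. Put
  \<open>F = q (signed_sum zs)\<close>. Since \<open>L F \<le> F\<close> pointwise, the energy of \<open>F\<close> is at most \<open>E F\<^sup>2\<close>; since \<open>F\<close> is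
  even, it has no mass in degree one and its energy is at least \<open>2 (E F\<^sup>2 - (E F)\<^sup>2)\<close>.\<close>

lemma kahane_second_moment:
  assumes q: "seminorm q"
  shows "sign_avg (length zs) (\<lambda>e. (q (signed_sum zs e))\<^sup>2)
           \<le> 2 * (sign_avg (length zs) (\<lambda>e. q (signed_sum zs e)))\<^sup>2"
proof -
  let ?m = "length zs" and ?F = "\<lambda>e. q (signed_sum zs e)"
  have "energy ?m ?F \<le> sign_avg ?m (\<lambda>e. (?F e)\<^sup>2)"
    unfolding energy_eq_laplacian power2_eq_square
    by (rule sign_avg_mono) (simp add: mult_left_mono laplacian_seminorm_le[OF q] seminorm_nonneg[OF q])
  moreover have "linear_weight ?m ?F = 0"
    by (rule linear_weight_even) (simp add: signed_sum_uminus seminorm_minus[OF q])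
  ultimately show ?thesis using second_spectral_gap_cube[of ?m ?F] by simp
qed

section \<open>Coordinate vectors and bilinear forms\<close>

definition unit_vec :: "nat \<Rightarrow> nat \<Rightarrow> real" where
  "unit_vec i = (\<lambda>k. if k = i then 1 else 0)"

definition inner_on :: "nat set \<Rightarrow> (nat \<Rightarrow> real) \<Rightarrow> (nat \<Rightarrow> real) \<Rightarrow> real" where
  "inner_on I x y = (\<Sum>k\<in>I. x k * y k)"

lemma bilinear_inner_on: "bilinear (inner_on I)"
  unfolding bilinear_def
  by (auto intro!: linearI simp: inner_on_def scaleR_fun_def sum.distrib sum_distrib_left algebra_simps)

lemma inner_on_commute: "inner_on I x y = inner_on I y x"
  by (simp add: inner_on_def mult.commute)

lemma inner_on_self_nonneg: "0 \<le> inner_on I x x"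
  by (simp add: inner_on_def sum_nonneg)

lemma inner_on_unit_vec: "finite I \<Longrightarrow> i \<in> I \<Longrightarrow> inner_on I x (unit_vec i) = x i"
  by (simp add: inner_on_def unit_vec_def sum.delta if_distrib cong: if_cong)

lemma subspace_coord_space: "subspace (coord_space \<sigma>)"
  by (auto simp: subspace_def coord_space_def scaleR_fun_def)

lemma coord_space_mono: "\<sigma> \<subseteq> \<tau> \<Longrightarrow> coord_space \<sigma> \<subseteq> coord_space \<tau>"
  by (auto simp: coord_space_def)

lemma unit_vec_in_coord_space: "i \<in> \<sigma> \<Longrightarrow> unit_vec i \<in> coord_space \<sigma>"
  by (auto simp: coord_space_def unit_vec_def)

lemma coord_space_insert_split:
  assumes "y \<in> coord_space (insert j \<sigma>)"
  obtains z where "z \<in> coord_space \<sigma>" "y = y j *\<^sub>R unit_vec j + z"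
proof
  show "y - y j *\<^sub>R unit_vec j \<in> coord_space \<sigma>"
    using assms by (auto simp: coord_space_def unit_vec_def scaleR_fun_def)
qed simp

lemma sum_fun_apply: "(\<Sum>i\<in>A. f i) k = (\<Sum>i\<in>A. f i k)"
  by (induction A rule: infinite_finite_induct) simp_all

lemmas bilinear_simps = bilinear_ladd bilinear_radd bilinear_lsub bilinear_rsub
  bilinear_lmul bilinear_rmul bilinear_lneg bilinear_rneg bilinear_lzero bilinear_rzero

text \<open>Gaussian elimination: after solving on the old coordinates, correct the solution along the
  component \<open>u\<close> of the new unit vector that is orthogonal to the old coordinates.\<close>

lemma positive_definite_solve:
  fixes C :: "(nat \<Rightarrow> real) \<Rightarrow> (nat \<Rightarrow> real) \<Rightarrow> real"
  assumes "finite \<sigma>" and C: "bilinear C" and sym: "\<And>x y. C x y = C y x"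
    and pos: "\<And>x. x \<in> coord_space \<sigma> \<Longrightarrow> x \<noteq> 0 \<Longrightarrow> 0 < C x x"
  shows "linear l \<Longrightarrow> \<exists>x\<in>coord_space \<sigma>. \<forall>y\<in>coord_space \<sigma>. C x y = l y"
  using assms(1) pos
proof (induction \<sigma> arbitrary: l rule: finite_induct)
  case empty
  have "C 0 y = l y" if "y \<in> coord_space {}" for y
  proof -
    have "y = 0" using that by (auto simp: coord_space_def)
    then show ?thesis by (simp only: linear_0[OF empty.prems(1)] bilinear_rzero[OF C])
  qed
  moreover have "0 \<in> coord_space {}" by (simp add: coord_space_def)
  ultimately show ?case by blast
next
  case (insert j \<sigma>)
  have sub: "coord_space \<sigma> \<subseteq> coord_space (insert j \<sigma>)" by (rule coord_space_mono) auto
  have pos': "\<And>x. x \<in> coord_space \<sigma> \<Longrightarrow> x \<noteq> 0 \<Longrightarrow> 0 < C x x"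
    using insert.prems(2) sub by blast
  obtain a where a: "a \<in> coord_space \<sigma>" "\<And>y. y \<in> coord_space \<sigma> \<Longrightarrow> C a y = l y"
    using insert.IH[OF insert.prems(1) pos'] by blast
  have "linear (C (unit_vec j))" using C by (simp add: bilinear_def)
  from insert.IH[OF this pos'] obtain z where
    z: "z \<in> coord_space \<sigma>" "\<And>y. y \<in> coord_space \<sigma> \<Longrightarrow> C z y = C (unit_vec j) y" by blast
  define u where "u = unit_vec j - z"
  have u: "u \<in> coord_space (insert j \<sigma>)" unfolding u_def
    using z(1) sub by (intro subspace_diff[OF subspace_coord_space] unit_vec_in_coord_space) auto
  have "z j = 0" using z(1) insert.hyps(2) by (simp add: coord_space_def)
  then have "u j = 1" by (simp add: u_def unit_vec_def)
  then have "u \<noteq> 0" by auto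
  then have Cu: "0 < C u u" using insert.prems(2) u by blast
  have orth: "C u y = 0" if "y \<in> coord_space \<sigma>" for y
    using z(2)[OF that] by (simp add: u_def bilinear_simps[OF C])
  define t where "t = (l (unit_vec j) - l z) / C u u"
  have "C (a + t *\<^sub>R u) y = l y" if y: "y \<in> coord_space (insert j \<sigma>)" for y
  proof -
    obtain w where w: "w \<in> coord_space \<sigma>" "y = y j *\<^sub>R unit_vec j + w"
      using coord_space_insert_split[OF y] by metis
    have "unit_vec j = u + z" by (simp add: u_def)
    then have "C (a + t *\<^sub>R u) (unit_vec j) = C a u + C a z + t * (C u u + C u z)"
      by (simp add: bilinear_simps[OF C] algebra_simps)
    also have "\<dots> = l (unit_vec j)"
      using orth[OF a(1)] orth[OF z(1)] a(2)[OF z(1)] Cu sym[of a u] by (simp add: t_def)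
    finally have "C (a + t *\<^sub>R u) (unit_vec j) = l (unit_vec j)" .
    moreover have "C (a + t *\<^sub>R u) w = l w"
      using a(2)[OF w(1)] orth[OF w(1)] by (simp add: bilinear_simps[OF C])
    ultimately have "C (a + t *\<^sub>R u) (y j *\<^sub>R unit_vec j + w) = l (y j *\<^sub>R unit_vec j + w)"
      using insert.prems(1) by (simp add: bilinear_radd[OF C] bilinear_rmul[OF C] linear_add linear_scale)
    then show ?thesis using w(2) by simp
  qed
  moreover have "a + t *\<^sub>R u \<in> coord_space (insert j \<sigma>)"
    using a(1) sub u by (intro subspace_add[OF subspace_coord_space] subspace_scale[OF subspace_coord_space]) auto
  ultimately show ?case by blast
qed

lemma cauchy_schwarz_psd:
  fixes B :: "'a::real_vector \<Rightarrow> 'a \<Rightarrow> real"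
  assumes B: "bilinear B" and sym: "\<And>x y. B x y = B y x" and psd: "\<And>x. 0 \<le> B x x"
  shows "(B x y)\<^sup>2 \<le> B x x * B y y"
proof -
  have quad: "0 \<le> B x x + 2 * t * B x y + t\<^sup>2 * B y y" for t
    using psd[of "x + t *\<^sub>R y"] sym[of y x]
    by (simp add: bilinear_simps[OF B] power2_eq_square algebra_simps)
  show ?thesis
  proof (cases "B y y = 0")
    case True
    have "B x y = 0"
    proof (rule ccontr)
      assume "B x y \<noteq> 0"
      then have "2 * (- (B x x + 1) / (2 * B x y)) * B x y = - (B x x + 1)" by simp
      then show False using quad[of "- (B x x + 1) / (2 * B x y)"] True by simp
    qed
    then show ?thesis using True by simp
  next
    case False
    then have "0 < B y y" using psd[of y] by simp
    then show ?thesis using quad[of "- B x y / B y y"]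
      by (simp add: field_simps power2_eq_square)
  qed
qed

section \<open>Restricted invertibility of a quadratic form\<close>

locale psd_form =
  fixes B :: "(nat \<Rightarrow> real) \<Rightarrow> (nat \<Rightarrow> real) \<Rightarrow> real" and I :: "nat set" and lam :: real
  assumes fin: "finite I"
    and bil: "bilinear B"
    and sym: "B x y = B y x"
    and psd: "0 \<le> B x x"
    and upper: "x \<in> coord_space I \<Longrightarrow> B x x \<le> lam * inner_on I x x"
    and lam_pos: "0 < lam"
begin

lemmas B_simps = bilinear_simps[OF bil]
lemmas in_simps = bilinear_simps[OF bilinear_inner_on]

text \<open>The left hand side is \<open>\<bar>A r\<bar>\<^sup>2\<close> for the matrix \<open>A\<close> of \<open>B\<close>, and \<open>A\<^sup>2 \<le> \<lambda> A\<close> for a positive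
  semidefinite matrix bounded by \<open>\<lambda>\<close>.\<close>

lemma sum_square_columns: "(\<Sum>i\<in>I. (B (unit_vec i) r)\<^sup>2) \<le> lam * B r r"
proof -
  define w where "w = (\<Sum>i\<in>I. B (unit_vec i) r *\<^sub>R unit_vec i)"
  define S where "S = (\<Sum>i\<in>I. (B (unit_vec i) r)\<^sup>2)"
  have lin: "linear (\<lambda>x. B x r)" using bil by (simp add: bilinear_def)
  have w: "w \<in> coord_space I" unfolding w_def
    by (intro subspace_sum[OF subspace_coord_space] subspace_scale[OF subspace_coord_space] unit_vec_in_coord_space)
  have wk: "w k = B (unit_vec k) r" if "k \<in> I" for k
  proof -
    have "w k = (\<Sum>i\<in>I. if k = i then B (unit_vec i) r else 0)"
      by (simp add: w_def sum_fun_apply scaleR_fun_def unit_vec_def if_distrib cong: if_cong)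
    then show ?thesis using fin that by simp
  qed
  have S1: "inner_on I w w = S"
    by (simp add: inner_on_def wk S_def power2_eq_square)
  have S2: "B w r = S"
    by (simp add: w_def S_def linear_sum[OF lin] linear_scale[OF lin] power2_eq_square B_simps)
  have "S\<^sup>2 \<le> B w w * B r r"
    using cauchy_schwarz_psd[OF bil sym psd, of w r] S2 by simp
  also have "\<dots> \<le> lam * S * B r r"
    using upper[OF w] psd[of r] S1 by (intro mult_right_mono) auto
  finally have "S * S \<le> S * (lam * B r r)" by (simp add: power2_eq_square mult_ac)
  moreover have "0 \<le> S" by (simp add: S_def sum_nonneg)
  moreover have "0 \<le> lam * B r r" using lam_pos psd[of r] by simp
  ultimately have "S \<le> lam * B r r"
    by (cases "S = 0") (auto simp: mult_le_cancel_left)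
  then show ?thesis by (simp add: S_def)
qed

text \<open>The invariant of the barrier argument. The second condition says that \<open>\<sigma>\<close> is invertible at
  level \<open>b\<close>. The third one bounds a potential from below, namely the sum over \<open>i\<close> of the minimum
  over \<open>y\<close> in \<open>\<real>\<^sup>\<sigma>\<close> of \<open>B (e\<^sub>i - y) (e\<^sub>i - y) - b \<bar>y\<bar>\<^sup>2\<close>. If \<open>B\<close> is the Gram matrix of vectors \<open>a\<^sub>i\<close>, and \<open>A\<close> is
  the sum of \<open>a\<^sub>j \<otimes> a\<^sub>j\<close> over \<open>j\<close> in \<open>\<sigma>\<close>, then this minimum equals \<open>b a\<^sub>i\<^sup>T (b - A)\<^sup>-\<^sup>1 a\<^sub>i\<close>, so that the sum
  is the potential of Spielman and Srivastava up to the factor \<open>b\<close>. As a minimum it needs neither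
  inverses nor eigenvalues.\<close>

definition barrier :: "nat set \<Rightarrow> real \<Rightarrow> real \<Rightarrow> bool" where
  "barrier \<sigma> b \<Phi> \<longleftrightarrow> \<sigma> \<subseteq> I \<and>
     (\<forall>x\<in>coord_space \<sigma>. x \<noteq> 0 \<longrightarrow> b * inner_on I x x < B x x) \<and>
     (\<forall>y. (\<forall>i\<in>I. y i \<in> coord_space \<sigma>) \<longrightarrow>
        \<Phi> \<le> (\<Sum>i\<in>I. B (unit_vec i - y i) (unit_vec i - y i) - b * inner_on I (y i) (y i)))"

lemma barrier_empty: "barrier {} b (\<Sum>i\<in>I. B (unit_vec i) (unit_vec i))"
proof -
  have "coord_space {} = {0}" by (auto simp: coord_space_def)
  then show ?thesis by (simp add: barrier_def in_simps)
qed

text \<open>Lowering the level from \<open>b\<close> to \<open>b - \<delta>\<close> raises the potential by at least \<open>\<delta> S\<close>, where \<open>S\<close> is the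
  sum of the squared norms of the minimisers \<open>x\<^sub>i\<close>. Adding the index \<open>j\<close> costs at most
  \<open>\<lambda> B r\<^sub>j r\<^sub>j / (D\<^sub>j - b')\<close>. Here \<open>r\<^sub>j = e\<^sub>j - x\<^sub>j\<close> is the residual, \<open>D\<^sub>j\<close> the minimum, and
  \<open>B r\<^sub>j r\<^sub>j = D\<^sub>j + b' \<bar>x\<^sub>j\<bar>\<^sup>2\<close>. Averaging over \<open>j\<close> shows that the cost is at most \<open>\<delta> S + 2 \<lambda>\<close> for some
  \<open>j\<close>, so the net loss is at most \<open>2 \<lambda>\<close>.\<close>

lemma barrier_step:
  assumes g: "barrier \<sigma> b \<Phi>" and ne: "I \<noteq> {}"
    and b': "0 < b - \<delta>" and \<delta>: "0 < \<delta>" and \<Phi>: "0 < \<Phi>"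
    and h1: "4 * real (card I) * (b - \<delta>) \<le> \<Phi>"
    and h2: "4 * lam * (b - \<delta>) \<le> 3 * \<delta> * \<Phi>"
  shows "\<exists>j\<in>I - \<sigma>. barrier (insert j \<sigma>) (b - \<delta>) (\<Phi> - 2 * lam)"
proof -
  define b' where "b' = b - \<delta>"
  have \<sigma>: "\<sigma> \<subseteq> I" and gpos: "\<And>x. x \<in> coord_space \<sigma> \<Longrightarrow> x \<noteq> 0 \<Longrightarrow> b * inner_on I x x < B x x"
    and gpot: "\<And>y. (\<And>i. i \<in> I \<Longrightarrow> y i \<in> coord_space \<sigma>) \<Longrightarrow>
        \<Phi> \<le> (\<Sum>i\<in>I. B (unit_vec i - y i) (unit_vec i - y i) - b * inner_on I (y i) (y i))"
    using g by (auto simp: barrier_def)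
  have pos': "b' * inner_on I x x < B x x" if "x \<in> coord_space \<sigma>" "x \<noteq> 0" for x
  proof -
    have "b' * inner_on I x x \<le> b * inner_on I x x"
      using \<delta> inner_on_self_nonneg[of I x] by (intro mult_right_mono) (auto simp: b'_def)
    then show ?thesis using gpos[OF that] by linarith
  qed
  define C where "C = (\<lambda>x y. B x y - b' * inner_on I x y)"
  have Cbil: "bilinear C" unfolding C_def bilinear_def
    by (auto intro!: linearI simp: B_simps in_simps algebra_simps)
  have Csym: "C x y = C y x" for x y
    using sym[of x y] inner_on_commute[of I x y] by (simp add: C_def)
  have Cpos: "0 < C x x" if "x \<in> coord_space \<sigma>" "x \<noteq> 0" for x
    using pos'[OF that] by (simp add: C_def)
  have "\<forall>v. \<exists>x\<in>coord_space \<sigma>. \<forall>y\<in>coord_space \<sigma>. C x y = B v y"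
    using positive_definite_solve[OF finite_subset[OF \<sigma> fin] Cbil Csym Cpos] bil
    by (simp add: bilinear_def)
  then obtain X where X: "\<And>v. X v \<in> coord_space \<sigma>"
    and Xstat: "\<And>v y. y \<in> coord_space \<sigma> \<Longrightarrow> C (X v) y = B v y" by metis
  define x where "x = (\<lambda>i. X (unit_vec i))"
  define r where "r = (\<lambda>i. unit_vec i - x i)"
  have xs: "x i \<in> coord_space \<sigma>" for i by (simp add: x_def X)
  have stat: "B (r i) y = - b' * inner_on I (x i) y" if "y \<in> coord_space \<sigma>" for i y
    using Xstat[OF that, of "unit_vec i"] by (simp add: r_def x_def C_def B_simps)
  define D where "D = (\<lambda>i. B (r i) (r i) - b' * inner_on I (x i) (x i))"
  \<comment> \<open>the bilinear form of the partial minimum, by stationarity of the minimisers\<close>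
  have D_alt: "B (unit_vec i) (r j) = B (r i) (r j) - b' * inner_on I (x i) (x j)" for i j
  proof -
    have "B (unit_vec i) (r j) = B (r i) (r j) + B (r j) (x i)"
      using sym[of "x i" "r j"] by (simp add: r_def B_simps)
    then show ?thesis using stat[OF xs] inner_on_commute[of I "x i" "x j"] by simp
  qed
  \<comment> \<open>completing the square around the minimiser\<close>
  have minim: "D i - 2 * t * B (unit_vec i) (r j) + t\<^sup>2 * D j
      \<le> B (unit_vec i - t *\<^sub>R unit_vec j - z) (unit_vec i - t *\<^sub>R unit_vec j - z) - b' * inner_on I z z"
    if z: "z \<in> coord_space \<sigma>" for i j t z
  proof -
    define w where "w = z - (x i - t *\<^sub>R x j)"
    have w: "w \<in> coord_space \<sigma>" unfolding w_def using z xs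
      by (intro subspace_diff[OF subspace_coord_space] subspace_scale[OF subspace_coord_space])
    have z': "z = w + (x i - t *\<^sub>R x j)" by (simp add: w_def)
    have v: "unit_vec i - t *\<^sub>R unit_vec j - z = (r i - t *\<^sub>R r j) - w"
      unfolding w_def r_def by (simp add: algebra_simps)
    have "0 \<le> C w w" using Cpos[OF w] bilinear_rzero[OF Cbil] by (cases "w = 0") auto
    moreover have "B w (r i) = - b' * inner_on I (x i) w" "B w (r j) = - b' * inner_on I (x j) w"
      "B (r i) w = - b' * inner_on I (x i) w" "B (r j) w = - b' * inner_on I (x j) w"
      using stat[OF w] sym by simp_all
    ultimately show ?thesis
      unfolding v unfolding z' unfolding D_alt D_def C_def
      using sym[of "r i" "r j"] inner_on_commute[of I "x i" "x j"]
        inner_on_commute[of I w "x i"] inner_on_commute[of I w "x j"]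
      by (simp add: B_simps in_simps power2_eq_square algebra_simps)
  qed
  define S where "S = (\<Sum>i\<in>I. inner_on I (x i) (x i))"
  define \<Phi>' where "\<Phi>' = (\<Sum>i\<in>I. D i)"
  have S0: "0 \<le> S" by (simp add: S_def sum_nonneg inner_on_self_nonneg)
  have "\<Phi> \<le> (\<Sum>i\<in>I. D i - \<delta> * inner_on I (x i) (x i))"
    using gpot[of x] xs by (simp add: D_def r_def b'_def algebra_simps)
  then have \<Phi>': "\<Phi> + \<delta> * S \<le> \<Phi>'"
    by (simp add: \<Phi>'_def S_def sum_subtractf sum_distrib_left)
  \<comment> \<open>compare the sums of both sides over \<open>j\<close>\<close>
  have "\<exists>j\<in>I. lam * B (r j) (r j) \<le> (\<delta> * S + 2 * lam) * (D j - b')"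
  proof (rule ccontr)
    assume "\<not> ?thesis"
    then have "(\<Sum>j\<in>I. (\<delta> * S + 2 * lam) * (D j - b')) < (\<Sum>j\<in>I. lam * B (r j) (r j))"
      by (intro sum_strict_mono fin ne) (simp add: not_le)
    moreover have "(\<Sum>j\<in>I. (\<delta> * S + 2 * lam) * (D j - b')) = (\<delta> * S + 2 * lam) * (\<Phi>' - real (card I) * b')"
      by (simp add: \<Phi>'_def sum_subtractf flip: sum_distrib_left)
    moreover have "(\<Sum>j\<in>I. lam * B (r j) (r j)) = lam * (\<Phi>' + b' * S)"
      by (simp add: \<Phi>'_def S_def D_def sum_subtractf flip: sum_distrib_left)
    ultimately have lt: "(\<delta> * S + 2 * lam) * (\<Phi>' - real (card I) * b') < lam * (\<Phi>' + b' * S)" by simp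
    have "real (card I) * b' \<le> \<Phi> / 4" using h1 by (simp add: b'_def mult.commute mult.left_commute)
    moreover have "\<Phi> \<le> \<Phi>'" using \<Phi>' \<delta> S0 by (smt (verit) mult_nonneg_nonneg)
    ultimately have "3/4 * \<Phi>' \<le> \<Phi>' - real (card I) * b'" by linarith
    then have "(\<delta> * S + 2 * lam) * (3/4 * \<Phi>') \<le> (\<delta> * S + 2 * lam) * (\<Phi>' - real (card I) * b')"
      using S0 \<delta> lam_pos by (intro mult_left_mono) auto
    moreover have "lam * b' * S \<le> 3/4 * \<delta> * \<Phi>' * S"
    proof (rule mult_right_mono[OF _ S0])
      have "3 * \<delta> * \<Phi> \<le> 3 * \<delta> * \<Phi>'" using \<open>\<Phi> \<le> \<Phi>'\<close> \<delta> by simp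
      then show "lam * b' \<le> 3/4 * \<delta> * \<Phi>'" using h2 by (simp add: b'_def)
    qed
    moreover have "(\<delta> * S + 2 * lam) * (3/4 * \<Phi>') = 3/4 * \<delta> * \<Phi>' * S + 3/2 * (lam * \<Phi>')"
      by (simp add: algebra_simps)
    moreover have "lam * (\<Phi>' + b' * S) = lam * \<Phi>' + lam * b' * S"
      by (simp add: algebra_simps)
    moreover have "0 < lam * \<Phi>'" using lam_pos \<open>\<Phi> \<le> \<Phi>'\<close> \<Phi> by simp
    ultimately show False using lt by argo
  qed
  then obtain j where j: "j \<in> I" and jle: "lam * B (r j) (r j) \<le> (\<delta> * S + 2 * lam) * (D j - b')" by blast
  have c: "0 < \<delta> * S + 2 * lam" using \<delta> S0 lam_pos by (simp add: add_nonneg_pos)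
  have Dj: "b' < D j"
  proof -
    have "0 \<le> lam * B (r j) (r j)" using lam_pos psd by simp
    then have "b' \<le> D j" using jle c by (smt (verit) mult_pos_neg)
    moreover have "0 \<le> b' * inner_on I (x j) (x j)"
      using b' inner_on_self_nonneg[of I "x j"] by (simp add: b'_def)
    ultimately have "0 < B (r j) (r j)" using b' by (simp add: D_def b'_def)
    then have "0 < (\<delta> * S + 2 * lam) * (D j - b')" using jle lam_pos by (smt (verit) mult_pos_pos)
    then show ?thesis using c by (simp add: zero_less_mult_iff)
  qed
  \<comment> \<open>for \<open>j\<close> in \<open>\<sigma>\<close> the choice \<open>y = e\<^sub>j\<close> shows that the minimum is negative\<close>
  have "j \<notin> \<sigma>"
  proof
    assume js: "j \<in> \<sigma>"
    have "inner_on I (unit_vec j) (unit_vec j) = 1"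
      using fin j by (simp add: inner_on_unit_vec) (simp add: unit_vec_def)
    then have "D j \<le> - b'"
      using minim[of "unit_vec j" j 0 j] unit_vec_in_coord_space[OF js] by (simp add: B_simps)
    then show False using Dj b' by (simp add: b'_def)
  qed
  have sub: "insert j \<sigma> \<subseteq> I" using j \<sigma> by simp
  have inn: "inner_on I (t *\<^sub>R unit_vec j + z) (t *\<^sub>R unit_vec j + z) = t\<^sup>2 + inner_on I z z"
    if "z \<in> coord_space \<sigma>" for t z
  proof -
    have "inner_on I z (unit_vec j) = 0"
      using that \<open>j \<notin> \<sigma>\<close> fin j by (simp add: inner_on_unit_vec coord_space_def)
    moreover have "inner_on I (unit_vec j) (unit_vec j) = 1"
      using fin j by (simp add: inner_on_unit_vec) (simp add: unit_vec_def)
    ultimately show ?thesis using inner_on_commute[of I z "unit_vec j"]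
      by (simp add: in_simps power2_eq_square)
  qed
  have "barrier (insert j \<sigma>) b' (\<Phi> - 2 * lam)"
    unfolding barrier_def
  proof (intro conjI ballI impI allI)
    show "insert j \<sigma> \<subseteq> I" by (rule sub)
  next
    fix y :: "nat \<Rightarrow> real" assume y: "y \<in> coord_space (insert j \<sigma>)" "y \<noteq> 0"
    obtain z where z: "z \<in> coord_space \<sigma>" "y = y j *\<^sub>R unit_vec j + z"
      using coord_space_insert_split[OF y(1)] by metis
    define t where "t = y j"
    show "b' * inner_on I y y < B y y"
    proof (cases "t = 0")
      case True
      then have "y = z" using z(2) by (simp add: t_def)
      then show ?thesis using pos' z(1) y(2) by blast
    next
      case False
      define w where "w = (- 1 / t) *\<^sub>R z"
      have w: "w \<in> coord_space \<sigma>" unfolding w_def using z(1) by (rule subspace_scale[OF subspace_coord_space])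
      have zw: "z = (- t) *\<^sub>R w" using False by (simp add: w_def)
      have yw: "y = t *\<^sub>R (unit_vec j - w)" using z(2) zw by (simp add: t_def algebra_simps)
      have "D j \<le> B (unit_vec j - w) (unit_vec j - w) - b' * inner_on I w w"
        using minim[OF w, of j 0 j] by simp
      then have "b' + b' * inner_on I w w < B (unit_vec j - w) (unit_vec j - w)" using Dj by linarith
      then have "t\<^sup>2 * (b' + b' * inner_on I w w) < t\<^sup>2 * B (unit_vec j - w) (unit_vec j - w)"
        using False by simp
      moreover have "B y y = t\<^sup>2 * B (unit_vec j - w) (unit_vec j - w)"
        unfolding yw by (simp add: B_simps power2_eq_square algebra_simps)
      moreover have "inner_on I y y = t\<^sup>2 + inner_on I z z"
        using inn[OF z(1), of t] z(2) by (simp add: t_def)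
      moreover have "inner_on I z z = t\<^sup>2 * inner_on I w w"
        unfolding zw by (simp add: in_simps power2_eq_square)
      ultimately show ?thesis by (simp add: algebra_simps)
    qed
  next
    fix y :: "nat \<Rightarrow> nat \<Rightarrow> real"
    assume y: "\<forall>i\<in>I. y i \<in> coord_space (insert j \<sigma>)"
    define \<beta> where "\<beta> = (\<lambda>i. B (unit_vec i) (r j))"
    have summand: "D i - (\<beta> i)\<^sup>2 / (D j - b')
        \<le> B (unit_vec i - y i) (unit_vec i - y i) - b' * inner_on I (y i) (y i)" if i: "i \<in> I" for i
    proof -
      define t where "t = y i j"
      obtain z where z: "z \<in> coord_space \<sigma>" "y i = t *\<^sub>R unit_vec j + z"
        using coord_space_insert_split[of "y i" j \<sigma>] y i unfolding t_def by metis
      \<comment> \<open>minimise over the new coordinate \<open>t\<close>\<close>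
      have "0 \<le> (t * (D j - b') - \<beta> i)\<^sup>2 / (D j - b')" using Dj by simp
      also have "\<dots> = t\<^sup>2 * (D j - b') - 2 * t * \<beta> i + (\<beta> i)\<^sup>2 / (D j - b')"
        using Dj by (simp add: field_simps power2_eq_square)
      finally have "D i - (\<beta> i)\<^sup>2 / (D j - b') \<le> D i - 2 * t * \<beta> i + t\<^sup>2 * D j - b' * t\<^sup>2"
        by (simp add: algebra_simps)
      also have "D i - 2 * t * \<beta> i + t\<^sup>2 * D j
          \<le> B (unit_vec i - y i) (unit_vec i - y i) - b' * inner_on I z z"
        using minim[OF z(1), of i t j] by (simp add: \<beta>_def z(2) diff_diff_eq)
      finally show ?thesis using inn[OF z(1), of t] by (simp add: z(2) algebra_simps)
    qed
    have "(\<Sum>i\<in>I. (\<beta> i)\<^sup>2) / (D j - b') \<le> lam * B (r j) (r j) / (D j - b')"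
      using sum_square_columns[of "r j"] Dj by (simp add: \<beta>_def divide_right_mono)
    also have "\<dots> \<le> \<delta> * S + 2 * lam" using jle Dj by (simp add: field_simps)
    finally have "\<Phi> - 2 * lam \<le> \<Phi>' - (\<Sum>i\<in>I. (\<beta> i)\<^sup>2) / (D j - b')" using \<Phi>' by linarith
    also have "\<dots> = (\<Sum>i\<in>I. D i - (\<beta> i)\<^sup>2 / (D j - b'))"
      by (simp add: \<Phi>'_def sum_subtractf sum_divide_distrib)
    also have "\<dots> \<le> (\<Sum>i\<in>I. B (unit_vec i - y i) (unit_vec i - y i) - b' * inner_on I (y i) (y i))"
      by (intro sum_mono summand)
    finally show "\<Phi> - 2 * lam \<le> \<dots>" .
  qed
  then show ?thesis using j \<open>j \<notin> \<sigma>\<close> unfolding b'_def by blast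
qed

text \<open>Each step loses \<open>2 \<lambda>\<close> of the initial potential \<open>F\<close> and \<open>\<delta>\<close> of the initial level \<open>F / (8 n)\<close>; both
  budgets allow at least \<open>F / (8 \<lambda>)\<close> steps. If this number is below one, a single vector is
  enough.\<close>

theorem restricted_invertibility:
  defines "F \<equiv> \<Sum>i\<in>I. B (unit_vec i) (unit_vec i)"
  assumes Fpos: "0 < F"
  shows "\<exists>\<sigma>\<subseteq>I. F / (8 * lam) \<le> real (card \<sigma>) \<and>
           (\<forall>x\<in>coord_space \<sigma>. F / (32 * real (card I)) * inner_on I x x \<le> B x x)"
proof (cases "F < 8 * lam")
  case True
  have ne: "I \<noteq> {}" using Fpos unfolding F_def by auto
  have "\<exists>i\<in>I. F / real (card I) \<le> B (unit_vec i) (unit_vec i)"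
  proof (rule ccontr)
    assume "\<not> ?thesis"
    then have "F < (\<Sum>i\<in>I. F / real (card I))"
      unfolding F_def by (intro sum_strict_mono fin ne) (simp add: not_le F_def)
    then show False using ne fin by simp
  qed
  then obtain i where i: "i \<in> I" "F / real (card I) \<le> B (unit_vec i) (unit_vec i)" by blast
  have "F / (32 * real (card I)) * inner_on I x x \<le> B x x" if x: "x \<in> coord_space {i}" for x
  proof -
    have xi: "x = x i *\<^sub>R unit_vec i"
      using x by (auto simp: coord_space_def unit_vec_def scaleR_fun_def fun_eq_iff)
    have "inner_on I (unit_vec i) (unit_vec i) = 1"
      using fin i by (simp add: inner_on_unit_vec) (simp add: unit_vec_def)
    then have 1: "inner_on I x x = (x i)\<^sup>2"
      by (subst xi, subst (2) xi) (simp add: in_simps power2_eq_square)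
    have 2: "B x x = (x i)\<^sup>2 * B (unit_vec i) (unit_vec i)"
      by (subst xi, subst (2) xi) (simp add: B_simps power2_eq_square)
    have "F / (32 * real (card I)) \<le> F / real (card I)"
      using Fpos ne fin by (simp add: field_simps card_gt_0_iff)
    then show ?thesis unfolding 1 2 using i(2)
      by (subst mult.commute) (intro mult_left_mono, auto)
  qed
  then show ?thesis using i(1) True lam_pos by (intro exI[of _ "{i}"]) (auto simp: field_simps)
next
  case False
  have ne: "I \<noteq> {}" using Fpos unfolding F_def by auto
  define n where "n = real (card I)"
  have n: "0 < n" using ne fin by (simp add: n_def card_gt_0_iff)
  define b where "b = F / (8 * n)"
  \<comment> \<open>the decrement for which the second numerical condition of \<open>barrier_step\<close> holds when \<open>\<Phi> \<ge> F / 2\<close>\<close>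
  define \<delta> where "\<delta> = 3 * lam * b / F"
  have b0: "0 < b" using Fpos n by (simp add: b_def)
  have \<delta>0: "0 < \<delta>" using b0 lam_pos Fpos by (simp add: \<delta>_def)
  have step: "real k * (4 * lam) \<le> F \<Longrightarrow>
      \<exists>\<sigma>. card \<sigma> = k \<and> barrier \<sigma> (b - real k * \<delta>) (F - real k * (2 * lam))" for k :: nat
  proof (induction k)
    case 0
    show ?case using barrier_empty[of b] by (intro exI[of _ "{}"]) (simp add: F_def)
  next
    case (Suc k)
    have k: "real k * (4 * lam) + 4 * lam \<le> F" using Suc.prems by (simp add: algebra_simps)
    then obtain \<sigma> where \<sigma>: "card \<sigma> = k" "barrier \<sigma> (b - real k * \<delta>) (F - real k * (2 * lam))"
      using Suc.IH lam_pos by auto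
    have half: "F / 2 \<le> F - real k * (2 * lam)" using k lam_pos by simp
    have "real (Suc k) * \<delta> = (real (Suc k) * (4 * lam)) * (3/4 * b / F)" by (simp add: \<delta>_def)
    also have "\<dots> \<le> F * (3/4 * b / F)"
      using Suc.prems b0 Fpos by (intro mult_right_mono) auto
    also have "\<dots> = 3/4 * b" using Fpos by simp
    finally have bk: "b / 4 \<le> b - real k * \<delta> - \<delta>" by (simp add: algebra_simps)
    have bb: "b - real k * \<delta> - \<delta> \<le> b"
      using \<delta>0 mult_nonneg_nonneg[of "real k" \<delta>] by linarith
    have "\<exists>j\<in>I - \<sigma>. barrier (insert j \<sigma>) (b - real k * \<delta> - \<delta>) (F - real k * (2 * lam) - 2 * lam)"
    proof (rule barrier_step[OF \<sigma>(2) ne _ \<delta>0])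
      show "0 < b - real k * \<delta> - \<delta>" using bk b0 by linarith
      show "0 < F - real k * (2 * lam)" using half Fpos by linarith
      have "4 * real (card I) * (b - real k * \<delta> - \<delta>) \<le> 4 * n * b"
        using bb n by (simp add: n_def)
      also have "\<dots> = F / 2" using n by (simp add: b_def)
      finally show "4 * real (card I) * (b - real k * \<delta> - \<delta>) \<le> F - real k * (2 * lam)" using half by linarith
      have "4 * lam * (b - real k * \<delta> - \<delta>) \<le> 4 * lam * b" using bb lam_pos by simp
      also have "\<dots> \<le> 3 * \<delta> * (F / 2)" using Fpos lam_pos b0 by (simp add: \<delta>_def)
      also have "\<dots> \<le> 3 * \<delta> * (F - real k * (2 * lam))" using half \<delta>0 by (intro mult_left_mono) auto
      finally show "4 * lam * (b - real k * \<delta> - \<delta>) \<le> 3 * \<delta> * (F - real k * (2 * lam))" .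
    qed
    then obtain j where j: "j \<in> I - \<sigma>" "barrier (insert j \<sigma>) (b - real k * \<delta> - \<delta>) (F - real k * (2 * lam) - 2 * lam)"
      by blast
    have "finite \<sigma>" using \<sigma>(2) fin by (auto simp: barrier_def intro: finite_subset)
    then have "card (insert j \<sigma>) = Suc k" using j(1) \<sigma>(1) by simp
    then show ?case using j(2) by (intro exI[of _ "insert j \<sigma>"]) (simp add: algebra_simps)
  qed
  define k where "k = nat \<lceil>F / (8 * lam)\<rceil>"
  have kge: "F / (8 * lam) \<le> real k" unfolding k_def by (rule real_nat_ceiling_ge)
  have "real k \<le> F / (8 * lam) + 1" unfolding k_def using Fpos lam_pos by (simp add: of_nat_nat)
  also have "\<dots> \<le> F / (4 * lam)" using False lam_pos by (simp add: field_simps)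
  finally have kle: "real k * (4 * lam) \<le> F" using lam_pos by (simp add: field_simps)
  then obtain \<sigma> where \<sigma>: "card \<sigma> = k" "barrier \<sigma> (b - real k * \<delta>) (F - real k * (2 * lam))"
    using step by blast
  have "real k * \<delta> = (real k * (4 * lam)) * (3/4 * b / F)" by (simp add: \<delta>_def)
  also have "\<dots> \<le> F * (3/4 * b / F)" using kle b0 Fpos by (intro mult_right_mono) auto
  also have "\<dots> = 3/4 * b" using Fpos by simp
  finally have bk: "F / (32 * n) \<le> b - real k * \<delta>" by (simp add: b_def)
  have "F / (32 * n) * inner_on I x x \<le> B x x" if "x \<in> coord_space \<sigma>" for x
  proof (cases "x = 0")
    case True then show ?thesis by (simp add: in_simps B_simps)
  next
    case nz: False
    have "F / (32 * n) * inner_on I x x \<le> (b - real k * \<delta>) * inner_on I x x"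
      using bk inner_on_self_nonneg by (rule mult_right_mono)
    also have "\<dots> \<le> B x x" using \<sigma>(2) that nz by (auto simp: barrier_def less_imp_le)
    finally show ?thesis .
  qed
  then show ?thesis using \<sigma> kge unfolding n_def barrier_def by (intro exI[of _ \<sigma>]) auto
qed

end

section \<open>Sums of Gaussian multiples of vectors\<close>

abbreviation gauss :: "real measure" where
  "gauss \<equiv> density lborel (\<lambda>t. ennreal (std_normal_density t))"

lemma prob_space_gauss: "prob_space gauss"
  using prob_space_normal_density[of 1 0] by simp

interpretation gauss: prob_space gauss by (rule prob_space_gauss)

lemma measurable_into_sequences:
  fixes f :: "'a \<Rightarrow> nat \<Rightarrow> real"
  assumes "\<And>k. (\<lambda>x. f x k) \<in> borel_measurable M"
  shows "f \<in> borel_measurable M"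
  using assms by (rule measurable_coordinatewise_then_product)

lemma measurable_coordinate [measurable]: "(\<lambda>x :: nat \<Rightarrow> real. x k) \<in> borel_measurable borel"
  by (rule measurable_product_then_coordinatewise) simp

lemma measurable_sequence_add [measurable (raw)]:
  fixes f g :: "'a \<Rightarrow> nat \<Rightarrow> real"
  assumes [measurable]: "f \<in> borel_measurable M" "g \<in> borel_measurable M"
  shows "(\<lambda>x. f x + g x) \<in> borel_measurable M"
  by (rule measurable_into_sequences) (simp add: measurable_product_then_coordinatewise assms)

lemma measurable_sequence_scaleR [measurable (raw)]:
  fixes g :: "'a \<Rightarrow> nat \<Rightarrow> real"
  assumes [measurable]: "c \<in> borel_measurable M" "g \<in> borel_measurable M"
  shows "(\<lambda>x. c x *\<^sub>R g x) \<in> borel_measurable M"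
  by (rule measurable_into_sequences)
    (simp add: scaleR_fun_def measurable_product_then_coordinatewise assms)

text \<open>Lebesgue measure in the plane is invariant under rotations because a rotation factors into
  one-dimensional affine maps with total scaling factor one, unless it is a quarter turn, which
  swaps the coordinates up to signs.\<close>

lemma lborel_rotate:
  fixes g :: "real \<times> real \<Rightarrow> ennreal"
  assumes [measurable]: "g \<in> borel_measurable (borel \<Otimes>\<^sub>M borel)" and cs: "c\<^sup>2 + s\<^sup>2 = 1"
  shows "(\<integral>\<^sup>+x. \<integral>\<^sup>+y. g (c * x - s * y, s * x + c * y) \<partial>lborel \<partial>lborel)
           = (\<integral>\<^sup>+x. \<integral>\<^sup>+y. g (x, y) \<partial>lborel \<partial>lborel)"
proof (cases "c = 0")
  case True
  then have s: "\<bar>s\<bar> = 1" "s \<noteq> 0" using cs by (auto simp: power2_eq_1_iff)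
  have aff: "(\<integral>\<^sup>+x. f x \<partial>lborel) = (\<integral>\<^sup>+x. f (d * x) \<partial>lborel)"
    if [measurable]: "f \<in> borel_measurable borel" and "\<bar>d\<bar> = 1" for f :: "real \<Rightarrow> ennreal" and d
    using nn_integral_real_affine[of f d 0] that by auto
  have "(\<integral>\<^sup>+x. \<integral>\<^sup>+y. g (c * x - s * y, s * x + c * y) \<partial>lborel \<partial>lborel)
      = (\<integral>\<^sup>+x. \<integral>\<^sup>+y. g ((- s) * y, s * x) \<partial>lborel \<partial>lborel)" using True by simp
  also have "\<dots> = (\<integral>\<^sup>+x. \<integral>\<^sup>+y. g (y, s * x) \<partial>lborel \<partial>lborel)"
  proof (rule nn_integral_cong)
    fix x :: real
    show "(\<integral>\<^sup>+y. g ((- s) * y, s * x) \<partial>lborel) = (\<integral>\<^sup>+y. g (y, s * x) \<partial>lborel)"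
      using s by (intro aff[symmetric]) auto
  qed
  also have "\<dots> = (\<integral>\<^sup>+x. \<integral>\<^sup>+y. g (y, x) \<partial>lborel \<partial>lborel)"
    using s by (intro aff[of "\<lambda>x. \<integral>\<^sup>+y. g (y, x) \<partial>lborel", symmetric]) auto
  also have "\<dots> = (\<integral>\<^sup>+x. \<integral>\<^sup>+y. g (x, y) \<partial>lborel \<partial>lborel)"
    by (rule lborel_pair.Fubini') simp
  finally show ?thesis .
next
  case False
  \<comment> \<open>factor the rotation into a vertical and a horizontal affine map\<close>
  have "\<bar>c\<bar> * (\<integral>\<^sup>+x. \<integral>\<^sup>+y. g (c * x - s * y, s * x + c * y) \<partial>lborel \<partial>lborel)
      = (\<integral>\<^sup>+x. \<bar>c\<bar> * (\<integral>\<^sup>+y. g (c * x - s * y, s * x + c * y) \<partial>lborel) \<partial>lborel)"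
    by (simp add: nn_integral_cmult)
  also have "\<dots> = (\<integral>\<^sup>+x. \<integral>\<^sup>+u. g ((x - s * u) / c, u) \<partial>lborel \<partial>lborel)"
  proof (rule nn_integral_cong)
    fix x :: real
    have "(x - s * (s * x + c * y)) / c = c * x - s * y" for y
    proof -
      have "x - s * (s * x + c * y) = (1 - s\<^sup>2) * x - s * c * y"
        by (simp add: algebra_simps power2_eq_square)
      also have "1 - s\<^sup>2 = c\<^sup>2" using cs by simp
      finally show ?thesis using False by (simp add: field_simps power2_eq_square)
    qed
    then show "\<bar>c\<bar> * (\<integral>\<^sup>+y. g (c * x - s * y, s * x + c * y) \<partial>lborel)
        = (\<integral>\<^sup>+u. g ((x - s * u) / c, u) \<partial>lborel)"
      using nn_integral_real_affine[of "\<lambda>u. g ((x - s * u) / c, u)" c "s * x"] False by simp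
  qed
  also have "\<dots> = (\<integral>\<^sup>+u. \<integral>\<^sup>+x. g ((x - s * u) / c, u) \<partial>lborel \<partial>lborel)"
    by (rule lborel_pair.Fubini') simp
  also have "\<dots> = (\<integral>\<^sup>+u. \<bar>c\<bar> * (\<integral>\<^sup>+w. g (w, u) \<partial>lborel) \<partial>lborel)"
  proof (rule nn_integral_cong)
    fix u :: real
    show "(\<integral>\<^sup>+x. g ((x - s * u) / c, u) \<partial>lborel) = \<bar>c\<bar> * (\<integral>\<^sup>+w. g (w, u) \<partial>lborel)"
      using nn_integral_real_affine[of "\<lambda>x. g ((x - s * u) / c, u)" c "s * u"] False by simp
  qed
  also have "\<dots> = \<bar>c\<bar> * (\<integral>\<^sup>+u. \<integral>\<^sup>+w. g (w, u) \<partial>lborel \<partial>lborel)"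
    by (simp add: nn_integral_cmult)
  also have "(\<integral>\<^sup>+u. \<integral>\<^sup>+w. g (w, u) \<partial>lborel \<partial>lborel) = (\<integral>\<^sup>+x. \<integral>\<^sup>+y. g (x, y) \<partial>lborel \<partial>lborel)"
    by (rule lborel_pair.Fubini') simp
  finally show ?thesis using False by (simp add: ennreal_mult_cancel_left)
qed

lemma std_normal_density_rotate:
  assumes "c\<^sup>2 + s\<^sup>2 = (1::real)"
  shows "std_normal_density (c * x - s * y) * std_normal_density (s * x + c * y)
           = std_normal_density x * std_normal_density y"
proof -
  have "(c * x - s * y)\<^sup>2 + (s * x + c * y)\<^sup>2 = (c\<^sup>2 + s\<^sup>2) * (x\<^sup>2 + y\<^sup>2)"
    by (simp add: power2_eq_square algebra_simps)
  then have "- (c * x - s * y)\<^sup>2 / 2 + - (s * x + c * y)\<^sup>2 / 2 = - x\<^sup>2 / 2 + - y\<^sup>2 / 2"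
    using assms by (simp add: field_simps)
  then have "exp (- (c * x - s * y)\<^sup>2 / 2) * exp (- (s * x + c * y)\<^sup>2 / 2) = exp (- x\<^sup>2 / 2) * exp (- y\<^sup>2 / 2)"
    by (simp only: exp_add[symmetric])
  then show ?thesis by (simp add: std_normal_density_def)
qed

lemma gauss_rotate:
  fixes h :: "real \<times> real \<Rightarrow> ennreal"
  assumes [measurable]: "h \<in> borel_measurable (borel \<Otimes>\<^sub>M borel)" and cs: "c\<^sup>2 + s\<^sup>2 = 1"
  shows "(\<integral>\<^sup>+x. \<integral>\<^sup>+y. h (c * x - s * y, s * x + c * y) \<partial>gauss \<partial>gauss)
           = (\<integral>\<^sup>+x. \<integral>\<^sup>+y. h (x, y) \<partial>gauss \<partial>gauss)"
proof -
  have expand: "(\<integral>\<^sup>+x. \<integral>\<^sup>+y. k (x, y) \<partial>gauss \<partial>gauss)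
     = (\<integral>\<^sup>+x. \<integral>\<^sup>+y. ennreal (std_normal_density x * std_normal_density y) * k (x, y) \<partial>lborel \<partial>lborel)"
    if [measurable]: "k \<in> borel_measurable (borel \<Otimes>\<^sub>M borel)" for k :: "real \<times> real \<Rightarrow> ennreal"
    by (simp add: nn_integral_density ennreal_mult mult.assoc flip: nn_integral_cmult)
  define g where "g = (\<lambda>(x, y). ennreal (std_normal_density x * std_normal_density y) * h (x, y))"
  have [measurable]: "g \<in> borel_measurable (borel \<Otimes>\<^sub>M borel)" unfolding g_def by simp
  have "(\<integral>\<^sup>+x. \<integral>\<^sup>+y. h (c * x - s * y, s * x + c * y) \<partial>gauss \<partial>gauss)
     = (\<integral>\<^sup>+x. \<integral>\<^sup>+y. g (c * x - s * y, s * x + c * y) \<partial>lborel \<partial>lborel)"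
    using expand[of "\<lambda>(x, y). h (c * x - s * y, s * x + c * y)"]
    by (simp add: g_def std_normal_density_rotate[OF cs])
  also have "\<dots> = (\<integral>\<^sup>+x. \<integral>\<^sup>+y. g (x, y) \<partial>lborel \<partial>lborel)"
    by (rule lborel_rotate[OF _ cs]) simp
  also have "\<dots> = (\<integral>\<^sup>+x. \<integral>\<^sup>+y. h (x, y) \<partial>gauss \<partial>gauss)"
    by (subst expand) (simp_all add: g_def)
  finally show ?thesis .
qed

lemma gauss_reflect:
  fixes f :: "real \<Rightarrow> ennreal"
  assumes [measurable]: "f \<in> borel_measurable borel"
  shows "(\<integral>\<^sup>+t. f (- t) \<partial>gauss) = (\<integral>\<^sup>+t. f t \<partial>gauss)"
proof -
  have "(\<integral>\<^sup>+t. f t \<partial>gauss) = (\<integral>\<^sup>+t. std_normal_density t * f t \<partial>lborel)"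
    by (simp add: nn_integral_density)
  also have "\<dots> = (\<integral>\<^sup>+t. std_normal_density (- t) * f (- t) \<partial>lborel)"
    by (subst nn_integral_real_affine[of _ "-1" 0]) simp_all
  also have "\<dots> = (\<integral>\<^sup>+t. f (- t) \<partial>gauss)"
    by (simp add: nn_integral_density std_normal_density_def)
  finally show ?thesis by simp
qed

lemma gauss_second_moment:
  assumes "0 \<le> a" "0 \<le> b"
  shows "(\<integral>\<^sup>+t. ennreal (a + t\<^sup>2 * b) \<partial>gauss) = ennreal (a + b)"
proof -
  have "has_bochner_integral lborel (\<lambda>x. std_normal_density x * x ^ 2) 1"
    using normal_moment_even[where \<mu> = 0 and \<sigma> = 1 and k = 1] by (simp add: fact_2 mult_2 power2_eq_square)
  then have "(\<integral>\<^sup>+t. ennreal (std_normal_density t * t\<^sup>2) \<partial>lborel) = 1"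
    by (subst nn_integral_eq_integral)
      (auto simp: has_bochner_integral_iff simp del: ennreal_mult')
  then have "(\<integral>\<^sup>+t. ennreal (t\<^sup>2) \<partial>gauss) = 1"
    by (simp add: nn_integral_density ennreal_mult)
  moreover have "(\<integral>\<^sup>+t. ennreal (a + t\<^sup>2 * b) \<partial>gauss)
      = (\<integral>\<^sup>+t. ennreal a + ennreal (t\<^sup>2) * ennreal b \<partial>gauss)"
    using assms by (simp add: ennreal_mult)
  ultimately show ?thesis using assms
    by (simp add: nn_integral_add nn_integral_multc gauss.emeasure_space_1[simplified])
qed

text \<open>The expectation of \<open>f (\<Sum> \<gamma>\<^sub>i z\<^sub>i)\<close> with independent standard Gaussian \<open>\<gamma>\<^sub>i\<close>, as an iterated
  integral: the number of vectors varies inside the proofs, and a list avoids product spaces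
  that depend on it.\<close>

primrec gauss_avg :: "(nat \<Rightarrow> real) list \<Rightarrow> ((nat \<Rightarrow> real) \<Rightarrow> ennreal) \<Rightarrow> ennreal" where
  "gauss_avg [] f = f 0"
| "gauss_avg (z # zs) f = (\<integral>\<^sup>+t. gauss_avg zs (\<lambda>v. f (t *\<^sub>R z + v)) \<partial>gauss)"

lemma measurable_gauss_avg [measurable]:
  fixes f :: "(nat \<Rightarrow> real) \<Rightarrow> ennreal"
  assumes "f \<in> borel_measurable borel"
  shows "(\<lambda>x. gauss_avg zs (\<lambda>v. f (x + v))) \<in> borel_measurable borel"
  using assms
proof (induction zs arbitrary: f)
  case (Cons z zs)
  note [measurable] = Cons.IH[OF Cons.prems]
  have "(\<lambda>x. \<integral>\<^sup>+t. gauss_avg zs (\<lambda>v. f ((x + t *\<^sub>R z) + v)) \<partial>gauss) \<in> borel_measurable borel"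
    by measurable
  then show ?case by (simp only: gauss_avg.simps add.assoc)
qed simp

lemma measurable_gauss_avg_line [measurable]:
  fixes f :: "(nat \<Rightarrow> real) \<Rightarrow> ennreal"
  assumes [measurable]: "f \<in> borel_measurable borel"
  shows "(\<lambda>t. gauss_avg zs (\<lambda>v. f (t *\<^sub>R z + v))) \<in> borel_measurable borel"
proof -
  note [measurable] = measurable_gauss_avg[OF assms, of zs]
  show ?thesis by measurable
qed

lemma gauss_avg_mono: "(\<And>v. f v \<le> g v) \<Longrightarrow> gauss_avg zs f \<le> gauss_avg zs g"
  by (induction zs arbitrary: f g) (simp_all add: nn_integral_mono)

lemma gauss_avg_const: "gauss_avg zs (\<lambda>_. c) = c"
  by (induction zs) (simp_all add: gauss.emeasure_space_1[simplified])

lemma gauss_avg_add: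
  fixes f g :: "(nat \<Rightarrow> real) \<Rightarrow> ennreal"
  assumes "f \<in> borel_measurable borel" "g \<in> borel_measurable borel"
  shows "gauss_avg zs (\<lambda>v. f v + g v) = gauss_avg zs f + gauss_avg zs g"
  using assms
proof (induction zs arbitrary: f g)
  case (Cons z zs)
  note [measurable] = Cons.prems
  have "gauss_avg (z # zs) (\<lambda>v. f v + g v)
      = (\<integral>\<^sup>+t. gauss_avg zs (\<lambda>v. f (t *\<^sub>R z + v)) + gauss_avg zs (\<lambda>v. g (t *\<^sub>R z + v)) \<partial>gauss)"
    by (simp add: Cons.IH)
  then show ?case by (simp add: nn_integral_add)
qed simp

lemma gauss_avg_cmult:
  fixes f :: "(nat \<Rightarrow> real) \<Rightarrow> ennreal"
  assumes "f \<in> borel_measurable borel"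
  shows "gauss_avg zs (\<lambda>v. c * f v) = c * gauss_avg zs f"
  using assms
proof (induction zs arbitrary: f)
  case (Cons z zs)
  note [measurable] = Cons.prems
  have "gauss_avg (z # zs) (\<lambda>v. c * f v) = (\<integral>\<^sup>+t. c * gauss_avg zs (\<lambda>v. f (t *\<^sub>R z + v)) \<partial>gauss)"
    by (simp add: Cons.IH)
  then show ?case by (simp add: nn_integral_cmult)
qed simp

lemma gauss_avg_append:
  "gauss_avg (xs @ ys) f = gauss_avg xs (\<lambda>u. gauss_avg ys (\<lambda>v. f (u + v)))"
  by (induction xs arbitrary: f) (simp_all add: add.assoc)

lemma gauss_avg_rotate:
  fixes f :: "(nat \<Rightarrow> real) \<Rightarrow> ennreal"
  assumes [measurable]: "f \<in> borel_measurable borel" and cs: "c\<^sup>2 + s\<^sup>2 = 1"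
  shows "gauss_avg ((c *\<^sub>R x + s *\<^sub>R y) # ((- s) *\<^sub>R x + c *\<^sub>R y) # zs) f = gauss_avg (x # y # zs) f"
proof -
  define G where "G = (\<lambda>v. gauss_avg zs (\<lambda>w. f (v + w)))"
  have [measurable]: "G \<in> borel_measurable borel" unfolding G_def by (rule measurable_gauss_avg) simp
  have pair: "gauss_avg (a # b # zs) f = (\<integral>\<^sup>+s. \<integral>\<^sup>+t. G (s *\<^sub>R a + t *\<^sub>R b) \<partial>gauss \<partial>gauss)" for a b
    by (simp add: G_def add.assoc)
  define h where "h = (\<lambda>p. G (fst p *\<^sub>R x + snd p *\<^sub>R y))"
  have "h \<in> borel_measurable (borel \<Otimes>\<^sub>M borel)" unfolding h_def by measurable
  from gauss_rotate[OF this cs] show ?thesis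
    unfolding pair by (simp add: h_def algebra_simps)
qed

text \<open>The covariance matrix of the Gaussian sum.\<close>

definition gram :: "(nat \<Rightarrow> real) list \<Rightarrow> nat \<Rightarrow> nat \<Rightarrow> real" where
  "gram zs i j = (\<Sum>z\<leftarrow>zs. z i * z j)"

lemma gram_rotate:
  assumes "c\<^sup>2 + s\<^sup>2 = 1"
  shows "gram ((c *\<^sub>R x + s *\<^sub>R y) # ((- s) *\<^sub>R x + c *\<^sub>R y) # zs) = gram (x # y # zs)"
proof (intro ext)
  fix i j
  have "(c * x i + s * y i) * (c * x j + s * y j) + (c * y i - s * x i) * (c * y j - s * x j)
     = (c\<^sup>2 + s\<^sup>2) * (x i * x j + y i * y j)"
    by (simp add: power2_eq_square algebra_simps)
  then show "gram ((c *\<^sub>R x + s *\<^sub>R y) # ((- s) *\<^sub>R x + c *\<^sub>R y) # zs) i j = gram (x # y # zs) i j"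
    using assms by (simp add: gram_def scaleR_fun_def)
qed

text \<open>Givens rotations of neighbouring vectors clear one coordinate in all vectors but the
  first; they change neither the Gaussian average nor the Gram matrix.\<close>

lemma gauss_avg_eliminate:
  assumes "set zs \<subseteq> coord_space J"
  shows "\<exists>w ws. 0 \<le> w k \<and> (\<forall>u\<in>set ws. u k = 0) \<and> set (w # ws) \<subseteq> coord_space J \<and>
           gram (w # ws) = gram zs \<and>
           (\<forall>f \<in> borel_measurable borel. gauss_avg (w # ws) f = gauss_avg zs f)"
  using assms
proof (induction zs)
  case Nil
  have "gauss_avg [0] f = gauss_avg [] f" for f
    by (simp only: gauss_avg.simps scaleR_zero_right add_0) (simp add: gauss.emeasure_space_1[simplified])
  moreover have "gram [0] = gram []" by (simp add: gram_def fun_eq_iff)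
  ultimately show ?case
    by (intro exI[of _ "0"] exI[of _ "[]"])
      (simp only: list.set ball_simps, simp add: subspace_0[OF subspace_coord_space])
next
  case (Cons z zs)
  have "set zs \<subseteq> coord_space J" using Cons.prems by simp
  from Cons.IH[OF this] obtain w ws where w: "0 \<le> w k" "\<And>u. u \<in> set ws \<Longrightarrow> u k = 0"
    "set (w # ws) \<subseteq> coord_space J" "gram (w # ws) = gram zs"
    "\<And>f. f \<in> borel_measurable borel \<Longrightarrow> gauss_avg (w # ws) f = gauss_avg zs f" by blast
  define r where "r = sqrt ((z k)\<^sup>2 + (w k)\<^sup>2)"
  define c where "c = (if r = 0 then 1 else z k / r)"
  define s where "s = (if r = 0 then 0 else w k / r)"
  have r2: "r\<^sup>2 = (z k)\<^sup>2 + (w k)\<^sup>2" by (simp add: r_def)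
  have "c\<^sup>2 + s\<^sup>2 = 1"
  proof (cases "r = 0")
    case False
    then have "c\<^sup>2 + s\<^sup>2 = ((z k)\<^sup>2 + (w k)\<^sup>2) / r\<^sup>2"
      by (simp add: c_def s_def power_divide add_divide_distrib)
    then show ?thesis using False by (simp only: r2[symmetric]) simp
  qed (simp add: c_def s_def)
  note cs = this
  have zero: "r = 0 \<Longrightarrow> z k = 0 \<and> w k = 0" using r2 by (simp add: sum_power2_eq_zero_iff)
  define z' where "z' = c *\<^sub>R z + s *\<^sub>R w"
  define w' where "w' = (- s) *\<^sub>R z + c *\<^sub>R w"
  have "z' k = r"
  proof (cases "r = 0")
    case False
    then have "z' k = ((z k)\<^sup>2 + (w k)\<^sup>2) / r"
      by (simp add: z'_def scaleR_fun_def c_def s_def power2_eq_square add_divide_distrib)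
    then show ?thesis using False by (simp flip: r2) (simp add: power2_eq_square)
  qed (use zero in \<open>simp add: z'_def scaleR_fun_def\<close>)
  moreover have "w' k = 0" by (simp add: w'_def scaleR_fun_def c_def s_def zero)
  moreover have "z' \<in> coord_space J" "w' \<in> coord_space J"
    using Cons.prems w(3) unfolding z'_def w'_def
    by (auto intro!: subspace_add[OF subspace_coord_space] subspace_diff[OF subspace_coord_space]
        subspace_scale[OF subspace_coord_space])
  moreover have "gram (z' # w' # ws) = gram (z # zs)"
  proof -
    have "gram (z # w # ws) = gram (z # zs)"
      using w(4) by (simp add: gram_def fun_eq_iff)
    then show ?thesis unfolding z'_def w'_def gram_rotate[OF cs] .
  qed
  moreover have "gauss_avg (z' # w' # ws) f = gauss_avg (z # zs) f" if [measurable]: "f \<in> borel_measurable borel" for f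
  proof -
    have "gauss_avg (z' # w' # ws) f = gauss_avg (z # w # ws) f"
      unfolding z'_def w'_def by (rule gauss_avg_rotate[OF that cs])
    also have "\<dots> = gauss_avg (z # zs) f"
      using w(5) by (simp del: gauss_avg.simps add: gauss_avg.simps(2)[of z])
    finally show ?thesis .
  qed
  moreover have "0 \<le> r" by (simp add: r_def)
  ultimately show ?case using w(2,3)
    by (intro exI[of _ z'] exI[of _ "w' # ws"]) auto
qed

text \<open>A Gaussian sum is determined in law by its covariance matrix. Eliminating one coordinate
  after the other amounts to the Cholesky factorisation of the Gram matrix: if \<open>w\<close> is the only
  vector that is nonzero at the coordinate \<open>k\<close>, then the row \<open>k\<close> of the Gram matrix is \<open>w k\<close> times \<open>w\<close>.
  Its entry at \<open>k\<close> determines \<open>w k\<close>, which is nonnegative, and so the row determines \<open>w\<close> unless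
  \<open>w k = 0\<close>.\<close>

lemma gauss_avg_eq_of_gram_eq:
  assumes "finite J" "set xs \<subseteq> coord_space J" "set ys \<subseteq> coord_space J" "gram xs = gram ys"
    "f \<in> borel_measurable borel"
  shows "gauss_avg xs f = gauss_avg ys f"
  using assms
proof (induction J arbitrary: xs ys f rule: finite_induct)
  case empty
  have 0: "gauss_avg zs f = f 0" if "set zs \<subseteq> coord_space {}" for zs :: "(nat \<Rightarrow> real) list" and f
    using that
  proof (induction zs arbitrary: f)
    case (Cons z zs)
    have "z = 0" using Cons.prems by (auto simp: coord_space_def)
    moreover have "set zs \<subseteq> coord_space {}" using Cons.prems by simp
    ultimately have "z = 0" "\<And>f. gauss_avg zs f = f 0" using Cons.IH by blast+
    then have "gauss_avg (z # zs) f = (\<integral>\<^sup>+t. f 0 \<partial>gauss)"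
      by (simp only: gauss_avg.simps scaleR_zero_right add_0)
    moreover have "(\<integral>\<^sup>+t. k \<partial>gauss) = k" for k
      by (simp add: gauss.emeasure_space_1[simplified])
    ultimately show ?case by (simp only:)
  qed simp
  show ?case using 0[OF empty.prems(1)] 0[OF empty.prems(2)] by simp
next
  case (insert k J)
  have drop: "z \<in> coord_space J" if "z \<in> coord_space (insert k J)" "z k = 0" for z :: "nat \<Rightarrow> real"
    using that by (auto simp: coord_space_def)
  obtain w ws where w: "0 \<le> w k" "\<And>u. u \<in> set ws \<Longrightarrow> u k = 0" "set (w # ws) \<subseteq> coord_space (insert k J)"
    "gram (w # ws) = gram xs"
    "\<And>f. f \<in> borel_measurable borel \<Longrightarrow> gauss_avg (w # ws) f = gauss_avg xs f"
    using gauss_avg_eliminate[OF insert.prems(1), of k] by blast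
  obtain u us where u: "0 \<le> u k" "\<And>v. v \<in> set us \<Longrightarrow> v k = 0" "set (u # us) \<subseteq> coord_space (insert k J)"
    "gram (u # us) = gram ys"
    "\<And>f. f \<in> borel_measurable borel \<Longrightarrow> gauss_avg (u # us) f = gauss_avg ys f"
    using gauss_avg_eliminate[OF insert.prems(2), of k] by blast
  have gr: "gram (w # ws) = gram (u # us)" using w(4) u(4) insert.prems(3) by simp
  have row: "gram (z # zs) k j = z k * z j" if "\<And>v. v \<in> set zs \<Longrightarrow> v k = 0" for z zs j
  proof -
    have "(\<Sum>v\<leftarrow>zs. v k * v j) = (\<Sum>v\<leftarrow>zs. 0)" by (intro arg_cong[of _ _ sum_list] map_cong) (simp_all add: that)
    then show ?thesis by (simp add: gram_def)
  qed
  have rows: "w k * w j = u k * u j" for j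
    using row[of ws w j] row[of us u j] w(2) u(2) gr by simp
  have wk: "w k = u k" using rows[of k] w(1) u(1) by (simp add: power2_eq_iff_nonneg flip: power2_eq_square)
  have "gauss_avg (w # ws) f = gauss_avg (u # us) f"
  proof (cases "w k = 0")
    case True
    show ?thesis
    proof (rule insert.IH[OF _ _ gr insert.prems(4)])
      show "set (w # ws) \<subseteq> coord_space J" using w(2,3) True drop by auto
      show "set (u # us) \<subseteq> coord_space J" using u(2,3) True wk drop by auto
    qed
  next
    case False
    then have "w = u" using rows wk by (simp add: fun_eq_iff)
    moreover have "gram ws = gram us" using gr \<open>w = u\<close> by (simp add: gram_def fun_eq_iff)
    moreover have "set ws \<subseteq> coord_space J" "set us \<subseteq> coord_space J" using w(2,3) u(2,3) drop by auto
    moreover note [measurable] = insert.prems(4)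
    have "(\<lambda>v. f (t *\<^sub>R u + v)) \<in> borel_measurable borel" for t by measurable
    ultimately have "gauss_avg ws (\<lambda>v. f (t *\<^sub>R u + v)) = gauss_avg us (\<lambda>v. f (t *\<^sub>R u + v))" for t
      by (intro insert.IH)
    then show ?thesis using \<open>w = u\<close> by simp
  qed
  then show ?case using w(5) u(5) insert.prems(4) by simp
qed

section \<open>Gaussian averages of a seminorm of type 2\<close>

lemma measurable_sign_avg:
  "(\<And>e. (\<lambda>v. F v e) \<in> borel_measurable M) \<Longrightarrow> (\<lambda>v. sign_avg m (F v)) \<in> borel_measurable M"
proof (induction m arbitrary: F)
  case (Suc m)
  have "(\<lambda>v. sign_avg m (\<lambda>e. F v (s # e))) \<in> borel_measurable M" for s
    by (rule Suc.IH) (rule Suc.prems)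
  then show ?case by simp
qed simp

text \<open>The mean over independent Gaussian and sign variables of \<open>f\<close> at the sum of all vectors,
  where the vectors of the first list carry both kinds of factors and those of the second only
  signs.\<close>

primrec gauss_sign_avg ::
    "(nat \<Rightarrow> real) list \<Rightarrow> (nat \<Rightarrow> real) list \<Rightarrow> ((nat \<Rightarrow> real) \<Rightarrow> real) \<Rightarrow> ennreal" where
  "gauss_sign_avg [] ws f = ennreal (sign_avg (length ws) (\<lambda>e. f (signed_sum ws e)))"
| "gauss_sign_avg (z # zs) ws f = (\<integral>\<^sup>+t. gauss_sign_avg zs (t *\<^sub>R z # ws) f \<partial>gauss)"

text \<open>A symmetric Gaussian variable may be multiplied by an independent sign.\<close>

lemma gauss_sign_avg_eq:
  assumes f: "f \<in> borel_measurable borel" and nn: "\<And>v. 0 \<le> f v"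
  shows "gauss_sign_avg zs ws f
      = gauss_avg zs (\<lambda>v. ennreal (sign_avg (length ws) (\<lambda>e. f (v + signed_sum ws e))))"
proof (induction zs arbitrary: ws)
  case Nil
  show ?case by (simp only: gauss_sign_avg.simps gauss_avg.simps add_0)
next
  case (Cons z zs)
  note [measurable] = f
  define r where "r = (\<lambda>v. sign_avg (length ws) (\<lambda>e. f (v + signed_sum ws e)))"
  have [measurable]: "r \<in> borel_measurable borel"
    unfolding r_def by (rule measurable_sign_avg) measurable
  have r0: "0 \<le> r v" for v unfolding r_def by (rule sign_avg_nonneg) (rule nn)
  have half: "ennreal (1/2) * (x + x) = x" for x :: ennreal
  proof -
    have "ennreal (1/2) * (x + x) = (ennreal (1/2) * 2) * x" by (simp add: mult_2 distrib_left mult.assoc)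
    also have "ennreal (1/2) * 2 = ennreal (1/2 * 2)" by (subst ennreal_mult) simp_all
    finally show ?thesis by simp
  qed
  define G where "G = (\<lambda>t. gauss_avg zs (\<lambda>v. ennreal (r (t *\<^sub>R z + v))))"
  have [measurable]: "G \<in> borel_measurable borel" unfolding G_def by measurable
  have step: "gauss_sign_avg zs (t *\<^sub>R z # ws) f = ennreal (1/2) * (G t + G (- t))" for t
  proof -
    have "sign_avg (length (t *\<^sub>R z # ws)) (\<lambda>e. f (v + signed_sum (t *\<^sub>R z # ws) e))
        = 1/2 * (r (t *\<^sub>R z + v) + r ((- t) *\<^sub>R z + v))" for v
    proof -
      have "v + (1 *\<^sub>R y + s) = (y + v) + s" "v + ((-1) *\<^sub>R y + s) = ((-1) *\<^sub>R y + v) + s" for y s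
        by (simp_all add: fun_eq_iff)
      then show ?thesis
        by (simp only: list.size(4) add_Suc_right add_0_right sign_avg.simps signed_sum.simps r_def) simp
    qed
    then have "gauss_sign_avg zs (t *\<^sub>R z # ws) f
        = gauss_avg zs (\<lambda>v. ennreal (1/2) * (ennreal (r (t *\<^sub>R z + v)) + ennreal (r ((- t) *\<^sub>R z + v))))"
      unfolding Cons.IH using r0 by (simp only: ennreal_mult ennreal_plus add_nonneg_nonneg divide_nonneg_nonneg zero_le_one zero_le_numeral)
    moreover have "(\<lambda>v. ennreal (r (t *\<^sub>R z + v))) \<in> borel_measurable borel" for t by measurable
    note m = this
    ultimately show ?thesis
      by (simp only: gauss_avg_cmult[OF borel_measurable_add[OF m m]] gauss_avg_add[OF m m] G_def)
  qed
  have "gauss_sign_avg (z # zs) ws f = ennreal (1/2) * ((\<integral>\<^sup>+t. G t \<partial>gauss) + (\<integral>\<^sup>+t. G (- t) \<partial>gauss))"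
    by (simp add: step nn_integral_cmult nn_integral_add)
  also have "\<dots> = (\<integral>\<^sup>+t. G t \<partial>gauss)"
    by (subst gauss_reflect) (simp_all only: half, measurable)
  finally show ?case by (simp only: G_def r_def gauss_avg.simps)
qed

text \<open>Inserting independent signs and conditioning on the Gaussian factors reduces the estimate
  to the sign average of the vectors \<open>\<gamma>\<^sub>i z\<^sub>i\<close>; then \<open>E \<gamma>\<^sub>i\<^sup>2 = 1\<close>.\<close>

lemma gauss_avg_le_of_sign_avg_le:
  assumes f: "f \<in> borel_measurable borel" and nn: "\<And>v. 0 \<le> f v"
    and hom: "\<And>t v. f (t *\<^sub>R v) = t\<^sup>2 * f v" and C: "0 \<le> C"
    and le: "\<And>ws. sign_avg (length ws) (\<lambda>e. f (signed_sum ws e)) \<le> C * (\<Sum>w\<leftarrow>ws. f w)"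
  shows "gauss_avg zs (\<lambda>v. ennreal (f v)) \<le> ennreal (C * (\<Sum>z\<leftarrow>zs. f z))"
proof -
  have S: "0 \<le> (\<Sum>w\<leftarrow>ws. f w)" for ws by (rule sum_list_nonneg) (auto simp: nn)
  have "gauss_sign_avg zs ws f \<le> ennreal (C * ((\<Sum>z\<leftarrow>zs. f z) + (\<Sum>w\<leftarrow>ws. f w)))" for ws
  proof (induction zs arbitrary: ws)
    case (Cons z zs)
    have "gauss_sign_avg (z # zs) ws f
        \<le> (\<integral>\<^sup>+t. ennreal (C * ((\<Sum>z\<leftarrow>zs. f z) + (\<Sum>w\<leftarrow>ws. f w)) + t\<^sup>2 * (C * f z)) \<partial>gauss)"
      unfolding gauss_sign_avg.simps
    proof (rule nn_integral_mono)
      fix t :: real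
      show "gauss_sign_avg zs (t *\<^sub>R z # ws) f
        \<le> ennreal (C * ((\<Sum>z\<leftarrow>zs. f z) + (\<Sum>w\<leftarrow>ws. f w)) + t\<^sup>2 * (C * f z))"
        using Cons.IH[of "t *\<^sub>R z # ws"] by (simp add: hom algebra_simps)
    qed
    also have "\<dots> = ennreal (C * ((\<Sum>z\<leftarrow>zs. f z) + (\<Sum>w\<leftarrow>ws. f w)) + C * f z)"
      using C S nn by (intro gauss_second_moment) auto
    finally show ?case by (simp add: algebra_simps)
  qed (simp add: ennreal_leI le)
  from this[of "[]"] show ?thesis by (simp add: gauss_sign_avg_eq[OF f nn])
qed

lemma sign_avg_bilinear:
  fixes B :: "'v::real_vector \<Rightarrow> 'v \<Rightarrow> real"
  assumes B: "bilinear B"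
  shows "sign_avg (length ws) (\<lambda>e. B (x + signed_sum ws e) (x + signed_sum ws e))
     = B x x + (\<Sum>w\<leftarrow>ws. B w w)"
proof (induction ws arbitrary: x)
  case (Cons w ws)
  have "sign_avg (length (w # ws)) (\<lambda>e. B (x + signed_sum (w # ws) e) (x + signed_sum (w # ws) e))
    = (B (x + w) (x + w) + B (x - w) (x - w)) / 2 + (\<Sum>w\<leftarrow>ws. B w w)"
    using Cons.IH[of "x + w"] Cons.IH[of "x - w"] by (simp add: algebra_simps)
  also have "B (x + w) (x + w) + B (x - w) (x - w) = 2 * (B x x + B w w)"
    by (simp add: bilinear_simps[OF B])
  finally show ?case by simp
qed simp

lemma gauss_avg_inner_on_le:
  assumes "0 \<le> c"
  shows "gauss_avg ws (\<lambda>v. ennreal (c * inner_on I v v)) \<le> ennreal (c * (\<Sum>w\<leftarrow>ws. inner_on I w w))"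
proof -
  have "gauss_avg ws (\<lambda>v. ennreal (c * inner_on I v v)) \<le> ennreal (1 * (\<Sum>w\<leftarrow>ws. c * inner_on I w w))"
  proof (rule gauss_avg_le_of_sign_avg_le)
    show "(\<lambda>v. c * inner_on I v v) \<in> borel_measurable borel"
      unfolding inner_on_def by measurable
    show "sign_avg (length ws) (\<lambda>e. c * inner_on I (signed_sum ws e) (signed_sum ws e))
        \<le> 1 * (\<Sum>w\<leftarrow>ws. c * inner_on I w w)" for ws
      using sign_avg_bilinear[OF bilinear_inner_on, of ws I 0]
      by (simp add: sign_avg_cmult bilinear_simps[OF bilinear_inner_on] sum_list_const_mult)
  qed (use assms in \<open>auto simp: inner_on_self_nonneg bilinear_simps[OF bilinear_inner_on] power2_eq_square\<close>)
  then show ?thesis by (simp add: sum_list_const_mult)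
qed

lemma seminorm_square_midpoint:
  assumes q: "seminorm q"
  shows "2 * (q x)\<^sup>2 \<le> (q (x + y))\<^sup>2 + (q (x - y))\<^sup>2"
proof -
  have "2 * q x \<le> q (x + y) + q (x - y)"
    using seminorm_triangle[OF q, of "x + y" "x - y"] seminorm_scale[OF q, of 2 x] by (simp add: scaleR_2)
  then have "(2 * q x)\<^sup>2 \<le> (q (x + y) + q (x - y))\<^sup>2"
    using seminorm_nonneg[OF q] by (intro power_mono) auto
  also have "\<dots> \<le> 2 * ((q (x + y))\<^sup>2 + (q (x - y))\<^sup>2)"
    using sum_squares_bound[of "q (x + y)" "q (x - y)"] by (simp add: power2_eq_square algebra_simps)
  finally show ?thesis by simp
qed

lemma seminorm_square_add_le:
  assumes q: "seminorm q"
  shows "(q (x + y))\<^sup>2 \<le> 2 * (q x)\<^sup>2 + 2 * (q y)\<^sup>2"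
proof -
  have "(q (x + y))\<^sup>2 \<le> (q x + q y)\<^sup>2"
    using seminorm_nonneg[OF q] seminorm_triangle[OF q] by (intro power_mono) auto
  also have "\<dots> \<le> 2 * (q x)\<^sup>2 + 2 * (q y)\<^sup>2"
    using sum_squares_bound[of "q x" "q y"] by (simp add: power2_eq_square algebra_simps)
  finally show ?thesis .
qed

lemma measurable_seminorm_square:
  "q \<in> borel_measurable M \<Longrightarrow> (\<lambda>v. ennreal ((q v)\<^sup>2)) \<in> borel_measurable M"
  by (intro measurable_compose[OF _ measurable_ennreal] borel_measurable_power)

text \<open>Adding an independent symmetric vector cannot decrease the mean of a convex function.\<close>

lemma gauss_avg_translate_ge:
  assumes q: "seminorm q" and meas: "q \<in> borel_measurable borel"
  shows "ennreal ((q u)\<^sup>2) \<le> gauss_avg ys (\<lambda>v. ennreal ((q (u + v))\<^sup>2))"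
proof (induction ys arbitrary: u)
  case (Cons y ys)
  have "(\<lambda>t. u + t *\<^sub>R y) \<in> borel_measurable borel" by measurable
  note line [measurable] = measurable_compose[OF this measurable_seminorm_square[OF meas]]
  have "(\<lambda>t. u + (- t) *\<^sub>R y) \<in> borel_measurable borel" by measurable
  note line' = measurable_compose[OF this measurable_seminorm_square[OF meas]]
  define A where "A = (\<integral>\<^sup>+t. ennreal ((q (u + t *\<^sub>R y))\<^sup>2) \<partial>gauss)"
  have A': "(\<integral>\<^sup>+t. ennreal ((q (u + (- t) *\<^sub>R y))\<^sup>2) \<partial>gauss) = A"
    unfolding A_def by (rule gauss_reflect[OF line])
  have "2 * ennreal ((q u)\<^sup>2) = (\<integral>\<^sup>+t. ennreal (2 * (q u)\<^sup>2) \<partial>gauss)"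
    by (simp add: gauss.emeasure_space_1[simplified] ennreal_mult)
  also have "\<dots> \<le> (\<integral>\<^sup>+t. ennreal ((q (u + t *\<^sub>R y))\<^sup>2) + ennreal ((q (u + (- t) *\<^sub>R y))\<^sup>2) \<partial>gauss)"
    using seminorm_square_midpoint[OF q]
    by (intro nn_integral_mono) (simp add: ennreal_plus[symmetric] ennreal_leI del: ennreal_plus)
  also have "\<dots> = A + (\<integral>\<^sup>+t. ennreal ((q (u + (- t) *\<^sub>R y))\<^sup>2) \<partial>gauss)"
    unfolding A_def using line line' by (intro nn_integral_add) simp_all
  also have "\<dots> = 2 * A" unfolding A' by (simp add: mult_2)
  finally have "ennreal ((q u)\<^sup>2) \<le> A" by (simp add: ennreal_mult_le_mult_iff)
  also have "A \<le> (\<integral>\<^sup>+t. gauss_avg ys (\<lambda>v. ennreal ((q ((u + t *\<^sub>R y) + v))\<^sup>2)) \<partial>gauss)"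
    unfolding A_def by (intro nn_integral_mono Cons.IH)
  finally show ?case by (simp only: gauss_avg.simps add.assoc)
qed (simp only: gauss_avg.simps add_0_right order_refl)

lemma type2_gauss:
  assumes q: "seminorm q" and meas: "q \<in> borel_measurable borel"
    and M: "0 \<le> M"
    and type2: "\<And>zs. sign_avg (length zs) (\<lambda>e. q (signed_sum zs e)) \<le> M * sqrt (\<Sum>z\<leftarrow>zs. (q z)\<^sup>2)"
  shows "gauss_avg xs (\<lambda>v. ennreal ((q v)\<^sup>2)) \<le> ennreal (2 * M\<^sup>2 * (\<Sum>x\<leftarrow>xs. (q x)\<^sup>2))"
proof (rule gauss_avg_le_of_sign_avg_le)
  show "(\<lambda>v. (q v)\<^sup>2) \<in> borel_measurable borel" using meas by (rule borel_measurable_power)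
  fix ws :: "(nat \<Rightarrow> real) list"
  have S: "0 \<le> (\<Sum>z\<leftarrow>ws. (q z)\<^sup>2)" by (rule sum_list_nonneg) auto
  have "sign_avg (length ws) (\<lambda>e. (q (signed_sum ws e))\<^sup>2)
      \<le> 2 * (sign_avg (length ws) (\<lambda>e. q (signed_sum ws e)))\<^sup>2"
    by (rule kahane_second_moment[OF q])
  also have "\<dots> \<le> 2 * (M * sqrt (\<Sum>z\<leftarrow>ws. (q z)\<^sup>2))\<^sup>2"
    using type2[of ws] sign_avg_nonneg[of "\<lambda>e. q (signed_sum ws e)"] seminorm_nonneg[OF q]
    by (intro mult_left_mono power_mono) auto
  also have "\<dots> = 2 * M\<^sup>2 * (\<Sum>z\<leftarrow>ws. (q z)\<^sup>2)" using S by (simp add: power_mult_distrib)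
  finally show "sign_avg (length ws) (\<lambda>e. (q (signed_sum ws e))\<^sup>2) \<le> 2 * M\<^sup>2 * (\<Sum>z\<leftarrow>ws. (q z)\<^sup>2)" .
qed (simp_all add: seminorm_scale[OF q] power_mult_distrib)

text \<open>The Gram condition says that the sum over \<open>xs @ ws\<close> has the law of the sum over \<open>us\<close> plus an
  independent part. So its average dominates, and it splits into a part that is bounded by the
  type 2 property and a part that is bounded by the operator norm.\<close>

lemma gauss_avg_decomposition_le:
  assumes q: "seminorm q" and meas: "q \<in> borel_measurable borel" and "finite I"
    and M: "0 \<le> M"
    and type2: "\<And>zs. sign_avg (length zs) (\<lambda>e. q (signed_sum zs e)) \<le> M * sqrt (\<Sum>z\<leftarrow>zs. (q z)\<^sup>2)"
    and K: "0 \<le> K" "\<And>x. q x \<le> K * sqrt (inner_on I x x)"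
    and sets: "set us \<subseteq> coord_space I" "set xs \<subseteq> coord_space I" "set ws \<subseteq> coord_space I" "set ys \<subseteq> coord_space I"
    and gram: "gram (xs @ ws) = gram (us @ ys)"
  shows "gauss_avg us (\<lambda>v. ennreal ((q v)\<^sup>2))
           \<le> ennreal (4 * M\<^sup>2 * (\<Sum>x\<leftarrow>xs. (q x)\<^sup>2) + 2 * K\<^sup>2 * (\<Sum>w\<leftarrow>ws. inner_on I w w))"
proof -
  let ?Q = "\<lambda>v. ennreal ((q v)\<^sup>2)"
  note Q [measurable] = measurable_seminorm_square[OF meas]
  have nn: "0 \<le> (\<Sum>x\<leftarrow>xs. (q x)\<^sup>2)" "0 \<le> (\<Sum>w\<leftarrow>ws. inner_on I w w)"
    by (auto intro!: sum_list_nonneg simp: inner_on_self_nonneg)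
  have "gauss_avg us ?Q \<le> gauss_avg us (\<lambda>u. gauss_avg ys (\<lambda>v. ?Q (u + v)))"
    by (intro gauss_avg_mono gauss_avg_translate_ge q meas)
  also have "\<dots> = gauss_avg (us @ ys) ?Q" by (rule gauss_avg_append[symmetric])
  also have "\<dots> = gauss_avg (xs @ ws) ?Q"
    using sets by (intro gauss_avg_eq_of_gram_eq[OF \<open>finite I\<close> _ _ gram[symmetric] Q]) auto
  also have "\<dots> = gauss_avg xs (\<lambda>u. gauss_avg ws (\<lambda>v. ?Q (u + v)))" by (rule gauss_avg_append)
  also have "\<dots> \<le> gauss_avg xs (\<lambda>u. gauss_avg ws (\<lambda>v. 2 * ?Q u + 2 * ?Q v))"
  proof (intro gauss_avg_mono)
    fix u v
    have "?Q (u + v) \<le> ennreal (2 * (q u)\<^sup>2 + 2 * (q v)\<^sup>2)"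
      by (rule ennreal_leI) (rule seminorm_square_add_le[OF q])
    then show "?Q (u + v) \<le> 2 * ?Q u + 2 * ?Q v" by (simp add: ennreal_mult)
  qed
  also have "\<dots> = 2 * gauss_avg xs ?Q + 2 * gauss_avg ws ?Q"
    by (simp add: gauss_avg_add gauss_avg_cmult[OF Q] gauss_avg_const)
  also have "\<dots> \<le> 2 * ennreal (2 * M\<^sup>2 * (\<Sum>x\<leftarrow>xs. (q x)\<^sup>2)) + 2 * ennreal (K\<^sup>2 * (\<Sum>w\<leftarrow>ws. inner_on I w w))"
  proof (intro add_mono mult_left_mono)
    show "gauss_avg xs ?Q \<le> ennreal (2 * M\<^sup>2 * (\<Sum>x\<leftarrow>xs. (q x)\<^sup>2))" by (rule type2_gauss[OF q meas M type2])
    have "(q v)\<^sup>2 \<le> K\<^sup>2 * inner_on I v v" for v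
      using power_mono[OF K(2)[of v], of 2] seminorm_nonneg[OF q] inner_on_self_nonneg[of I v]
      by (simp add: power_mult_distrib)
    then have "gauss_avg ws ?Q \<le> gauss_avg ws (\<lambda>v. ennreal (K\<^sup>2 * inner_on I v v))"
      by (intro gauss_avg_mono ennreal_leI)
    also have "\<dots> \<le> ennreal (K\<^sup>2 * (\<Sum>w\<leftarrow>ws. inner_on I w w))" by (rule gauss_avg_inner_on_le) simp
    finally show "gauss_avg ws ?Q \<le> ennreal (K\<^sup>2 * (\<Sum>w\<leftarrow>ws. inner_on I w w))" .
  qed auto
  also have "\<dots> = ennreal (2 * (2 * M\<^sup>2 * (\<Sum>x\<leftarrow>xs. (q x)\<^sup>2)) + 2 * (K\<^sup>2 * (\<Sum>w\<leftarrow>ws. inner_on I w w)))"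
  proof -
    have two: "2 * ennreal c = ennreal (2 * c)" if "0 \<le> c" for c
      using that by (simp add: ennreal_mult)
    have "0 \<le> 2 * M\<^sup>2 * (\<Sum>x\<leftarrow>xs. (q x)\<^sup>2)" "0 \<le> K\<^sup>2 * (\<Sum>w\<leftarrow>ws. inner_on I w w)"
      using nn by simp_all
    then show ?thesis by (simp only: two) (simp add: ennreal_plus[symmetric] del: ennreal_plus)
  qed
  finally show ?thesis by (simp add: mult.assoc)
qed

lemma gauss_avg_unit_vec_le:
  assumes q: "seminorm q" and K: "0 \<le> K" "\<And>x. q x \<le> K * sqrt (inner_on I x x)"
    and ks: "distinct ks" "set ks = I"
  shows "gauss_avg (map unit_vec ks) (\<lambda>v. ennreal ((q v)\<^sup>2)) \<le> ennreal (K\<^sup>2 * real (card I))"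
proof -
  have "(q v)\<^sup>2 \<le> K\<^sup>2 * inner_on I v v" for v
    using power_mono[OF K(2)[of v], of 2] seminorm_nonneg[OF q] inner_on_self_nonneg[of I v]
    by (simp add: power_mult_distrib)
  then have "gauss_avg (map unit_vec ks) (\<lambda>v. ennreal ((q v)\<^sup>2))
      \<le> gauss_avg (map unit_vec ks) (\<lambda>v. ennreal (K\<^sup>2 * inner_on I v v))"
    by (intro gauss_avg_mono ennreal_leI)
  also have "\<dots> \<le> ennreal (K\<^sup>2 * (\<Sum>w\<leftarrow>map unit_vec ks. inner_on I w w))"
    by (rule gauss_avg_inner_on_le) simp
  also have "(\<Sum>w\<leftarrow>map unit_vec ks. inner_on I w w) = real (card I)"
  proof -
    have "finite I" using ks by auto
    then have "inner_on I (unit_vec k) (unit_vec k) = 1" if "k \<in> I" for k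
      using that by (simp add: inner_on_unit_vec) (simp add: unit_vec_def)
    then show ?thesis using ks by (simp add: o_def sum_list_distinct_conv_sum_set)
  qed
  finally show ?thesis .
qed

section \<open>Finite-dimensional Hahn-Banach extension\<close>

text \<open>Positive homogeneity is required for positive factors only, hence the separate condition
  at 0.\<close>

definition sublinear :: "('v::real_vector \<Rightarrow> real) \<Rightarrow> bool" where
  "sublinear W \<longleftrightarrow> W 0 = 0 \<and> (\<forall>a>0. \<forall>x. W (a *\<^sub>R x) = a * W x) \<and> (\<forall>x y. W (x + y) \<le> W x + W y)"

lemma sublinear_uminus_ge: "sublinear W \<Longrightarrow> - W x \<le> W (- x)"
proof -
  assume "sublinear W"
  then have "W (x + (- x)) \<le> W x + W (- x)" "W 0 = 0" unfolding sublinear_def by blast+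
  then show ?thesis by simp
qed

text \<open>The functional \<open>W' x = inf (W (x + t b) - t W b)\<close> over \<open>t \<ge> 0\<close> is the largest sublinear one
  below \<open>W\<close> that is linear on the line through \<open>b\<close> with the same value at \<open>b\<close>.\<close>

lemma sublinear_linearize:
  assumes W: "sublinear W"
  shows "\<exists>W'. sublinear W' \<and> (\<forall>x. W' x \<le> W x) \<and> W' (- b) = - W b \<and> W' b = W b"
proof -
  have W0: "W 0 = 0" and Wh: "\<And>a x. 0 < a \<Longrightarrow> W (a *\<^sub>R x) = a * W x"
    and Wa: "\<And>x y. W (x + y) \<le> W x + W y" using W by (auto simp: sublinear_def)
  have Wh0: "W (a *\<^sub>R x) = a * W x" if "0 \<le> a" for a x
    using Wh[of a x] W0 that by (cases "a = 0") auto
  define S where "S = (\<lambda>x. (\<lambda>t. W (x + t *\<^sub>R b) - t * W b) ` {0..})"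
  define W' where "W' = (\<lambda>x. Inf (S x))"
  have lower: "- W (- x) \<le> W (x + t *\<^sub>R b) - t * W b" if "0 \<le> t" for x t
    using Wa[of "x + t *\<^sub>R b" "- x"] Wh0[OF that, of b] by (simp add: algebra_simps)
  have bdd: "bdd_below (S x)" for x
    by (rule bdd_belowI[of _ "- W (- x)"]) (auto simp: S_def lower)
  have ne: "S x \<noteq> {}" for x by (simp add: S_def)
  have le: "W' x \<le> W (x + t *\<^sub>R b) - t * W b" if "0 \<le> t" for x t
    unfolding W'_def by (rule cInf_lower[OF _ bdd]) (use that in \<open>auto simp: S_def\<close>)
  have ge: "c \<le> W' x" if "\<And>t. 0 \<le> t \<Longrightarrow> c \<le> W (x + t *\<^sub>R b) - t * W b" for c x
    unfolding W'_def by (rule cInf_greatest[OF ne]) (use that in \<open>auto simp: S_def\<close>)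
  have leW: "W' x \<le> W x" for x using le[of 0 x] by simp
  have eqb: "W' b = W b"
  proof (rule antisym[OF leW ge])
    fix t :: real assume "0 \<le> t"
    then have "W ((1 + t) *\<^sub>R b) = (1 + t) * W b" by (intro Wh0) simp
    then show "W b \<le> W (b + t *\<^sub>R b) - t * W b" by (simp add: algebra_simps)
  qed
  have W'0: "W' 0 = 0"
    by (rule antisym) (use leW[of 0] W0 ge[of 0 0] Wh0 in auto)
  have W'h: "W' (a *\<^sub>R x) \<le> a * W' x" if "0 < a" for a x
  proof -
    have "W' (a *\<^sub>R x) / a \<le> W' x"
    proof (rule ge)
      fix t :: real assume t: "0 \<le> t"
      have "W' (a *\<^sub>R x) \<le> W (a *\<^sub>R x + (a * t) *\<^sub>R b) - (a * t) * W b"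
        using t that by (intro le) simp
      also have "a *\<^sub>R x + (a * t) *\<^sub>R b = a *\<^sub>R (x + t *\<^sub>R b)" by (simp add: algebra_simps)
      also have "W \<dots> - (a * t) * W b = a * (W (x + t *\<^sub>R b) - t * W b)"
        unfolding Wh[OF that] by (simp add: algebra_simps)
      finally show "W' (a *\<^sub>R x) / a \<le> W (x + t *\<^sub>R b) - t * W b"
        using that by (simp add: mult.commute pos_divide_le_eq)
    qed
    then show ?thesis using that by (simp add: field_simps)
  qed
  have W'hom: "W' (a *\<^sub>R x) = a * W' x" if a: "0 < a" for a x
  proof (rule antisym[OF W'h[OF a]])
    have "W' (inverse a *\<^sub>R (a *\<^sub>R x)) \<le> inverse a * W' (a *\<^sub>R x)" using a by (intro W'h) simp
    then show "a * W' x \<le> W' (a *\<^sub>R x)" using a by (simp add: field_simps)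
  qed
  have W'add: "W' (x + y) \<le> W' x + W' y" for x y
  proof -
    have "W' (x + y) - W' y \<le> W' x"
    proof (rule ge)
      fix t :: real assume t: "0 \<le> t"
      have "W' (x + y) - (W (x + t *\<^sub>R b) - t * W b) \<le> W' y"
      proof (rule ge)
        fix s :: real assume s: "0 \<le> s"
        have "W' (x + y) \<le> W ((x + y) + (t + s) *\<^sub>R b) - (t + s) * W b" using s t by (intro le) simp
        also have "(x + y) + (t + s) *\<^sub>R b = (x + t *\<^sub>R b) + (y + s *\<^sub>R b)" by (simp add: algebra_simps)
        also have "W \<dots> \<le> W (x + t *\<^sub>R b) + W (y + s *\<^sub>R b)" by (rule Wa)
        finally show "W' (x + y) - (W (x + t *\<^sub>R b) - t * W b) \<le> W (y + s *\<^sub>R b) - s * W b"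
          by (simp add: algebra_simps)
      qed
      then show "W' (x + y) - W' y \<le> W (x + t *\<^sub>R b) - t * W b" by simp
    qed
    then show ?thesis by simp
  qed
  have sub: "sublinear W'" unfolding sublinear_def using W'0 W'hom W'add by blast
  have "W' (- b) \<le> - W b" using le[of 1 "- b"] W0 by simp
  moreover have "- W b \<le> W' (- b)" using sublinear_uminus_ge[OF sub, of b] eqb by simp
  ultimately show ?thesis using sub leW eqb by (intro exI[of _ W']) auto
qed

text \<open>Once a sublinear functional is linear on a line, every smaller sublinear functional is
  linear on that line as well, so the vectors can be treated one after the other.\<close>

lemma hahn_banach_finite:
  assumes W: "sublinear W"
  shows "\<exists>W'. sublinear W' \<and> (\<forall>x. W' x \<le> W x) \<and> (\<forall>b\<in>set bs. W' (- b) = - W' b)"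
proof (induction bs)
  case Nil
  show ?case using W by auto
next
  case (Cons b bs)
  then obtain U where U: "sublinear U" "\<And>x. U x \<le> W x" "\<And>c. c \<in> set bs \<Longrightarrow> U (- c) = - U c" by auto
  from sublinear_linearize[OF U(1), of b] obtain W' where
    W': "sublinear W'" "\<And>x. W' x \<le> U x" "W' (- b) = - U b" "W' b = U b" by auto
  have "W' (- c) = - W' c" if "c \<in> set bs" for c
    using sublinear_uminus_ge[OF W'(1), of c] W'(2)[of "- c"] W'(2)[of c] U(3)[OF that]
      sublinear_uminus_ge[OF W'(1), of "- c"] by simp
  moreover have "W' (- b) = - W' b" "W' x \<le> W x" for x
    using W'(2)[of x] W'(3,4) U(2)[of x] by simp_all
  ultimately show ?case using W'(1) by (intro exI[of _ W']) auto
qed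

lemma hahn_banach_finite_at:
  assumes W: "sublinear W"
  shows "\<exists>W'. sublinear W' \<and> (\<forall>x. W' x \<le> W x) \<and> (\<forall>b\<in>set bs. W' (- b) = - W' b) \<and> W' b0 = W b0"
proof -
  obtain U where U: "sublinear U" "\<And>x. U x \<le> W x" "U (- b0) = - W b0" "U b0 = W b0"
    using sublinear_linearize[OF W, of b0] by auto
  obtain W' where W': "sublinear W'" "\<And>x. W' x \<le> U x" "\<forall>b\<in>set bs. W' (- b) = - W' b"
    using hahn_banach_finite[OF U(1), of bs] by auto
  have "W' b0 = W b0"
    using W'(2)[of b0] W'(2)[of "- b0"] sublinear_uminus_ge[OF W'(1), of b0] U(3,4) by simp
  moreover have "W' x \<le> W x" for x using W'(2)[of x] U(2)[of x] by simp
  ultimately show ?thesis using W' by blast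
qed

lemma sublinear_linear_combination:
  assumes W: "sublinear W" and odd: "\<And>i. i \<in> A \<Longrightarrow> W (- b i) = - W (b i)" and "finite A"
  shows "W (\<Sum>i\<in>A. c i *\<^sub>R b i) = (\<Sum>i\<in>A. c i * W (b i))"
proof -
  have W0: "W 0 = 0" and Wh: "\<And>a x. 0 < a \<Longrightarrow> W (a *\<^sub>R x) = a * W x"
    and Wa: "\<And>x y. W (x + y) \<le> W x + W y" using W by (auto simp: sublinear_def)
  have one: "W (t *\<^sub>R b i) = t * W (b i)" if "i \<in> A" for t i
  proof -
    consider "t = 0" | "0 < t" | "0 < - t" by linarith
    then show ?thesis
    proof cases
      case 3
      then show ?thesis using Wh[of "- t" "- b i"] odd[OF that] by simp
    qed (simp_all add: W0 Wh)
  qed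
  have shift: "W (x + t *\<^sub>R b i) = W x + t * W (b i)" if "i \<in> A" for x t i
    using Wa[of x "t *\<^sub>R b i"] Wa[of "x + t *\<^sub>R b i" "(- t) *\<^sub>R b i"] one[OF that, of t] one[OF that, of "- t"]
    by simp
  from \<open>finite A\<close> show ?thesis
    using shift
  proof (induction A rule: finite_induct)
    case (insert i A)
    then show ?case by (simp add: add.commute[of "c i *\<^sub>R b i"])
  qed (simp add: W0)
qed

section \<open>Quadratic forms dominated by a seminorm\<close>

definition outer :: "(nat \<Rightarrow> real) \<Rightarrow> nat \<Rightarrow> nat \<Rightarrow> real" where
  "outer x = (\<lambda>i j. x i * x j)"

definition restrict_vec :: "nat set \<Rightarrow> (nat \<Rightarrow> real) \<Rightarrow> nat \<Rightarrow> real" where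
  "restrict_vec I x = (\<lambda>i. if i \<in> I then x i else 0)"

lemma gram_append: "gram (xs @ ys) i j = gram xs i j + gram ys i j"
  by (simp add: gram_def)

lemma gram_scaleR: "gram (map (scaleR a) xs) i j = a\<^sup>2 * gram xs i j"
  by (induction xs) (simp_all add: gram_def scaleR_fun_def power2_eq_square algebra_simps)

text \<open>The locale sets up the conic duality between forms below \<open>min (q\<^sup>2) (\<lambda> \<bar>\<cdot>\<bar>\<^sup>2)\<close> and
  decompositions of matrices into rank-one matrices.\<close>

locale seminorm_form =
  fixes q :: "(nat \<Rightarrow> real) \<Rightarrow> real" and I :: "nat set" and lam :: real
  assumes q: "seminorm q" and fin: "finite I" and lam_pos: "0 < lam"
begin

definition cost :: "(nat \<Rightarrow> real) list \<Rightarrow> (nat \<Rightarrow> real) list \<Rightarrow> real" where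
  "cost xs ws = (\<Sum>x\<leftarrow>xs. (q x)\<^sup>2) + lam * (\<Sum>w\<leftarrow>ws. inner_on I w w)"

text \<open>The matrices \<open>x \<otimes> x\<close> and \<open>w \<otimes> w\<close> add up to the symmetric part of \<open>b\<close> plus a positive
  semidefinite matrix, which is given as a sum of \<open>y \<otimes> y\<close>. The surplus makes the infimum of the
  costs monotone, and the symmetric part lets \<open>b\<close> range over all matrices.\<close>

definition represents ::
    "(nat \<Rightarrow> real) list \<Rightarrow> (nat \<Rightarrow> real) list \<Rightarrow> (nat \<Rightarrow> real) list \<Rightarrow> (nat \<Rightarrow> nat \<Rightarrow> real) \<Rightarrow> bool" where
  "represents xs ws ys b \<longleftrightarrow> set xs \<subseteq> coord_space I \<and> set ws \<subseteq> coord_space I \<and> set ys \<subseteq> coord_space I \<and>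
     (\<forall>i\<in>I. \<forall>j\<in>I. 2 * gram (xs @ ws) i j = b i j + b j i + 2 * gram ys i j)"

definition costs :: "(nat \<Rightarrow> nat \<Rightarrow> real) \<Rightarrow> real set" where
  "costs b = {cost xs ws | xs ws ys. represents xs ws ys b}"

definition gauge :: "(nat \<Rightarrow> nat \<Rightarrow> real) \<Rightarrow> real" where
  "gauge b = Inf (costs b)"

lemma cost_nonneg: "0 \<le> cost xs ws"
  unfolding cost_def using lam_pos
  by (intro add_nonneg_nonneg mult_nonneg_nonneg sum_list_nonneg) (auto simp: inner_on_self_nonneg)

lemma bdd_below_costs: "bdd_below (costs b)"
  by (rule bdd_belowI[of _ 0]) (auto simp: costs_def cost_nonneg)

text \<open>By polarisation: \<open>(e\<^sub>k + b\<^sub>k\<^sub>l e\<^sub>l) \<otimes> (e\<^sub>k + b\<^sub>k\<^sub>l e\<^sub>l)\<close> has the mixed terms that are wanted, and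
  its two pure terms go into the surplus.\<close>

lemma costs_nonempty: "costs b \<noteq> {}"
proof -
  obtain ks where ks: "set ks = I" "distinct ks" using finite_distinct_list[OF fin] by blast
  define P where "P = List.product ks ks"
  have P: "set P = I \<times> I" "distinct P" using ks by (simp_all add: P_def distinct_product)
  define h where "h = (1 / sqrt 2 :: real)"
  have h: "h * h = 1/2" by (simp add: h_def)
  have sumP: "(\<Sum>p\<leftarrow>P. F p) = (\<Sum>k\<in>I. \<Sum>l\<in>I. F (k, l))" for F :: "nat \<times> nat \<Rightarrow> real"
    using P by (simp add: sum_list_distinct_conv_sum_set sum.cartesian_product)
  define xs where "xs = map (\<lambda>(k, l). h *\<^sub>R (unit_vec k + b k l *\<^sub>R unit_vec l)) P"
  define ys where "ys = map (\<lambda>(k, l). h *\<^sub>R unit_vec k) P @ map (\<lambda>(k, l). (h * b k l) *\<^sub>R unit_vec l) P"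
  have "represents xs [] ys b"
    unfolding represents_def
  proof (intro conjI ballI)
    show "set xs \<subseteq> coord_space I" "set [] \<subseteq> coord_space I" "set ys \<subseteq> coord_space I"
      using P unfolding xs_def ys_def
      by (auto intro!: subspace_scale[OF subspace_coord_space] subspace_add[OF subspace_coord_space]
          unit_vec_in_coord_space)
    fix i j assume ij: "i \<in> I" "j \<in> I"
    define d :: "nat \<Rightarrow> nat \<Rightarrow> real" where "d = (\<lambda>k i. if i = k then 1 else 0)"
    have delta: "(\<Sum>k\<in>I. \<Sum>l\<in>I. d k i * (d l j * b k l)) = b i j" if "i \<in> I" "j \<in> I" for i j
    proof -
      have "(\<Sum>l\<in>I. d k i * (d l j * b k l)) = (\<Sum>l\<in>I. if l = j then d k i * b k l else 0)" for k
        by (intro sum.cong) (auto simp: d_def)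
      then have "(\<Sum>l\<in>I. d k i * (d l j * b k l)) = (if k = i then b k j else 0)" for k
        using fin that by (simp add: d_def)
      then show ?thesis using fin that by simp
    qed
    have "2 * gram xs i j = (\<Sum>k\<in>I. \<Sum>l\<in>I. 2 * (h * h) * ((d k i + b k l * d l i) * (d k j + b k l * d l j)))"
      by (simp add: gram_def xs_def o_def case_prod_unfold sumP scaleR_fun_def unit_vec_def d_def
          sum_distrib_left algebra_simps cong: if_cong)
    also have "\<dots> = (\<Sum>k\<in>I. \<Sum>l\<in>I. d k i * (d l j * b k l) + d k j * (d l i * b k l)
        + d k i * d k j + b k l * b k l * (d l i * d l j))"
      by (simp add: h algebra_simps)
    also have "\<dots> = (\<Sum>k\<in>I. \<Sum>l\<in>I. d k i * (d l j * b k l)) + (\<Sum>k\<in>I. \<Sum>l\<in>I. d k j * (d l i * b k l))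
        + (\<Sum>k\<in>I. \<Sum>l\<in>I. d k i * d k j + b k l * b k l * (d l i * d l j))"
      by (simp add: sum.distrib add.assoc)
    also have "(\<Sum>k\<in>I. \<Sum>l\<in>I. d k i * (d l j * b k l)) = b i j"
      using ij by (intro delta)
    also have "(\<Sum>k\<in>I. \<Sum>l\<in>I. d k j * (d l i * b k l)) = b j i"
      using ij by (intro delta)
    also have "(\<Sum>k\<in>I. \<Sum>l\<in>I. d k i * d k j + b k l * b k l * (d l i * d l j))
        = (\<Sum>k\<in>I. \<Sum>l\<in>I. 2 * (h * h) * (d k i * d k j) + 2 * (h * h) * (b k l * b k l * (d l i * d l j)))"
      by (simp add: h)
    also have "\<dots> = 2 * gram ys i j"
      by (simp add: gram_def ys_def o_def case_prod_unfold sumP scaleR_fun_def unit_vec_def d_def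
          sum_distrib_left sum.distrib algebra_simps cong: if_cong)
    finally show "2 * gram (xs @ []) i j = b i j + b j i + 2 * gram ys i j" by simp
  qed
  then show ?thesis unfolding costs_def by blast
qed

lemma gauge_le: "represents xs ws ys b \<Longrightarrow> gauge b \<le> cost xs ws"
  unfolding gauge_def by (rule cInf_lower[OF _ bdd_below_costs]) (auto simp: costs_def)

lemma gauge_ge: "(\<And>xs ws ys. represents xs ws ys b \<Longrightarrow> c \<le> cost xs ws) \<Longrightarrow> c \<le> gauge b"
  unfolding gauge_def by (rule cInf_greatest[OF costs_nonempty]) (auto simp: costs_def)

lemma sublinear_gauge: "sublinear gauge"
  unfolding sublinear_def
proof (intro conjI allI impI)
  have "represents [] [] [] 0" by (simp add: represents_def gram_def)
  then have "gauge 0 \<le> 0" using gauge_le by (fastforce simp: cost_def)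
  moreover have "0 \<le> gauge 0" by (rule gauge_ge) (rule cost_nonneg)
  ultimately show "gauge 0 = 0" by simp
next
  have le: "gauge (a *\<^sub>R b) \<le> a * gauge b" if a: "0 < a" for a b
  proof -
    have "gauge (a *\<^sub>R b) / a \<le> gauge b"
    proof (rule gauge_ge)
      fix xs ws ys assume r: "represents xs ws ys b"
      let ?s = "map (scaleR (sqrt a)) :: (nat \<Rightarrow> real) list \<Rightarrow> _"
      have "represents (?s xs) (?s ws) (?s ys) (a *\<^sub>R b)"
      proof -
        have "2 * (a * gram xs i j) + 2 * (a * gram ws i j) = a * b i j + a * b j i + 2 * (a * gram ys i j)"
          if "i \<in> I" "j \<in> I" for i j
        proof -
          have "2 * (gram xs i j + gram ws i j) = b i j + b j i + 2 * gram ys i j"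
            using r that by (simp add: represents_def gram_append)
          then have "a * (2 * (gram xs i j + gram ws i j)) = a * (b i j + b j i + 2 * gram ys i j)" by simp
          then show ?thesis by (simp add: algebra_simps)
        qed
        then show ?thesis using r a
          by (auto simp: represents_def gram_append gram_scaleR scaleR_fun_def[of a] distrib_left
              intro!: subspace_scale[OF subspace_coord_space])
      qed
      from gauge_le[OF this] have "gauge (a *\<^sub>R b) \<le> cost (?s xs) (?s ws)" .
      also have "\<dots> = a * cost xs ws"
        using a by (simp add: cost_def o_def seminorm_scale[OF q] power_mult_distrib sum_list_const_mult
            bilinear_simps[OF bilinear_inner_on] algebra_simps flip: mult.assoc)
      finally show "gauge (a *\<^sub>R b) / a \<le> cost xs ws" using a by (simp add: field_simps)
    qed
    then show ?thesis using a by (simp add: field_simps)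
  qed
  fix a :: real and b assume a: "0 < a"
  have "gauge (inverse a *\<^sub>R (a *\<^sub>R b)) \<le> inverse a * gauge (a *\<^sub>R b)" using a by (intro le) simp
  then have "a * gauge b \<le> gauge (a *\<^sub>R b)" using a by (simp add: field_simps)
  then show "gauge (a *\<^sub>R b) = a * gauge b" using le[OF a, of b] by simp
next
  fix b c
  have "gauge (b + c) - gauge c \<le> gauge b"
  proof (rule gauge_ge)
    fix xs ws ys assume r: "represents xs ws ys b"
    have "gauge (b + c) - cost xs ws \<le> gauge c"
    proof (rule gauge_ge)
      fix xs' ws' ys' assume r': "represents xs' ws' ys' c"
      have "represents (xs @ xs') (ws @ ws') (ys @ ys') (b + c)"
      proof -
        have "2 * gram ((xs @ xs') @ (ws @ ws')) i j = (b + c) i j + (b + c) j i + 2 * gram (ys @ ys') i j"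
          if "i \<in> I" "j \<in> I" for i j
        proof -
          have "2 * gram (xs @ ws) i j = b i j + b j i + 2 * gram ys i j"
            "2 * gram (xs' @ ws') i j = c i j + c j i + 2 * gram ys' i j"
            using r r' that by (simp_all add: represents_def)
          then show ?thesis by (simp add: gram_append)
        qed
        then show ?thesis using r r' by (simp add: represents_def)
      qed
      from gauge_le[OF this] show "gauge (b + c) - cost xs ws \<le> cost xs' ws'"
        by (simp add: cost_def algebra_simps)
    qed
    then show "gauge (b + c) - gauge c \<le> cost xs ws" by simp
  qed
  then show "gauge (b + c) \<le> gauge b + gauge c" by simp
qed

lemma gauge_outer_le:
  assumes "x \<in> coord_space I"
  shows "gauge (outer x) \<le> (q x)\<^sup>2" "gauge (outer x) \<le> lam * inner_on I x x" "gauge (- outer x) \<le> 0"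
proof -
  have "represents [x] [] [] (outer x)" "represents [] [x] [] (outer x)" "represents [] [] [x] (- outer x)"
    using assms by (auto simp: represents_def gram_def outer_def)
  from this[THEN gauge_le]
  show "gauge (outer x) \<le> (q x)\<^sup>2" "gauge (outer x) \<le> lam * inner_on I x x" "gauge (- outer x) \<le> 0"
    by (simp_all add: cost_def)
qed

text \<open>A linear functional on matrices below the gauge is given by a matrix \<open>A\<close>. Its values on
  \<open>x \<otimes> x\<close> form a quadratic form that inherits the upper bounds from the gauge, and it is positive
  because the gauge is nonpositive at \<open>- (x \<otimes> x)\<close>. Its trace is the value at the identity, where
  Hahn-Banach allows equality with the gauge.\<close>

theorem exists_dominated_form:
  assumes v: "\<And>xs ws ys. set xs \<subseteq> coord_space I \<Longrightarrow> set ws \<subseteq> coord_space I \<Longrightarrow> set ys \<subseteq> coord_space I \<Longrightarrow>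
      (\<And>i j. i \<in> I \<Longrightarrow> j \<in> I \<Longrightarrow> gram (xs @ ws) i j = (if i = j then 1 else 0) + gram ys i j) \<Longrightarrow>
      v \<le> cost xs ws"
  obtains B where "psd_form B I lam" "\<And>x. x \<in> coord_space I \<Longrightarrow> B x x \<le> (q x)\<^sup>2"
    "v \<le> (\<Sum>i\<in>I. B (unit_vec i) (unit_vec i))"
proof -
  \<comment> \<open>matrix units, and the identity matrix on \<open>I\<close>\<close>
  define E :: "nat \<times> nat \<Rightarrow> nat \<Rightarrow> nat \<Rightarrow> real" where
    "E = (\<lambda>(k, l) i j. if i = k \<and> j = l then 1 else 0)"
  define b0 :: "nat \<Rightarrow> nat \<Rightarrow> real" where "b0 = (\<lambda>i j. if i = j \<and> i \<in> I then 1 else 0)"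
  have "finite (E ` (I \<times> I))" using fin by simp
  then obtain bs where bs: "set bs = E ` (I \<times> I)" using finite_list by blast
  obtain W where W: "sublinear W" "\<And>b. W b \<le> gauge b" "\<And>b. b \<in> set bs \<Longrightarrow> W (- b) = - W b" "W b0 = gauge b0"
    using hahn_banach_finite_at[OF sublinear_gauge, of bs b0] by blast
  define A where "A = (\<lambda>k l. W (E (k, l)))"
  have lin: "W (\<Sum>p\<in>I \<times> I. c p *\<^sub>R E p) = (\<Sum>k\<in>I. \<Sum>l\<in>I. c (k, l) * A k l)" for c
  proof -
    have "W (\<Sum>p\<in>I \<times> I. c p *\<^sub>R E p) = (\<Sum>p\<in>I \<times> I. c p * W (E p))"
      using bs W(3) fin by (intro sublinear_linear_combination[OF W(1)]) auto
    then show ?thesis by (simp add: A_def sum.cartesian_product case_prod_unfold)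
  qed
  have expand: "b = (\<Sum>p\<in>I \<times> I. b (fst p) (snd p) *\<^sub>R E p)"
    if "\<And>i j. i \<notin> I \<or> j \<notin> I \<Longrightarrow> b i j = 0" for b
  proof (intro ext)
    fix i j
    have "(\<Sum>p\<in>I \<times> I. b (fst p) (snd p) *\<^sub>R E p) i j
        = (\<Sum>p\<in>I \<times> I. if p = (i, j) then b (fst p) (snd p) else 0)"
    proof -
      have "(\<Sum>p\<in>S. b (fst p) (snd p) *\<^sub>R E p) i j = (\<Sum>p\<in>S. b (fst p) (snd p) * E p i j)" for S
        by (induction S rule: infinite_finite_induct) (simp_all add: scaleR_fun_def)
      then show ?thesis
        by (simp, intro sum.cong) (auto simp: E_def split: if_splits)
    qed
    also have "\<dots> = b i j" using fin that[of i j] by (auto simp: sum.delta)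
    finally show "b i j = (\<Sum>p\<in>I \<times> I. b (fst p) (snd p) *\<^sub>R E p) i j" by simp
  qed
  define B where "B = (\<lambda>x y. \<Sum>k\<in>I. \<Sum>l\<in>I. (A k l + A l k) / 2 * (x k * y l))"
  have Bsym: "B x y = B y x" for x y
    unfolding B_def by (subst sum.swap) (simp add: add.commute mult.commute)
  have B1: "linear (\<lambda>y. B x y)" for x
    by (rule linearI) (simp_all add: B_def scaleR_fun_def sum.distrib sum_distrib_left algebra_simps add_divide_distrib)
  then have Bbil: "bilinear B" unfolding bilinear_def using Bsym by simp
  have BA: "B x x = (\<Sum>k\<in>I. \<Sum>l\<in>I. x k * x l * A k l)" for x
  proof -
    have "(\<Sum>k\<in>I. \<Sum>l\<in>I. x k * x l * A l k) = (\<Sum>k\<in>I. \<Sum>l\<in>I. x k * x l * A k l)"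
      by (subst sum.swap) (simp add: mult.commute mult.left_commute)
    moreover have "B x x = ((\<Sum>k\<in>I. \<Sum>l\<in>I. x k * x l * A k l) + (\<Sum>k\<in>I. \<Sum>l\<in>I. x k * x l * A l k)) / 2"
      by (simp add: B_def sum.distrib[symmetric] sum_divide_distrib algebra_simps add_divide_distrib)
    ultimately show ?thesis by simp
  qed
  have BW: "B x x = W (outer x)" if "x \<in> coord_space I" for x
    by (subst expand[of "outer x"], use that in \<open>force simp: outer_def coord_space_def\<close>)
      (subst lin, simp add: BA outer_def)
  have B0: "0 \<le> B x x" for x
  proof -
    have r: "restrict_vec I x \<in> coord_space I" by (simp add: restrict_vec_def coord_space_def)
    have "B x x = B (restrict_vec I x) (restrict_vec I x)"
      by (simp add: B_def restrict_vec_def)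
    also have "\<dots> = W (outer (restrict_vec I x))" by (rule BW[OF r])
    also have "\<dots> \<ge> - W (- outer (restrict_vec I x))"
      using sublinear_uminus_ge[OF W(1), of "- outer (restrict_vec I x)"] by simp
    finally show ?thesis using W(2)[of "- outer (restrict_vec I x)"] gauge_outer_le(3)[OF r] by linarith
  qed
  have dom: "B x x \<le> (q x)\<^sup>2" "B x x \<le> lam * inner_on I x x" if "x \<in> coord_space I" for x
    using gauge_outer_le[OF that] W(2)[of "outer x"] BW[OF that] by simp_all
  have "v \<le> gauge b0"
  proof (rule gauge_ge)
    fix xs ws ys assume r: "represents xs ws ys b0"
    show "v \<le> cost xs ws"
    proof (rule v)
      fix i j assume "i \<in> I" "j \<in> I"
      then have "2 * gram (xs @ ws) i j = b0 i j + b0 j i + 2 * gram ys i j"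
        using r by (simp add: represents_def)
      then show "gram (xs @ ws) i j = (if i = j then 1 else 0) + gram ys i j"
        using \<open>i \<in> I\<close> by (auto simp: b0_def split: if_splits)
    qed (use r in \<open>auto simp: represents_def\<close>)
  qed
  also have "gauge b0 = W b0" by (simp add: W(4))
  also have "W b0 = (\<Sum>k\<in>I. \<Sum>l\<in>I. b0 k l * A k l)"
    by (subst expand[of b0]) (auto simp: lin b0_def)
  also have "\<dots> = (\<Sum>k\<in>I. A k k)"
    by (intro sum.cong refl) (simp add: b0_def fin if_distrib[of "\<lambda>x. x * _"] cong: if_cong)
  also have "\<dots> = (\<Sum>i\<in>I. B (unit_vec i) (unit_vec i))"
  proof (intro sum.cong refl)
    fix i assume i: "i \<in> I"
    have "B (unit_vec i) (unit_vec i) = (\<Sum>k\<in>I. if k = i then (\<Sum>l\<in>I. if l = i then A k l else 0) else 0)"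
      unfolding BA by (intro sum.cong refl) (auto simp: unit_vec_def intro!: sum.cong)
    also have "\<dots> = A i i" using fin i by simp
    finally show "A i i = B (unit_vec i) (unit_vec i)" by simp
  qed
  finally have tr: "v \<le> (\<Sum>i\<in>I. B (unit_vec i) (unit_vec i))" .
  have "psd_form B I lam"
    by unfold_locales (use fin Bbil Bsym B0 dom(2) lam_pos in auto)
  then show ?thesis using that dom(1) tr by blast
qed

end

text \<open>With \<open>\<lambda> = K\<^sup>2 / (2 M\<^sup>2)\<close> the bound for Gaussian averages of decompositions is \<open>4 M\<^sup>2\<close> times the
  cost, so duality gives a form with trace \<open>F \<ge> n / (4 M\<^sup>2)\<close>; then \<open>F / (8 \<lambda>) \<ge> n / (16 K\<^sup>2)\<close>.\<close>

theorem seminorm_restriction: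
  fixes q :: "(nat \<Rightarrow> real) \<Rightarrow> real"
  assumes q: "seminorm q" and meas: "q \<in> borel_measurable borel"
    and ks: "distinct ks" "set ks = I" and ne: "I \<noteq> {}"
    and M: "0 < M"
    and type2: "\<And>zs. sign_avg (length zs) (\<lambda>e. q (signed_sum zs e)) \<le> M * sqrt (\<Sum>z\<leftarrow>zs. (q z)\<^sup>2)"
    and K: "0 < K" "\<And>x. q x \<le> K * sqrt (inner_on I x x)"
    and g: "ennreal (real (card I)) \<le> gauss_avg (map unit_vec ks) (\<lambda>v. ennreal ((q v)\<^sup>2))"
  shows "\<exists>\<sigma>\<subseteq>I. real (card I) / (16 * K\<^sup>2) \<le> real (card \<sigma>) \<and>
           (\<forall>x\<in>coord_space \<sigma>. inner_on I x x / (128 * M\<^sup>2) \<le> (q x)\<^sup>2)"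
proof -
  define n where "n = real (card I)"
  have fin: "finite I" using ks by auto
  have n: "0 < n" using fin ne by (simp add: n_def card_gt_0_iff)
  define lam where "lam = K\<^sup>2 / (2 * M\<^sup>2)"
  have lam: "0 < lam" using K M by (simp add: lam_def)
  interpret seminorm_form q I lam by unfold_locales (use q fin lam in auto)
  have "n / (4 * M\<^sup>2) \<le> cost xs ws"
    if s: "set xs \<subseteq> coord_space I" "set ws \<subseteq> coord_space I" "set ys \<subseteq> coord_space I"
      and gr: "\<And>i j. i \<in> I \<Longrightarrow> j \<in> I \<Longrightarrow> gram (xs @ ws) i j = (if i = j then 1 else 0) + gram ys i j"
    for xs ws ys
  proof -
    let ?us = "map unit_vec ks"
    have us: "set ?us \<subseteq> coord_space I" using ks by (auto intro: unit_vec_in_coord_space)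
    have gu: "gram ?us i j = (if i = j then 1 else 0)" if "i \<in> I" for i j
    proof -
      have "gram ?us i j = (\<Sum>k\<in>I. if k = i then (if i = j then 1 else 0) else 0)"
      proof -
        have "gram ?us i j = (\<Sum>k\<in>I. unit_vec k i * unit_vec k j)"
          using ks by (simp add: gram_def o_def sum_list_distinct_conv_sum_set)
        also have "\<dots> = (\<Sum>k\<in>I. if k = i then (if i = j then 1 else 0) else 0)"
          by (intro sum.cong) (auto simp: unit_vec_def)
        finally show ?thesis .
      qed
      then show ?thesis using fin that by simp
    qed
    have out: "gram zs i j = 0" if "set zs \<subseteq> coord_space I" "i \<notin> I \<or> j \<notin> I" for zs i j
      using that by (induction zs) (auto simp: gram_def coord_space_def)
    have "gram (xs @ ws) = gram (?us @ ys)"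
    proof (intro ext)
      fix i j
      show "gram (xs @ ws) i j = gram (?us @ ys) i j"
      proof (cases "i \<in> I \<and> j \<in> I")
        case True then show ?thesis using gr gu by (simp add: gram_append[of ?us])
      next
        case False
        moreover have "set (xs @ ws) \<subseteq> coord_space I" "set (?us @ ys) \<subseteq> coord_space I" using s us by auto
        ultimately show ?thesis using out by metis
      qed
    qed
    then have "gauss_avg ?us (\<lambda>v. ennreal ((q v)\<^sup>2))
        \<le> ennreal (4 * M\<^sup>2 * (\<Sum>x\<leftarrow>xs. (q x)\<^sup>2) + 2 * K\<^sup>2 * (\<Sum>w\<leftarrow>ws. inner_on I w w))"
      using M K by (intro gauss_avg_decomposition_le[OF q meas fin _ type2 _ _ us s]) auto
    also have "4 * M\<^sup>2 * (\<Sum>x\<leftarrow>xs. (q x)\<^sup>2) + 2 * K\<^sup>2 * (\<Sum>w\<leftarrow>ws. inner_on I w w) = 4 * M\<^sup>2 * cost xs ws"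
    proof -
      have "K\<^sup>2 = 2 * M\<^sup>2 * lam" using M by (simp add: lam_def)
      then show ?thesis by (simp add: cost_def algebra_simps)
    qed
    finally have "ennreal n \<le> ennreal (4 * M\<^sup>2 * cost xs ws)" using g by (simp add: n_def)
    then have "n \<le> 4 * M\<^sup>2 * cost xs ws" using cost_nonneg[of xs ws] M by (simp add: ennreal_le_iff)
    then show ?thesis using M by (simp add: field_simps)
  qed
  then obtain B where B: "psd_form B I lam" "\<And>x. x \<in> coord_space I \<Longrightarrow> B x x \<le> (q x)\<^sup>2"
    "n / (4 * M\<^sup>2) \<le> (\<Sum>i\<in>I. B (unit_vec i) (unit_vec i))"
    using exists_dominated_form[of "n / (4 * M\<^sup>2)"] by blast
  define F where "F = (\<Sum>i\<in>I. B (unit_vec i) (unit_vec i))"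
  have F: "n / (4 * M\<^sup>2) \<le> F" "0 < F"
  proof -
    show "n / (4 * M\<^sup>2) \<le> F" using B(3) by (simp add: F_def)
    moreover have "0 < n / (4 * M\<^sup>2)" using n M by simp
    ultimately show "0 < F" by linarith
  qed
  from psd_form.restricted_invertibility[OF B(1)] F(2)
  obtain \<sigma> where \<sigma>: "\<sigma> \<subseteq> I" "F / (8 * lam) \<le> real (card \<sigma>)"
    "\<And>x. x \<in> coord_space \<sigma> \<Longrightarrow> F / (32 * n) * inner_on I x x \<le> B x x"
    by (auto simp: F_def n_def)
  have "n / (16 * K\<^sup>2) = n / (4 * M\<^sup>2) / (8 * lam)" using M K by (simp add: lam_def field_simps)
  also have "\<dots> \<le> F / (8 * lam)" using F(1) lam by (intro divide_right_mono) auto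
  finally have size: "n / (16 * K\<^sup>2) \<le> real (card \<sigma>)" using \<sigma>(2) by linarith
  have "inner_on I x x / (128 * M\<^sup>2) \<le> (q x)\<^sup>2" if x: "x \<in> coord_space \<sigma>" for x
  proof -
    have "1 / (128 * M\<^sup>2) = n / (4 * M\<^sup>2) / (32 * n)" using n M by (simp add: field_simps)
    also have "\<dots> \<le> F / (32 * n)" using F(1) n by (intro divide_right_mono) auto
    finally have "1 / (128 * M\<^sup>2) * inner_on I x x \<le> F / (32 * n) * inner_on I x x"
      using inner_on_self_nonneg by (rule mult_right_mono)
    also have "\<dots> \<le> B x x" by (rule \<sigma>(3)[OF x])
    also have "\<dots> \<le> (q x)\<^sup>2" using B(2) x coord_space_mono[OF \<sigma>(1)] by blast
    finally show ?thesis by simp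
  qed
  then show ?thesis using \<sigma>(1) size by (auto simp: n_def)
qed

section \<open>Operators into spaces of type 2\<close>

lemma finite_set_pmf_rademacher: "finite (set_pmf (rademacher m))"
  unfolding rademacher_def by (subst set_Pi_pmf) (auto intro!: finite_PiE_dflt)

text \<open>The list is reversed because \<open>rademacher\<close> grows by its last coordinate, \<open>sign_avg\<close> by its
  first.\<close>

lemma expectation_rademacher:
  "measure_pmf.expectation (rademacher m) (\<lambda>\<epsilon>. F (rev (map \<epsilon> [0..<m]))) = sign_avg m F"
proof (induction m arbitrary: F)
  case 0
  show ?case by (simp add: rademacher_def)
next
  case (Suc m)
  have rad: "rademacher (Suc m) = pmf_of_set {-1, 1} \<bind> (\<lambda>s. map_pmf (\<lambda>f. f(m := s)) (rademacher m))"
    unfolding rademacher_def lessThan_Suc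
    by (subst Pi_pmf_insert') (simp_all add: map_pmf_def)
  have list: "rev (map (f(m := s)) [0..<Suc m]) = s # rev (map f [0..<m])" for f :: "nat \<Rightarrow> real" and s
    by simp
  have "measure_pmf.expectation (rademacher (Suc m)) (\<lambda>\<epsilon>. F (rev (map \<epsilon> [0..<Suc m])))
      = (\<Sum>s\<in>{-1, 1::real}. measure_pmf.expectation (rademacher m) (\<lambda>\<epsilon>. F (s # rev (map \<epsilon> [0..<m])))) / 2"
    unfolding rad
    by (subst pmf_expectation_bind_pmf_of_set)
      (simp_all add: finite_set_pmf_rademacher list del: upt_Suc)
  also have "\<dots> = sign_avg (Suc m) F"
    using Suc.IH[of "\<lambda>e. F (1 # e)"] Suc.IH[of "\<lambda>e. F ((-1) # e)"] by simp
  finally show ?case .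
qed

lemma signed_sum_rev_map:
  "signed_sum zs (rev (map \<epsilon> [0..<length zs])) = (\<Sum>i<length zs. \<epsilon> i *\<^sub>R (rev zs ! i))"
proof (induction zs)
  case (Cons z zs)
  have "(\<Sum>i<length zs. \<epsilon> i *\<^sub>R (rev (z # zs) ! i)) = (\<Sum>i<length zs. \<epsilon> i *\<^sub>R (rev zs ! i))"
    by (intro sum.cong refl) (simp add: nth_append)
  then show ?case using Cons.IH by (simp add: nth_append add.commute)
qed simp

lemma seminorm_sum_le:
  assumes q: "seminorm q"
  shows "q (\<Sum>i\<in>A. f i) \<le> (\<Sum>i\<in>A. q (f i))"
proof (induction A rule: infinite_finite_induct)
  case (insert i A)
  then show ?case using seminorm_triangle[OF q, of "f i" "sum f A"] by simp
qed (simp_all add: seminorm_zero[OF q])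

lemma measurable_seminorm:
  assumes q: "seminorm q" and "finite I" and K: "\<And>x. q x \<le> K * sqrt (inner_on I x x)"
  shows "q \<in> borel_measurable borel"
proof -
  have diff: "\<bar>q y - q x\<bar> \<le> q (y - x)" for x y
    using seminorm_triangle[OF q, of "y - x" x] seminorm_triangle[OF q, of "x - y" y]
      seminorm_minus[OF q, of "x - y"] by simp
  have "(q \<longlongrightarrow> q x) (at x)" for x :: "nat \<Rightarrow> real"
  proof -
    define h where "h = (\<lambda>y :: nat \<Rightarrow> real. K * sqrt (\<Sum>k\<in>I. (y k - x k) * (y k - x k)))"
    have "continuous_on UNIV h" unfolding h_def
      by (intro continuous_intros continuous_on_product_coordinates)
    then have "(h \<longlongrightarrow> h x) (at x)" by (simp add: continuous_on_def)
    then have "(h \<longlongrightarrow> 0) (at x)" by (simp add: h_def)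
    moreover have "norm (q y - q x) \<le> h y" for y
      using diff[of y x] K[of "y - x"] by (simp add: h_def inner_on_def)
    ultimately have "((\<lambda>y. q y - q x) \<longlongrightarrow> 0) (at x)"
      by (intro Lim_null_comparison[of "\<lambda>y. q y - q x" h]) auto
    then show ?thesis by (rule LIM_zero_cancel)
  qed
  then have "continuous_on UNIV q" by (simp add: continuous_on_def)
  then show ?thesis by (rule borel_measurable_continuous_onI)
qed

lemma measurable_gauss_coordinate:
  assumes "i \<in> J"
  shows "(\<lambda>g. g i) \<in> borel_measurable (\<Pi>\<^sub>M i\<in>J. gauss)"
proof -
  have "(\<lambda>g. g i) \<in> measurable (\<Pi>\<^sub>M i\<in>J. gauss) gauss"
    using assms by (rule measurable_component_singleton)
  moreover have "sets gauss = sets borel" by simp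
  ultimately show ?thesis using measurable_cong_sets by blast
qed

text \<open>The standard Gaussian vector is the Gaussian sum over the unit vectors.\<close>

lemma nn_integral_std_gaussian:
  fixes f :: "(nat \<Rightarrow> real) \<Rightarrow> ennreal"
  assumes "distinct ks" "f \<in> borel_measurable borel"
  shows "(\<integral>\<^sup>+g. f (restrict_vec (set ks) g) \<partial>(\<Pi>\<^sub>M i\<in>set ks. gauss)) = gauss_avg (map unit_vec ks) f"
  using assms
proof (induction ks arbitrary: f)
  case Nil
  have "restrict_vec {} g = 0" for g by (simp add: restrict_vec_def fun_eq_iff)
  then show ?case by (simp only: list.set nn_integral_const list.map gauss_avg.simps) (simp add: space_PiM)
next
  case (Cons k ks)
  interpret product_sigma_finite "\<lambda>_::nat. gauss"
    by unfold_locales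
  have meas: "(\<lambda>g. f (restrict_vec J g)) \<in> borel_measurable (\<Pi>\<^sub>M i\<in>J. gauss)" for J
  proof (rule measurable_compose[OF measurable_into_sequences Cons.prems(2)])
    fix i
    show "(\<lambda>g. restrict_vec J g i) \<in> borel_measurable (\<Pi>\<^sub>M i\<in>J. gauss)"
      by (cases "i \<in> J") (simp_all add: restrict_vec_def measurable_gauss_coordinate)
  qed
  have upd: "restrict_vec (insert k (set ks)) (g(k := t)) = t *\<^sub>R unit_vec k + restrict_vec (set ks) g" for g t
    using Cons.prems(1) by (auto simp: restrict_vec_def unit_vec_def scaleR_fun_def fun_eq_iff)
  have "(\<integral>\<^sup>+g. f (restrict_vec (set (k # ks)) g) \<partial>(\<Pi>\<^sub>M i\<in>set (k # ks). gauss))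
      = (\<integral>\<^sup>+t. \<integral>\<^sup>+g. f (t *\<^sub>R unit_vec k + restrict_vec (set ks) g) \<partial>(\<Pi>\<^sub>M i\<in>set ks. gauss) \<partial>gauss)"
    unfolding list.set upd[symmetric]
    by (rule product_nn_integral_insert_rev) (use Cons.prems meas in auto)
  also have "\<dots> = (\<integral>\<^sup>+t. gauss_avg (map unit_vec ks) (\<lambda>v. f (t *\<^sub>R unit_vec k + v)) \<partial>gauss)"
  proof (intro nn_integral_cong)
    fix t
    have m: "(\<lambda>v. t *\<^sub>R unit_vec k + v) \<in> borel_measurable borel" by measurable
    show "(\<integral>\<^sup>+g. f (t *\<^sub>R unit_vec k + restrict_vec (set ks) g) \<partial>(\<Pi>\<^sub>M i\<in>set ks. gauss))
        = gauss_avg (map unit_vec ks) (\<lambda>v. f (t *\<^sub>R unit_vec k + v))"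
      by (rule Cons.IH[of "\<lambda>v. f (t *\<^sub>R unit_vec k + v)"])
        (use Cons.prems measurable_compose[OF m Cons.prems(2)] in auto)
  qed
  finally show ?case by (simp only: list.map gauss_avg.simps)
qed

lemma type2_bound_mono:
  assumes "type2_bound V N M" "M \<le> M'"
  shows "type2_bound V N M'"
  unfolding type2_bound_def
proof (intro allI impI)
  fix m and x :: "nat \<Rightarrow> 'a" assume "\<forall>i<m. x i \<in> V"
  then have "measure_pmf.expectation (rademacher m) (\<lambda>\<epsilon>. N (\<Sum>i<m. \<epsilon> i *\<^sub>R x i)) \<le> M * sqrt (\<Sum>i<m. (N (x i))\<^sup>2)"
    using assms(1) by (simp add: type2_bound_def)
  also have "\<dots> \<le> M' * sqrt (\<Sum>i<m. (N (x i))\<^sup>2)"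
    using assms(2) by (intro mult_right_mono) (simp_all add: sum_nonneg)
  finally show "measure_pmf.expectation (rademacher m) (\<lambda>\<epsilon>. N (\<Sum>i<m. \<epsilon> i *\<^sub>R x i))
      \<le> M' * sqrt (\<Sum>i<m. (N (x i))\<^sup>2)" .
qed

text \<open>The infimum that defines the type 2 constant is attained, as each single inequality is
  closed in \<open>M\<close>.\<close>

lemma type2_bound_type2_const:
  assumes "has_type2 V N"
  shows "type2_bound V N (type2_const V N)" "0 \<le> type2_const V N"
proof -
  let ?S = "{M. 0 \<le> M \<and> type2_bound V N M}"
  obtain M where "type2_bound V N M" using assms by (auto simp: has_type2_def)
  then have "type2_bound V N (max 0 M)" by (rule type2_bound_mono) simp
  then have ne: "?S \<noteq> {}" by (intro ex_in_conv[THEN iffD1] exI[of _ "max 0 M"]) simp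
  show "0 \<le> type2_const V N" unfolding type2_const_def by (rule cInf_greatest[OF ne]) simp
  show "type2_bound V N (type2_const V N)"
    unfolding type2_bound_def
  proof (intro allI impI)
    fix m and x :: "nat \<Rightarrow> 'a" assume x: "\<forall>i<m. x i \<in> V"
    define E where "E = measure_pmf.expectation (rademacher m) (\<lambda>\<epsilon>. N (\<Sum>i<m. \<epsilon> i *\<^sub>R x i))"
    define s where "s = sqrt (\<Sum>i<m. (N (x i))\<^sup>2)"
    have s0: "0 \<le> s" by (simp add: s_def sum_nonneg)
    have le: "E \<le> M * s" if "M \<in> ?S" for M
      using that x by (simp add: type2_bound_def E_def s_def)
    have "E \<le> type2_const V N * s"
    proof (cases "s = 0")
      case True
      then show ?thesis using le ne by fastforce
    next
      case False
      then have "E / s \<le> type2_const V N" unfolding type2_const_def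
        using le s0 by (intro cInf_greatest[OF ne]) (simp add: pos_divide_le_eq)
      then show ?thesis using False s0 by (simp add: pos_divide_le_eq)
    qed
    then show "measure_pmf.expectation (rademacher m) (\<lambda>\<epsilon>. N (\<Sum>i<m. \<epsilon> i *\<^sub>R x i))
        \<le> type2_const V N * sqrt (\<Sum>i<m. (N (x i))\<^sup>2)" by (simp add: E_def s_def)
  qed
qed

lemma restrict_vec_in: "restrict_vec I x \<in> coord_space I"
  by (simp add: restrict_vec_def coord_space_def)

lemma restrict_vec_id: "x \<in> coord_space I \<Longrightarrow> restrict_vec I x = x"
  by (auto simp: restrict_vec_def coord_space_def)

lemma linear_restrict_vec: "linear (restrict_vec I)"
  by (rule linearI) (auto simp: restrict_vec_def scaleR_fun_def)

lemma L2_set_eq_inner_on: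
  assumes "finite I" "\<sigma> \<subseteq> I" "x \<in> coord_space \<sigma>"
  shows "L2_set x \<sigma> = sqrt (inner_on I x x)"
proof -
  have "(\<Sum>i\<in>\<sigma>. (x i)\<^sup>2) = (\<Sum>i\<in>I. (x i)\<^sup>2)"
    using assms by (intro sum.mono_neutral_left) (auto simp: coord_space_def)
  then show ?thesis by (simp add: L2_set_def inner_on_def power2_eq_square)
qed

locale operator_setting =
  fixes V :: "'v::real_vector set" and N n and T :: "(nat \<Rightarrow> real) \<Rightarrow> 'v"
  assumes V: "normed_space_on V N" and ht: "has_type2 V N" and T: "linear_operator n V T"
begin

definition I :: "nat set" where "I = {1..n}"

definition q :: "(nat \<Rightarrow> real) \<Rightarrow> real" where "q x = N (T (restrict_vec I x))"

lemma T_in: "x \<in> coord_space I \<Longrightarrow> T x \<in> V"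
  and T_add: "x \<in> coord_space I \<Longrightarrow> y \<in> coord_space I \<Longrightarrow> T (x + y) = T x + T y"
  and T_scale: "x \<in> coord_space I \<Longrightarrow> T (a *\<^sub>R x) = a *\<^sub>R T x"
  using T by (auto simp: linear_operator_def I_def)

lemma subspace_V: "subspace V"
  and N_nonneg: "u \<in> V \<Longrightarrow> 0 \<le> N u"
  and N_scale: "u \<in> V \<Longrightarrow> N (a *\<^sub>R u) = \<bar>a\<bar> * N u"
  and N_add: "u \<in> V \<Longrightarrow> w \<in> V \<Longrightarrow> N (u + w) \<le> N u + N w"
  using V by (auto simp: normed_space_on_def)

text \<open>Stated for restricted vectors, because \<open>T\<close> is linear on \<open>\<real>\<^sup>n\<close> but arbitrary elsewhere.\<close>

lemma T_sum: "T (\<Sum>i<(m::nat). a i *\<^sub>R restrict_vec I (z i)) = (\<Sum>i<m. a i *\<^sub>R T (restrict_vec I (z i)))"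
proof (induction m)
  case 0
  have "T (0 *\<^sub>R 0) = 0 *\<^sub>R T 0"
    by (rule T_scale) (rule subspace_0[OF subspace_coord_space])
  then have "T 0 = 0" by (simp only: scaleR_zero_left)
  then show ?case by (simp only: lessThan_0 sum.empty)
next
  case (Suc m)
  have s: "(\<Sum>i<m. a i *\<^sub>R restrict_vec I (z i)) \<in> coord_space I"
    by (intro subspace_sum[OF subspace_coord_space] subspace_scale[OF subspace_coord_space] restrict_vec_in)
  have t: "a m *\<^sub>R restrict_vec I (z m) \<in> coord_space I"
    by (intro subspace_scale[OF subspace_coord_space] restrict_vec_in)
  show ?case by (simp only: sum.lessThan_Suc T_add[OF s t] T_scale[OF restrict_vec_in] Suc.IH)
qed

lemma seminorm_q: "seminorm q"
  unfolding seminorm_def q_def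
  by (simp add: linear_add[OF linear_restrict_vec] linear_scale[OF linear_restrict_vec]
      T_add T_scale N_add N_scale restrict_vec_in T_in)

lemma q_eq: "x \<in> coord_space I \<Longrightarrow> q x = N (T x)"
  by (simp add: q_def restrict_vec_id)

lemma finite_I: "finite I" by (simp add: I_def)

lemma q_le_coords: "q x \<le> (\<Sum>i\<in>I. \<bar>x i\<bar> * q (unit_vec i))"
proof -
  have "restrict_vec I x = (\<Sum>i\<in>I. x i *\<^sub>R unit_vec i)"
    using finite_I
    by (auto simp: fun_eq_iff restrict_vec_def sum_fun_apply scaleR_fun_def unit_vec_def if_distrib cong: if_cong)
  then have "q x = q (\<Sum>i\<in>I. x i *\<^sub>R unit_vec i)"
    by (metis q_def restrict_vec_id restrict_vec_in)
  also have "\<dots> \<le> (\<Sum>i\<in>I. q (x i *\<^sub>R unit_vec i))" by (rule seminorm_sum_le[OF seminorm_q])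
  finally show ?thesis by (simp add: seminorm_scale[OF seminorm_q])
qed

lemma q_le_op_norm: "q x \<le> op_norm n N T * sqrt (inner_on I x x)"
proof -
  let ?S = "{x \<in> coord_space {1..n}. L2_set x {1..n} \<le> 1}"
  have "N (T y) \<le> (\<Sum>i\<in>I. q (unit_vec i))" if y: "y \<in> ?S" for y
  proof -
    have "\<bar>y i\<bar> \<le> 1" if "i \<in> I" for i
    proof -
      have "\<bar>y i\<bar> \<le> L2_set (\<lambda>i. \<bar>y i\<bar>) I"
        using that finite_I by (intro member_le_L2_set) auto
      also have "\<dots> = L2_set y I" by (simp add: L2_set_def)
      finally show ?thesis using y by (simp add: I_def)
    qed
    then have "(\<Sum>i\<in>I. \<bar>y i\<bar> * q (unit_vec i)) \<le> (\<Sum>i\<in>I. 1 * q (unit_vec i))"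
      using seminorm_nonneg[OF seminorm_q] by (intro sum_mono mult_right_mono) auto
    moreover have "N (T y) = q y" using y q_eq by (simp add: I_def)
    ultimately show ?thesis using q_le_coords[of y] by simp
  qed
  then have bdd: "bdd_above ((\<lambda>x. N (T x)) ` ?S)"
    by (auto intro!: bdd_aboveI)
  have in_S: "q y \<le> op_norm n N T" if "y \<in> ?S" for y
  proof -
    have "N (T y) \<le> op_norm n N T" unfolding op_norm_def by (rule cSUP_upper[OF that bdd])
    then show ?thesis using that q_eq by (simp add: I_def)
  qed
  define y where "y = restrict_vec I x"
  define r where "r = sqrt (inner_on I x x)"
  have qy: "q x = q y" by (simp add: q_def y_def restrict_vec_id restrict_vec_in)
  have y: "y \<in> coord_space I" by (simp add: y_def restrict_vec_in)
  have r: "L2_set y I = r"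
    using L2_set_eq_inner_on[OF finite_I order_refl y] by (simp add: r_def y_def inner_on_def restrict_vec_def)
  show ?thesis
  proof (cases "r = 0")
    case True
    then have "y i = 0" if "i \<in> I" for i
      using r that finite_I by (simp add: L2_set_eq_0_iff)
    then have "y = 0" using y by (auto simp: coord_space_def fun_eq_iff)
    then have "q y = 0" using seminorm_zero[OF seminorm_q] by metis
    then show ?thesis using True qy by (simp add: r_def)
  next
    case False
    have r0: "0 < r" using False inner_on_self_nonneg[of I x] by (simp add: r_def)
    have "L2_set ((1 / r) *\<^sub>R y) I = 1 / r * L2_set y I"
      using r0 by (subst L2_set_right_distrib) (simp_all add: scaleR_fun_def)
    then have "(1 / r) *\<^sub>R y \<in> ?S"
      using subspace_scale[OF subspace_coord_space y] r r0 by (simp add: I_def)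
    from in_S[OF this] have "q y / r \<le> op_norm n N T"
      using r0 by (simp add: seminorm_scale[OF seminorm_q])
    then show ?thesis using r0 qy by (simp add: r_def pos_divide_le_eq)
  qed
qed

lemma sign_avg_q_le:
  assumes M: "type2_bound V N M"
  shows "sign_avg (length zs) (\<lambda>e. q (signed_sum zs e)) \<le> M * sqrt (\<Sum>z\<leftarrow>zs. (q z)\<^sup>2)"
proof -
  define x where "x = (\<lambda>i. T (restrict_vec I (rev zs ! i)))"
  have x: "x i \<in> V" for i by (simp add: x_def T_in restrict_vec_in)
  have "q (signed_sum zs (rev (map \<epsilon> [0..<length zs]))) = N (\<Sum>i<length zs. \<epsilon> i *\<^sub>R x i)" for \<epsilon>
    unfolding signed_sum_rev_map q_def x_def T_sum[symmetric]
    by (simp add: linear_sum[OF linear_restrict_vec] linear_scale[OF linear_restrict_vec])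
  then have "sign_avg (length zs) (\<lambda>e. q (signed_sum zs e))
      = measure_pmf.expectation (rademacher (length zs)) (\<lambda>\<epsilon>. N (\<Sum>i<length zs. \<epsilon> i *\<^sub>R x i))"
    by (simp flip: expectation_rademacher)
  also have "\<dots> \<le> M * sqrt (\<Sum>i<length zs. (N (x i))\<^sup>2)"
    using M x by (simp add: type2_bound_def)
  also have "(\<Sum>i<length zs. (N (x i))\<^sup>2) = (\<Sum>i<length (rev zs). (q (rev zs ! i))\<^sup>2)"
    by (simp add: x_def q_def)
  also have "\<dots> = (\<Sum>z\<leftarrow>rev zs. (q z)\<^sup>2)"
    by (simp add: sum_list_sum_nth atLeast0LessThan)
  also have "\<dots> = (\<Sum>z\<leftarrow>zs. (q z)\<^sup>2)" by (simp flip: rev_map)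
  finally show ?thesis .
qed

lemma q_measurable: "q \<in> borel_measurable borel"
  by (rule measurable_seminorm[OF seminorm_q finite_I q_le_op_norm])

lemma gauss_avg_ge:
  assumes "real n \<le> (ell_norm n N T)\<^sup>2" "0 < n" "distinct ks" "set ks = I"
  shows "ennreal (real (card I)) \<le> gauss_avg (map unit_vec ks) (\<lambda>v. ennreal ((q v)\<^sup>2))"
proof -
  let ?P = "\<Pi>\<^sub>M i\<in>I. gauss"
  define f where "f = (\<lambda>g. (q (restrict_vec I g))\<^sup>2)"
  have "(\<lambda>g. restrict_vec I g) \<in> borel_measurable ?P"
  proof (rule measurable_into_sequences)
    fix i
    show "(\<lambda>g. restrict_vec I g i) \<in> borel_measurable ?P"
      by (cases "i \<in> I") (simp_all add: restrict_vec_def measurable_gauss_coordinate)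
  qed
  then have meas: "f \<in> borel_measurable ?P" unfolding f_def
    by (intro borel_measurable_power measurable_compose[OF _ q_measurable])
  define J where "J = (\<integral>g. f g \<partial>?P)"
  have "ell_norm n N T = sqrt J"
    by (simp add: ell_norm_def J_def f_def q_def restrict_vec_id restrict_vec_in std_gaussian_def I_def)
      (simp add: restrict_vec_def)
  moreover have "0 \<le> J" unfolding J_def by (rule integral_nonneg_AE) (simp add: f_def)
  ultimately have nJ: "real n \<le> J" using assms(1) by simp
  have J: "J = enn2real (\<integral>\<^sup>+g. ennreal (f g) \<partial>?P)"
    unfolding J_def using meas by (intro integral_eq_nn_integral) (auto simp: f_def)
  have "ennreal (real n) \<le> (\<integral>\<^sup>+g. ennreal (f g) \<partial>?P)"
  proof (cases "(\<integral>\<^sup>+g. ennreal (f g) \<partial>?P) = \<infinity>")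
    case False
    then have "ennreal J = (\<integral>\<^sup>+g. ennreal (f g) \<partial>?P)" unfolding J by (simp add: less_top)
    then show ?thesis using nJ by (metis ennreal_leI)
  qed simp
  also have "\<dots> = gauss_avg (map unit_vec ks) (\<lambda>v. ennreal ((q v)\<^sup>2))"
    using nn_integral_std_gaussian[OF assms(3) measurable_seminorm_square[OF q_measurable]] assms(4)
    by (simp add: f_def)
  finally show ?thesis by (simp add: I_def)
qed

text \<open>The constant \<open>12\<close> in the bound is a rational upper estimate of \<open>sqrt 128\<close>; the added \<open>1\<close> keeps
  the factor finite for the zero space, whose type 2 constant is 0.\<close>

theorem large_restriction:
  assumes ell: "real n \<le> (ell_norm n N T)\<^sup>2"
  shows "large_coord_restriction (1/16) (1 / (12 * (\<bar>type2_const V N\<bar> + 1))) N n T"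
proof (cases "n = 0")
  case True
  have "0 \<le> N (T x)" if "x \<in> coord_space {}" for x
    using that coord_space_mono[of "{}" I] by (intro N_nonneg T_in) auto
  then show ?thesis using True by (simp add: large_coord_restriction_def Let_def)
next
  case False
  define K where "K = op_norm n N T"
  define M where "M = \<bar>type2_const V N\<bar> + 1"
  have M: "1 \<le> M" by (simp add: M_def)
  have Mb: "type2_bound V N M"
    by (rule type2_bound_mono[OF type2_bound_type2_const(1)[OF ht]]) (simp add: M_def)
  have card: "card I = n" and ne: "I \<noteq> {}" using False by (simp_all add: I_def)
  obtain ks where ks: "distinct ks" "set ks = I" using finite_distinct_list[OF finite_I] by blast
  have K0: "0 \<le> K"
  proof -
    have "inner_on I (unit_vec 1) (unit_vec 1) = 1"
      using finite_I False by (simp add: I_def inner_on_unit_vec) (simp add: unit_vec_def)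
    then show ?thesis using q_le_op_norm[of "unit_vec 1"] seminorm_nonneg[OF seminorm_q, of "unit_vec 1"]
      by (simp add: K_def)
  qed
  note ge = gauss_avg_ge[OF ell _ ks]
  have qK: "q x \<le> K * sqrt (inner_on I x x)" for x
    unfolding K_def by (rule q_le_op_norm)
  have "ennreal (real n) \<le> gauss_avg (map unit_vec ks) (\<lambda>v. ennreal ((q v)\<^sup>2))"
    using ge False card by simp
  also have "\<dots> \<le> ennreal (K\<^sup>2 * real n)"
    using gauss_avg_unit_vec_le[OF seminorm_q K0 qK ks] card by simp
  finally have "ennreal (real n) \<le> ennreal (K\<^sup>2 * real n)" .
  then have "1 \<le> K\<^sup>2" using False K0 by (simp add: ennreal_le_iff)
  then have K1: "1 \<le> K" using K0 power2_le_imp_le[of 1 K] by simp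
  obtain \<sigma> where \<sigma>: "\<sigma> \<subseteq> I" "real n / (16 * K\<^sup>2) \<le> real (card \<sigma>)"
    "\<And>x. x \<in> coord_space \<sigma> \<Longrightarrow> inner_on I x x / (128 * M\<^sup>2) \<le> (q x)\<^sup>2"
  proof -
    have "0 < K" "0 < M" using K1 M by simp_all
    with seminorm_restriction[OF seminorm_q q_measurable ks ne _ sign_avg_q_le[OF Mb] _ qK ge] False card that
    show ?thesis by auto
  qed
  define \<alpha> where "\<alpha> = 1/16 * ln (2 * K) powr (-3/2)"
  have "1/2 \<le> ln (2 * K)"
  proof -
    have "ln (1/2 :: real) \<le> 1/2 - 1" by (rule ln_le_minus_one) simp
    then have "1/2 \<le> ln (2 :: real)" by (simp add: ln_div)
    also have "\<dots> \<le> ln (2 * K)" using K1 by simp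
    finally show ?thesis .
  qed
  then have "ln (2 * K) powr (-3/2) \<le> (1/2) powr (-3/2)" by (intro powr_mono2') auto
  also have "\<dots> = 2 powr (3/2)" by (simp add: powr_divide powr_minus field_simps)
  also have "\<dots> \<le> 2 powr 2" by (intro powr_mono) auto
  finally have \<alpha>: "0 \<le> \<alpha>" "\<alpha> \<le> 1/4" by (simp_all add: \<alpha>_def)
  have "\<alpha>\<^sup>2 * real n / K\<^sup>2 \<le> (1/4)\<^sup>2 * real n / K\<^sup>2"
    using \<alpha> by (intro divide_right_mono mult_right_mono power_mono) auto
  also have "\<dots> = real n / (16 * K\<^sup>2)" by (simp add: power2_eq_square)
  finally have size: "\<alpha>\<^sup>2 * real n / K\<^sup>2 \<le> real (card \<sigma>)" using \<sigma>(2) by linarith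
  have "\<alpha> * (1 / (12 * M)) * L2_set x \<sigma> \<le> N (T x)" if x: "x \<in> coord_space \<sigma>" for x
  proof -
    have xI: "x \<in> coord_space I" using x coord_space_mono[OF \<sigma>(1)] by blast
    have L: "L2_set x \<sigma> = sqrt (inner_on I x x)" by (rule L2_set_eq_inner_on[OF finite_I \<sigma>(1) x])
    have "(1 / (12 * M) * L2_set x \<sigma>)\<^sup>2 = inner_on I x x / (144 * M\<^sup>2)"
      using inner_on_self_nonneg[of I x] by (simp add: L power_mult_distrib power_divide)
    also have "\<dots> \<le> inner_on I x x / (128 * M\<^sup>2)"
      using M inner_on_self_nonneg[of I x] by (intro divide_left_mono) auto
    also have "\<dots> \<le> (q x)\<^sup>2" by (rule \<sigma>(3)[OF x])
    finally have "1 / (12 * M) * L2_set x \<sigma> \<le> q x"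
      using seminorm_nonneg[OF seminorm_q] by (rule power2_le_imp_le)
    moreover have "\<alpha> * (1 / (12 * M) * L2_set x \<sigma>) \<le> 1 * (1 / (12 * M) * L2_set x \<sigma>)"
      using \<alpha> M by (intro mult_right_mono) (auto intro!: mult_nonneg_nonneg)
    ultimately show ?thesis using q_eq[OF xI] by (simp add: mult.assoc)
  qed
  then show ?thesis using \<sigma>(1) size
    unfolding large_coord_restriction_def Let_def K_def[symmetric] M_def[symmetric] \<alpha>_def[symmetric] I_def
    by blast
qed

end

section \<open>Transfer between ambient spaces\<close>

lemma independent_unit_vecs: "independent (unit_vec ` A)"
proof (rule independent_explicit_finite_subsets[THEN iffD2], intro allI impI ballI)
  fix S u v
  assume S: "S \<subseteq> unit_vec ` A" "finite S" and 0: "(\<Sum>w\<in>S. u w *\<^sub>R w) = 0" and v: "v \<in> S"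
  obtain k where k: "v = unit_vec k" using S v by auto
  have "0 = (\<Sum>w\<in>S. u w *\<^sub>R w) k" by (simp add: 0)
  also have "\<dots> = (\<Sum>w\<in>S. if w = v then u w else 0)"
    unfolding sum_fun_apply
  proof (intro sum.cong refl)
    fix w assume "w \<in> S"
    then obtain l where "w = unit_vec l" using S by auto
    then show "(u w *\<^sub>R w) k = (if w = v then u w else 0)"
      by (auto simp: k unit_vec_def scaleR_fun_def fun_eq_iff)
  qed
  also have "\<dots> = u v" using S v by simp
  finally show "u v = 0" by simp
qed

text \<open>A countable basis is mapped to distinct unit vectors.\<close>

lemma embed_countable_span:
  fixes C :: "'v::real_vector set"
  assumes "countable C"
  obtains J :: "'v \<Rightarrow> nat \<Rightarrow> real" where "linear J" "inj_on J (span C)"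
proof -
  obtain B where B: "B \<subseteq> C" "independent B" "C \<subseteq> span B"
    using maximal_independent_subset by blast
  have "countable B" using B(1) assms by (rule countable_subset)
  then have inj: "inj_on (to_nat_on B) B" by (rule inj_on_to_nat_on)
  obtain J where J: "linear J" "\<And>b. b \<in> B \<Longrightarrow> J b = unit_vec (to_nat_on B b)"
    using linear_independent_extend[OF B(2), of "\<lambda>b. unit_vec (to_nat_on B b)"] by blast
  have "inj unit_vec"
  proof (rule injI)
    fix k l assume "unit_vec k = unit_vec l"
    then have "unit_vec k k = unit_vec l k" by simp
    then show "k = l" by (simp add: unit_vec_def split: if_splits)
  qed
  then have "inj_on (\<lambda>b. unit_vec (to_nat_on B b)) B"
    using inj by (auto simp: inj_on_def)
  then have "inj_on J B" using J(2) by (simp cong: inj_on_cong)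
  moreover have "J ` B = unit_vec ` (to_nat_on B ` B)" using J(2) by force
  then have "independent (J ` B)" by (simp add: independent_unit_vecs)
  ultimately have "inj_on J (span B)" by (intro linear_inj_on_span_independent_image J(1))
  moreover have "span C \<subseteq> span B" using B(3) by (simp add: span_minimal)
  ultimately show ?thesis using that J(1) inj_on_subset by blast
qed

lemma not_type2_bound_witness:
  assumes "\<not> type2_bound V N M"
  shows "\<exists>m x. (\<forall>i<(m::nat). x i \<in> V) \<and>
    M * sqrt (\<Sum>i<m. (N (x i))\<^sup>2) < measure_pmf.expectation (rademacher m) (\<lambda>\<epsilon>. N (\<Sum>i<m. \<epsilon> i *\<^sub>R x i))"
  using assms by (auto simp: type2_bound_def not_le)

text \<open>For every rational number that is not a type 2 bound, one finite family of vectors that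
  violates the inequality is put into \<open>C\<close>. Rational numbers are enough: a violation at \<open>M\<close> persists
  at slightly larger numbers.\<close>

lemma countable_type2_witnesses:
  fixes V :: "'v::real_vector set"
  obtains C where "countable C" "C \<subseteq> V"
    "\<And>Y M. C \<subseteq> Y \<Longrightarrow> Y \<subseteq> V \<Longrightarrow> type2_bound Y N M \<longleftrightarrow> type2_bound V N M"
proof -
  define bad where "bad = (\<lambda>r m x. (\<forall>i<(m::nat). x i \<in> V) \<and>
    r * sqrt (\<Sum>i<m. (N (x i))\<^sup>2) < measure_pmf.expectation (rademacher m) (\<lambda>\<epsilon>. N (\<Sum>i<m. \<epsilon> i *\<^sub>R x i)))"
  have "\<forall>r::rat. \<exists>m x. \<not> type2_bound V N (real_of_rat r) \<longrightarrow> bad (real_of_rat r) m x"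
    using not_type2_bound_witness[of V N] unfolding bad_def by blast
  then obtain m x where mx: "\<And>r. \<not> type2_bound V N (real_of_rat r) \<Longrightarrow> bad (real_of_rat r) (m r) (x r)"
    by metis
  define C where "C = (\<Union>r\<in>{r. \<not> type2_bound V N (real_of_rat r)}. x r ` {..<m r})"
  have count: "countable C" unfolding C_def by (intro countable_UN countableI_type) auto
  have sub: "C \<subseteq> V" using mx by (auto simp: C_def bad_def)
  have iff: "type2_bound Y N M \<longleftrightarrow> type2_bound V N M"
    if Y: "C \<subseteq> Y" "Y \<subseteq> V" for Y M
  proof
    assume "type2_bound V N M"
    then show "type2_bound Y N M" using Y(2) by (auto simp: type2_bound_def)
  next
    assume YM: "type2_bound Y N M"
    show "type2_bound V N M"
    proof (rule ccontr)
      assume "\<not> type2_bound V N M"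
      then obtain k z where z: "bad M k z"
        using not_type2_bound_witness[of V N M] unfolding bad_def by blast
      define E where "E = measure_pmf.expectation (rademacher k) (\<lambda>\<epsilon>. N (\<Sum>i<k. \<epsilon> i *\<^sub>R z i))"
      define s where "s = sqrt (\<Sum>i<k. (N (z i))\<^sup>2)"
      have s: "0 \<le> s" by (simp add: s_def sum_nonneg)
      have lt: "M * s < E" using z by (simp add: bad_def E_def s_def)
      \<comment> \<open>a rational number above \<open>M\<close> that the same family still violates\<close>
      have "\<exists>r. M < real_of_rat r \<and> real_of_rat r * s < E"
      proof (cases "s = 0")
        case True
        then show ?thesis using lt of_rat_dense[of M "M + 1"] by auto
      next
        case False
        then have "M < E / s" using lt s by (simp add: pos_less_divide_eq)
        from of_rat_dense[OF this] show ?thesis using False s by (auto simp: pos_less_divide_eq)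
      qed
      then obtain r where r: "M < real_of_rat r" "real_of_rat r * s < E" by blast
      have nb: "\<not> type2_bound V N (real_of_rat r)"
        using r(2) z by (auto simp: type2_bound_def bad_def E_def s_def not_le)
      have "\<forall>i<m r. x r i \<in> Y" using nb Y(1) by (auto simp: C_def)
      moreover have "type2_bound Y N (real_of_rat r)"
        using type2_bound_mono[OF YM] r(1) by simp
      ultimately show False using mx[OF nb] unfolding type2_bound_def bad_def by (meson not_le)
    qed
  qed
  show ?thesis by (rule that[OF count sub iff])
qed

lemma type2_bound_image:
  assumes J: "linear J" and Y: "subspace Y" and N': "\<And>y. y \<in> Y \<Longrightarrow> N' (J y) = N y"
  shows "type2_bound (J ` Y) N' M \<longleftrightarrow> type2_bound Y N M"
proof -
  have sums: "N' (\<Sum>i<m. \<epsilon> i *\<^sub>R J (y i)) = N (\<Sum>i<m. \<epsilon> i *\<^sub>R y i)" if "\<forall>i<m. y i \<in> Y" for m \<epsilon> and y :: "nat \<Rightarrow> 'a"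
  proof -
    have "(\<Sum>i<m. \<epsilon> i *\<^sub>R y i) \<in> Y" using that by (intro subspace_sum[OF Y] subspace_scale[OF Y]) auto
    from N'[OF this] show ?thesis by (simp add: linear_sum[OF J] linear_scale[OF J])
  qed
  show ?thesis
  proof
    assume b: "type2_bound (J ` Y) N' M"
    show "type2_bound Y N M" unfolding type2_bound_def
    proof (intro allI impI)
      fix m and y :: "nat \<Rightarrow> 'a" assume y: "\<forall>i<m. y i \<in> Y"
      have "(\<Sum>i<m. (N' (J (y i)))\<^sup>2) = (\<Sum>i<m. (N (y i))\<^sup>2)"
        using y N' by (intro sum.cong) auto
      then show "measure_pmf.expectation (rademacher m) (\<lambda>\<epsilon>. N (\<Sum>i<m. \<epsilon> i *\<^sub>R y i)) \<le> M * sqrt (\<Sum>i<m. (N (y i))\<^sup>2)"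
        using b[unfolded type2_bound_def, rule_format, of m "\<lambda>i. J (y i)"] y by (simp add: sums)
    qed
  next
    assume b: "type2_bound Y N M"
    show "type2_bound (J ` Y) N' M" unfolding type2_bound_def
    proof (intro allI impI)
      fix m and x :: "nat \<Rightarrow> 'b" assume "\<forall>i<m. x i \<in> J ` Y"
      then have "\<forall>i. \<exists>y. i < m \<longrightarrow> y \<in> Y \<and> x i = J y" by blast
      then obtain y where y: "\<forall>i<m. y i \<in> Y \<and> x i = J (y i)" by metis
      have "(\<Sum>i<m. (N' (x i))\<^sup>2) = (\<Sum>i<m. (N (y i))\<^sup>2)"
        using y N' by (intro sum.cong) auto
      moreover have "(\<Sum>i<m. \<epsilon> i *\<^sub>R x i) = (\<Sum>i<m. \<epsilon> i *\<^sub>R J (y i))" for \<epsilon> :: "nat \<Rightarrow> real"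
        using y by (intro sum.cong) auto
      ultimately show "measure_pmf.expectation (rademacher m) (\<lambda>\<epsilon>. N' (\<Sum>i<m. \<epsilon> i *\<^sub>R x i)) \<le> M * sqrt (\<Sum>i<m. (N' (x i))\<^sup>2)"
        using b[unfolded type2_bound_def, rule_format, of m y] y by (simp add: sums)
    qed
  qed
qed

lemma normed_space_on_subspace:
  "normed_space_on V N \<Longrightarrow> subspace Y \<Longrightarrow> Y \<subseteq> V \<Longrightarrow> normed_space_on Y N"
  by (auto simp: normed_space_on_def subset_iff)

lemma normed_space_on_image:
  assumes J: "linear J" "inj_on J Y" and Y: "normed_space_on Y N" and N': "\<And>y. y \<in> Y \<Longrightarrow> N' (J y) = N y"
  shows "normed_space_on (J ` Y) N'"
proof -
  have sub: "subspace Y" using Y by (simp add: normed_space_on_def)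
  have J0: "J y = 0 \<longleftrightarrow> y = 0" if "y \<in> Y" for y
    using inj_on_eq_iff[OF J(2) that subspace_0[OF sub]] linear_0[OF J(1)] by simp
  show ?thesis unfolding normed_space_on_def
  proof (intro conjI ballI allI)
    show "subspace (J ` Y)" using J(1) sub by (rule linear_subspace_image)
  next
    fix x assume "x \<in> J ` Y"
    then obtain y where y: "y \<in> Y" "x = J y" by blast
    show "0 \<le> N' x" "N' x = 0 \<longleftrightarrow> x = 0"
      using Y y N' J0 by (simp_all add: normed_space_on_def)
    fix a
    have "a *\<^sub>R y \<in> Y" using sub y(1) by (rule subspace_scale)
    then have "N' (J (a *\<^sub>R y)) = N (a *\<^sub>R y)" by (rule N')
    then show "N' (a *\<^sub>R x) = \<bar>a\<bar> * N' x"
      using Y y N' by (simp add: normed_space_on_def linear_scale[OF J(1)])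
  next
    fix x x' assume "x \<in> J ` Y" "x' \<in> J ` Y"
    then obtain y y' where y: "y \<in> Y" "x = J y" "y' \<in> Y" "x' = J y'" by blast
    have "y + y' \<in> Y" using sub y(1,3) by (rule subspace_add)
    then have "N' (J (y + y')) = N (y + y')" by (rule N')
    then show "N' (x + x') \<le> N' x + N' x'"
      using Y y N' by (simp add: normed_space_on_def linear_add[OF J(1)])
  qed
qed

text \<open>The span of the witnesses and of the image of \<open>T\<close> has the same type 2 bounds as \<open>V\<close>; it has
  countable dimension, so its image in the sequences carries a copy of the norm.\<close>

lemma operator_transfer:
  fixes V :: "'v::real_vector set"
  assumes V: "normed_space_on V N" and ht: "has_type2 V N" and T: "linear_operator n V T"
  obtains V' :: "(nat \<Rightarrow> real) set" and N' T' where
    "normed_space_on V' N'" "has_type2 V' N'" "type2_const V' N' = type2_const V N"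
    "linear_operator n V' T'" "\<And>x. x \<in> coord_space {1..n} \<Longrightarrow> N' (T' x) = N (T x)"
proof -
  interpret operator_setting V N n T by unfold_locales (fact V ht T)+
  obtain C where C: "countable C" "C \<subseteq> V"
    "\<And>Y M. C \<subseteq> Y \<Longrightarrow> Y \<subseteq> V \<Longrightarrow> type2_bound Y N M \<longleftrightarrow> type2_bound V N M"
    using countable_type2_witnesses[of V N] by blast
  define D where "D = C \<union> (\<lambda>i. T (unit_vec i)) ` I"
  have D: "countable D" "D \<subseteq> V"
    using C(1,2) finite_I by (auto simp: D_def countable_finite intro: T_in unit_vec_in_coord_space)
  define Y where "Y = span D"
  have Y: "subspace Y" "Y \<subseteq> V" "C \<subseteq> Y"
    using span_minimal[OF D(2) subspace_V] span_superset[of D] by (simp_all add: Y_def) (simp add: D_def)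
  have NY: "normed_space_on Y N" by (rule normed_space_on_subspace[OF V Y(1,2)])
  have TY: "T x \<in> Y" if x: "x \<in> coord_space I" for x
  proof -
    have "restrict_vec I (unit_vec i) = unit_vec i" if "i \<in> I" for i
      using that by (intro restrict_vec_id unit_vec_in_coord_space)
    have sum: "(\<Sum>i\<in>A. x i *\<^sub>R unit_vec i) \<in> coord_space I \<and> T (\<Sum>i\<in>A. x i *\<^sub>R unit_vec i) \<in> Y" if "A \<subseteq> I" for A
      using finite_subset[OF that finite_I] that
    proof (induction A rule: finite_induct)
      case empty
      have "T (0 *\<^sub>R 0) = 0 *\<^sub>R T 0"
        by (rule T_scale) (rule subspace_0[OF subspace_coord_space])
      then have "T 0 = 0" by (simp only: scaleR_zero_left)
      then show ?case
        by (simp only: sum.empty subspace_0[OF subspace_coord_space] subspace_0[OF Y(1)])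
    next
      case (insert i A)
      have u: "unit_vec i \<in> coord_space I" using insert.prems by (intro unit_vec_in_coord_space) auto
      have "T (unit_vec i) \<in> Y" using insert.prems by (auto simp: Y_def D_def intro: span_base)
      then have "x i *\<^sub>R T (unit_vec i) + T (\<Sum>i\<in>A. x i *\<^sub>R unit_vec i) \<in> Y"
        using insert by (intro subspace_add[OF Y(1)] subspace_scale[OF Y(1)]) auto
      moreover have s: "x i *\<^sub>R unit_vec i \<in> coord_space I" by (rule subspace_scale[OF subspace_coord_space u])
      have S: "(\<Sum>i\<in>A. x i *\<^sub>R unit_vec i) \<in> coord_space I" using insert by blast
      have eq: "(\<Sum>i\<in>insert i A. x i *\<^sub>R unit_vec i) = x i *\<^sub>R unit_vec i + (\<Sum>i\<in>A. x i *\<^sub>R unit_vec i)"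
        by (rule sum.insert[OF insert.hyps])
      ultimately show ?case
        unfolding eq T_add[OF s S] T_scale[OF u] using subspace_add[OF subspace_coord_space s S] by blast
    qed
    have eqx: "x = (\<Sum>i\<in>I. x i *\<^sub>R unit_vec i)"
      using finite_I x
      by (auto simp: fun_eq_iff coord_space_def sum_fun_apply scaleR_fun_def unit_vec_def if_distrib cong: if_cong)
    show ?thesis using sum[OF order_refl] by (subst eqx) (rule conjunct2)
  qed
  obtain J :: "'v \<Rightarrow> nat \<Rightarrow> real" where J: "linear J" "inj_on J Y"
    using embed_countable_span[OF D(1)] unfolding Y_def by blast
  define N' where "N' = N \<circ> inv_into Y J"
  have N': "N' (J y) = N y" if "y \<in> Y" for y
    using that J(2) by (simp add: N'_def inv_into_f_f)
  have bound: "type2_bound (J ` Y) N' M \<longleftrightarrow> type2_bound V N M" for M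
    using type2_bound_image[OF J(1) Y(1), of N' N] N' C(3)[OF Y(3,2)] by simp
  show ?thesis
  proof
    show "normed_space_on (J ` Y) N'" by (rule normed_space_on_image[OF J NY]) (rule N')
    show "has_type2 (J ` Y) N'" using ht by (simp add: has_type2_def bound)
    show "type2_const (J ` Y) N' = type2_const V N" by (simp add: type2_const_def bound)
    show "linear_operator n (J ` Y) (\<lambda>x. J (T x))"
      using TY unfolding linear_operator_def I_def[symmetric]
      by (simp add: T_add T_scale linear_add[OF J(1)] linear_scale[OF J(1)])
    show "N' (J (T x)) = N (T x)" if "x \<in> coord_space {1..n}" for x
      using N' TY that by (simp add: I_def)
  qed
qed

lemma coord_restriction_cong:
  assumes eq: "\<And>x. x \<in> coord_space {1..n} \<Longrightarrow> N' (T' x) = N (T x)"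
  shows "op_norm n N' T' = op_norm n N T" "ell_norm n N' T' = ell_norm n N T"
    "large_coord_restriction c b N' n T' \<longleftrightarrow> large_coord_restriction c b N n T"
proof -
  show op: "op_norm n N' T' = op_norm n N T"
    unfolding op_norm_def by (intro SUP_cong refl) (simp add: eq)
  have "(\<lambda>i. if i \<in> {1..n} then g i else 0) \<in> coord_space {1..n}" for g :: "nat \<Rightarrow> real"
    by (simp add: coord_space_def)
  then show "ell_norm n N' T' = ell_norm n N T" by (simp only: ell_norm_def eq)
  have "N' (T' x) = N (T x)" if "\<sigma> \<subseteq> {1..n}" "x \<in> coord_space \<sigma>" for \<sigma> x
    using eq coord_space_mono[OF that(1)] that(2) by blast
  then show "large_coord_restriction c b N' n T' \<longleftrightarrow> large_coord_restriction c b N n T"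
    unfolding large_coord_restriction_def Let_def op
    by (intro ex_cong1 conj_cong ball_cong refl) simp
qed

(* The first conjunct provides the constants, uniformly over all normed spaces inside the ambient
   space nat => real.  The second conjunct says that any such constants, fixed before the type 'v,
   also serve for all normed spaces inside an arbitrary ambient space 'v. *)

theorem theorem1p5:
  shows "(\<exists>c>0. \<exists>\<beta> :: real \<Rightarrow> real. (\<forall>M. 0 < \<beta> M) \<and>
          (\<forall>(V :: (nat \<Rightarrow> real) set) N n T.
             normed_space_on V N \<and> has_type2 V N \<and>
             linear_operator n V T \<and> (ell_norm n N T)\<^sup>2 \<ge> real n \<longrightarrow>
             large_coord_restriction c (\<beta> (type2_const V N)) N n T)) \<and>
         (\<forall>c>0. \<forall>\<beta> :: real \<Rightarrow> real. (\<forall>M. 0 < \<beta> M) \<and>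
          (\<forall>(V :: (nat \<Rightarrow> real) set) N n T.
             normed_space_on V N \<and> has_type2 V N \<and>
             linear_operator n V T \<and> (ell_norm n N T)\<^sup>2 \<ge> real n \<longrightarrow>
             large_coord_restriction c (\<beta> (type2_const V N)) N n T) \<longrightarrow>
          (\<forall>(V :: 'v::real_vector set) N n T.
             normed_space_on V N \<and> has_type2 V N \<and>
             linear_operator n V T \<and> (ell_norm n N T)\<^sup>2 \<ge> real n \<longrightarrow>
             large_coord_restriction c (\<beta> (type2_const V N)) N n T))"
proof (intro conjI allI impI)
  let ?\<beta> = "\<lambda>M :: real. 1 / (12 * (\<bar>M\<bar> + 1))"
  have "large_coord_restriction (1/16) (?\<beta> (type2_const V N)) N n T"
    if "normed_space_on V N \<and> has_type2 V N \<and> linear_operator n V T \<and> real n \<le> (ell_norm n N T)\<^sup>2"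
    for V :: "(nat \<Rightarrow> real) set" and N n T
    using that by (intro operator_setting.large_restriction) (auto simp: operator_setting_def)
  moreover have "0 < ?\<beta> M" for M by (simp add: add_nonneg_pos)
  ultimately show "\<exists>c>0. \<exists>\<beta> :: real \<Rightarrow> real. (\<forall>M. 0 < \<beta> M) \<and>
      (\<forall>(V :: (nat \<Rightarrow> real) set) N n T.
         normed_space_on V N \<and> has_type2 V N \<and>
         linear_operator n V T \<and> (ell_norm n N T)\<^sup>2 \<ge> real n \<longrightarrow>
         large_coord_restriction c (\<beta> (type2_const V N)) N n T)"
    by (intro exI[of _ "1/16"] conjI exI[of _ ?\<beta>] allI impI) auto
next
  fix c :: real and \<beta> :: "real \<Rightarrow> real" and V :: "'v set" and N n T
  assume all: "(\<forall>M. 0 < \<beta> M) \<and>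
      (\<forall>(V :: (nat \<Rightarrow> real) set) N n T.
         normed_space_on V N \<and> has_type2 V N \<and>
         linear_operator n V T \<and> (ell_norm n N T)\<^sup>2 \<ge> real n \<longrightarrow>
         large_coord_restriction c (\<beta> (type2_const V N)) N n T)"
    and *: "normed_space_on V N \<and> has_type2 V N \<and> linear_operator n V T \<and> (ell_norm n N T)\<^sup>2 \<ge> real n"
  obtain V' :: "(nat \<Rightarrow> real) set" and N' T' where V':
    "normed_space_on V' N'" "has_type2 V' N'" "type2_const V' N' = type2_const V N"
    "linear_operator n V' T'" "\<And>x. x \<in> coord_space {1..n} \<Longrightarrow> N' (T' x) = N (T x)"
    using operator_transfer[of V N n T] * by metis
  have ell: "ell_norm n N' T' = ell_norm n N T"
    by (rule coord_restriction_cong(2)) (rule V'(5))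
  have restr: "large_coord_restriction c b N' n T' \<longleftrightarrow> large_coord_restriction c b N n T" for b
    by (rule coord_restriction_cong(3)) (rule V'(5))
  have "real n \<le> (ell_norm n N' T')\<^sup>2" using * by (simp only: ell)
  then have "large_coord_restriction c (\<beta> (type2_const V' N')) N' n T'"
    using all[THEN conjunct2, rule_format, of V' N' n T'] V'(1,2,4) by blast
  then show "large_coord_restriction c (\<beta> (type2_const V N)) N n T"
    unfolding V'(3) restr .
qed

end
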